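(* Let $g$ be a Riemannian metric on $T^3$. Let $\delta_0>0$ satisfy $C_{\mathrm{abs}}(\delta_0)<1/C_{\mathrm{flat}}$, and let $0<\delta<\delta_0$ satisfy $C_{\mathrm{end}}(\delta)>0$. If $\|g-g_{\mathrm{flat}}\|_{C^1}\le\delta$, then there exists $\xi\in C^\infty(T^3)$ such that $dx_1+d\xi\in\Omega^1(T^3)$ is nowhere vanishing and harmonic with respect to $g$.
   Context: $T^3=\mathbb{R}^3/\mathbb{Z}^3$ with coordinates $x_1,x_2,x_3$, flat metric $g_{\mathrm{flat}}=\sum dx_i^2$. For a metric $g$, $g_{ij}=g(\partial_i,\partial_j)$. For a matrix-valued function $A$ on $T^3$: $\|A\|_{C^0}=\max_{i,j,x}|A_{ij}(x)|$, $\|A\|_{C^1}=\|A\|_{C^0}+\|dA\|_{C^0}$ (with $\|dA\|_{C^0}$ the maximum over $i,j,k,x$ of $|\partial_kA_{ij}(x)|$); $g_{\mathrm{flat}}$ is the identity matrix. Flat constant: $C_{CZ}:=193$; $C_P:=(81/(4\pi))^{1/3}$; $C_{\mathrm{reg}}:=9C_{CZ}(3C_P+1)$; $C_{\Delta\chi}:=-180\big(-6+\tfrac{13}{6}(9+\sqrt3)-\tfrac14(9+\sqrt3)^2+\tfrac1{108}(9+\sqrt3)^3\big)$; $C_{D^2\chi}:=60(5\sqrt3-6)$; $C_H:=27^{1/12}$; $K:=3^{-1/2}(4/\pi^2)^{1/3}$; $C_S:=27\big(1+C_{\mathrm{reg}}C_{\Delta\chi}+(2+54\cdot27\sqrt{17})C_{\mathrm{reg}}C_HC_{D^2\chi}K\big)$;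 $C_{\mathrm{cube}}:=13.25$; $C_{\mathrm{flat}}:=\frac{1}{4\pi^2}C_SC_{\mathrm{cube}}(1+27\sqrt{17})+C_S(1+27C_{\mathrm{cube}})$. $\delta$-dependent constants (with $p=4$): $D_\pm(\delta)=(1\pm\delta)^3\pm2\delta^3\pm3(1+\delta)\delta^2$; $\Gamma_0=9\delta^2$; $E_\pm=(1\pm3\delta)^{1/2}$; $F_\pm=(1\pm18\delta(2+2\delta))^{1/2}$; $A_\pm=E_\pm D_\pm^{1/(2p)}$; $B_{\mathrm{up}}=A_+(1+3\sqrt3\Gamma_0)F_+D_+^{1/(2p)}$; $B_{\mathrm{low}}=A_-+(1-3\sqrt3\Gamma_0)D_-^{1/(2p)}F_-$; $C_{\mathrm{abs}}(\delta)=3\big((D_+^{1/(2p)}-1)(1+2\delta)+2\delta\big)+9\sqrt3(1+2\delta)\Gamma_0D_+^{1/(2p)}$; $C_{\mathrm{nonflat}}=\dfrac{B_{\mathrm{up}}C_{\mathrm{flat}}}{1-C_{\mathrm{flat}}C_{\mathrm{abs}}}$; $C_M=\max\big(\omega^{-1/4},(\int_{B(0,1)}|y|^{8/3}dy)^{3/4}\big)$ with $\omega=4\pi/3$ and $B(0,1)\subset\mathbb{R}^3$ the unit ball; $C_{1}=C_ME_+C_{\mathrm{nonflat}}/B_{\mathrm{low}}$; and $$C_{\mathrm{end}}(\delta)=E_--C_{1}(3+18\delta)\,\Gamma_0\,D_+^{1/(2p)},$$ all evaluated at $\delta$. *)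

theory Defs
  imports "HOL-Analysis.Analysis"
begin

text \<open>Points of T^3 = R^3/Z^3 are represented by their lifts in real^3; functions on T^3
  are Z^3-periodic functions on real^3. The coordinate x_1 corresponds to the index (1::3).\<close>

definition periodic3 :: "(real^3 \<Rightarrow> 'a) \<Rightarrow> bool" where
  "periodic3 f \<longleftrightarrow> (\<forall>x. \<forall>i::3. f (x + axis i 1) = f x)"

definition partial :: "(real^3 \<Rightarrow> real) \<Rightarrow> 3 \<Rightarrow> real^3 \<Rightarrow> real" where
  "partial f k x = deriv (\<lambda>t. f (x + t *\<^sub>R axis k 1)) 0"

definition smooth3 :: "(real^3 \<Rightarrow> real) \<Rightarrow> bool" where
  "smooth3 f \<longleftrightarrow> (\<exists>D :: 3 list \<Rightarrow> real^3 \<Rightarrow> real.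
      D [] = f \<and>
      (\<forall>ks. continuous_on UNIV (D ks)) \<and>
      (\<forall>ks k x. ((\<lambda>t. D ks (x + t *\<^sub>R axis k 1)) has_real_derivative D (k # ks) x) (at 0)))"

definition smooth_T3 :: "(real^3 \<Rightarrow> real) \<Rightarrow> bool" where
  "smooth_T3 f \<longleftrightarrow> smooth3 f \<and> periodic3 f"

text \<open>A Riemannian metric on T^3, given by its coefficient matrix g_ij(x) = g(d_i, d_j).\<close>
definition riemannian_metric_T3 :: "(real^3 \<Rightarrow> real^3^3) \<Rightarrow> bool" where
  "riemannian_metric_T3 g \<longleftrightarrow>
     (\<forall>i j. smooth_T3 (\<lambda>x. g x $ i $ j)) \<and>
     (\<forall>x. transpose (g x) = g x) \<and>
     (\<forall>x v. v \<noteq> 0 \<longrightarrow> v \<bullet> (g x *v v) > 0)"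

definition C0_norm :: "(real^3 \<Rightarrow> real^3^3) \<Rightarrow> real" where
  "C0_norm A = (SUP (i, j, x) \<in> (UNIV :: (3 \<times> 3 \<times> (real^3)) set). \<bar>A x $ i $ j\<bar>)"

definition dC0_norm :: "(real^3 \<Rightarrow> real^3^3) \<Rightarrow> real" where
  "dC0_norm A = (SUP (i, j, k, x) \<in> (UNIV :: (3 \<times> 3 \<times> 3 \<times> (real^3)) set).
                   \<bar>partial (\<lambda>y. A y $ i $ j) k x\<bar>)"

definition C1_norm :: "(real^3 \<Rightarrow> real^3^3) \<Rightarrow> real" where
  "C1_norm A = C0_norm A + dC0_norm A"

definition one_form :: "(real^3 \<Rightarrow> real) \<Rightarrow> real^3 \<Rightarrow> real^3" where
  "one_form \<xi> x = axis (1::3) 1 + (\<chi> k. partial \<xi> k x)"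

text \<open>Harmonic 1-form on the closed manifold (T^3, g): closed (d alpha = 0) and coclosed
  (d^* alpha = 0, i.e. sum_i d_i (sqrt(det g) g^{ij} alpha_j) = 0).\<close>
definition harmonic_1form :: "(real^3 \<Rightarrow> real^3^3) \<Rightarrow> (real^3 \<Rightarrow> real^3) \<Rightarrow> bool" where
  "harmonic_1form g \<alpha> \<longleftrightarrow>
     (\<forall>i j x. partial (\<lambda>y. \<alpha> y $ j) i x = partial (\<lambda>y. \<alpha> y $ i) j x) \<and>
     (\<forall>x. (\<Sum>i\<in>UNIV. partial (\<lambda>y. sqrt (det (g y)) * (\<Sum>j\<in>UNIV. matrix_inv (g y) $ i $ j * \<alpha> y $ j)) i x) = 0)"

definition nowhere_vanishing :: "(real^3 \<Rightarrow> real^3) \<Rightarrow> bool" where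
  "nowhere_vanishing \<alpha> \<longleftrightarrow> (\<forall>x. \<alpha> x \<noteq> 0)"

definition C_CZ :: real where "C_CZ = 193"
definition C_P :: real where "C_P = (81 / (4 * pi)) powr (1/3)"
definition C_reg :: real where "C_reg = 9 * C_CZ * (3 * C_P + 1)"
definition C_Dchi :: real where
  "C_Dchi = - 180 * (- 6 + 13/6 * (9 + sqrt 3) - 1/4 * (9 + sqrt 3)^2 + 1/108 * (9 + sqrt 3)^3)"
definition C_D2chi :: real where "C_D2chi = 60 * (5 * sqrt 3 - 6)"
definition C_H :: real where "C_H = 27 powr (1/12)"
definition K_const :: real where "K_const = 3 powr (-1/2) * (4 / pi^2) powr (1/3)"
definition C_S :: real where
  "C_S = 27 * (1 + C_reg * C_Dchi + (2 + 54 * 27 * sqrt 17) * C_reg * C_H * C_D2chi * K_const)"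
definition C_cube :: real where "C_cube = 13.25"
definition C_flat :: real where
  "C_flat = 1 / (4 * pi^2) * C_S * C_cube * (1 + 27 * sqrt 17) + C_S * (1 + 27 * C_cube)"

definition p_exp :: real where "p_exp = 4"

definition D_plus :: "real \<Rightarrow> real" where
  "D_plus d = (1 + d)^3 + 2 * d^3 + 3 * (1 + d) * d^2"
definition D_minus :: "real \<Rightarrow> real" where
  "D_minus d = (1 - d)^3 - 2 * d^3 - 3 * (1 + d) * d^2"
definition Gamma0 :: "real \<Rightarrow> real" where "Gamma0 d = 9 * d^2"
definition E_plus :: "real \<Rightarrow> real" where "E_plus d = sqrt (1 + 3 * d)"
definition E_minus :: "real \<Rightarrow> real" where "E_minus d = sqrt (1 - 3 * d)"
definition F_plus :: "real \<Rightarrow> real" where "F_plus d = sqrt (1 + 18 * d * (2 + 2 * d))"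
definition F_minus :: "real \<Rightarrow> real" where "F_minus d = sqrt (1 - 18 * d * (2 + 2 * d))"
definition A_plus :: "real \<Rightarrow> real" where "A_plus d = E_plus d * D_plus d powr (1 / (2 * p_exp))"
definition A_minus :: "real \<Rightarrow> real" where "A_minus d = E_minus d * D_minus d powr (1 / (2 * p_exp))"
definition B_up :: "real \<Rightarrow> real" where
  "B_up d = A_plus d * (1 + 3 * sqrt 3 * Gamma0 d) * F_plus d * D_plus d powr (1 / (2 * p_exp))"
definition B_low :: "real \<Rightarrow> real" where
  "B_low d = A_minus d + (1 - 3 * sqrt 3 * Gamma0 d) * D_minus d powr (1 / (2 * p_exp)) * F_minus d"
definition C_abs :: "real \<Rightarrow> real" where
  "C_abs d = 3 * ((D_plus d powr (1 / (2 * p_exp)) - 1) * (1 + 2 * d) + 2 * d)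
             + 9 * sqrt 3 * (1 + 2 * d) * Gamma0 d * D_plus d powr (1 / (2 * p_exp))"
definition C_nonflat :: "real \<Rightarrow> real" where
  "C_nonflat d = B_up d * C_flat / (1 - C_flat * C_abs d)"
definition omega3 :: real where "omega3 = 4 * pi / 3"
definition C_M :: real where
  "C_M = max (omega3 powr (-1/4))
             ((integral (ball (0::real^3) 1) (\<lambda>y. norm y powr (8/3))) powr (3/4))"
definition C_one :: "real \<Rightarrow> real" where
  "C_one d = C_M * E_plus d * C_nonflat d / B_low d"
definition C_end :: "real \<Rightarrow> real" where
  "C_end d = E_minus d - C_one d * (3 + 18 * d) * Gamma0 d * D_plus d powr (1 / (2 * p_exp))"

end

theory Submission
  imports Defs
begin

text \<open>
  Write \<open>A = sqrt (det g) g\<^sup>-\<^sup>1\<close>. The form \<open>dx\<^sub>1 + d\<xi>\<close> is harmonic iff \<open>div (A (e\<^sub>1 + \<nabla>\<xi>)) = 0\<close>. The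
  constant \<open>C_flat\<close> is so large that the hypothesis on \<open>\<delta>0\<close> alone forces \<open>A - I\<close> to be tiny in
  \<open>C\<^sup>1\<close>, and this suffices, by a route that avoids Calderon--Zygmund theory.

  Existence: \<open>\<xi> = \<Sum>n. \<eta>\<^sub>n\<close> with \<open>\<Delta>\<eta>\<^sub>0 = - div (A e\<^sub>1)\<close> and \<open>\<Delta>\<eta>\<^sub>n\<^sub>+\<^sub>1 = - div ((A - I) \<nabla>\<eta>\<^sub>n)\<close>, where each Poisson
  equation is solved by Fourier series. The energy estimate makes the sequence contract in \<open>H\<^sup>1\<close>;
  since the commutator of \<open>A - I\<close> with derivatives has lower order, the series converges in every
  Sobolev norm, hence \<open>\<xi>\<close> is smooth.

  Nonvanishing: \<open>\<xi>\<close> solves the nondivergence equation \<open>A\<^sub>i\<^sub>j \<partial>\<^sub>i\<partial>\<^sub>j\<xi> = f\<close> with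
  \<open>\<bar>f\<bar> \<le> C \<delta> (1 + sup \<bar>\<nabla>\<xi>\<bar>)\<close> and Lipschitz coefficients. The maximum principle applied to
  \<open>\<xi> x - \<xi> y - \<phi> (norm (x - y))\<close> (the Ishii--Lions method with a reflection coupling) bounds the
  Lipschitz constant of \<open>\<xi>\<close> by a multiple of \<open>sup \<bar>f\<bar>\<close>, so \<open>\<bar>\<nabla>\<xi>\<bar> < 1\<close>.
\<close>

section \<open>Smooth functions and iterated partial derivatives\<close>

text \<open>The two halves need constants of different quality. Existence tolerates constants that
  are merely known to exist: in each Sobolev norm only the leading factor \<open>9 * \<beta>\<close>
  has to be below 1, since lower orders enter as an already summable forcing term. Nonvanishing
  needs explicit numbers, because the gradient of \<xi> must be shown smaller than 1 and not just
  finite; the Fourier embedding constants are never computed and cannot give that, whereas the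
  maximum principle comes with numbers.

  The right-hand side of the nondivergence equation contains the very gradient that is to be
  bounded. Since \<xi> is already smooth and periodic, its largest partial derivative is finite, so
  it can be absorbed.

  Smoothness is phrased through derivatives along the coordinate axes. Fourier inversion therefore
  has a second purpose beside the Poisson equation: it supplies the symmetry of mixed partials and
  the derivatives in oblique directions, which the reflection coupling uses.\<close>

primrec pds :: "3 list \<Rightarrow> (real^3 \<Rightarrow> real) \<Rightarrow> real^3 \<Rightarrow> real" where
  "pds [] f = f"
| "pds (k # ks) f = partial (pds ks f) k"

text \<open>\<open>deriv\<close> is total, so an equation about \<open>partial\<close> does not say
  that the derivative exists; this predicate carries existence as well.\<close>

definition has_partials :: "(real^3 \<Rightarrow> real) \<Rightarrow> (3 \<Rightarrow> real^3 \<Rightarrow> real) \<Rightarrow> bool" where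
  "has_partials f f' \<longleftrightarrow>
     (\<forall>k x. ((\<lambda>t. f (x + t *\<^sub>R axis k 1)) has_real_derivative f' k x) (at 0))"

lemma has_partials_imp_partial:
  assumes "has_partials f f'" shows "partial f k = f' k"
  using assms unfolding has_partials_def partial_def by (auto intro!: ext DERIV_imp_deriv)

lemma has_partials_line:
  assumes "has_partials f f'"
  shows "((\<lambda>t. f (x + t *\<^sub>R axis k 1)) has_real_derivative f' k (x + s *\<^sub>R axis k 1)) (at s)"
proof -
  have "((\<lambda>t. f ((x + s *\<^sub>R axis k 1) + t *\<^sub>R axis k 1)) has_real_derivative
      f' k (x + s *\<^sub>R axis k 1)) (at 0)"
    using assms unfolding has_partials_def by blast
  then have "((\<lambda>t. f (x + (t + s) *\<^sub>R axis k 1)) has_real_derivative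
      f' k (x + s *\<^sub>R axis k 1)) (at 0)"
    by (simp add: scaleR_add_left add_ac)
  then show ?thesis
    using DERIV_shift[of "\<lambda>t. f (x + t *\<^sub>R axis k 1)" _ 0 s] by simp
qed

lemma pds_append: "pds (ks @ ls) f = pds ks (pds ls f)"
  by (induction ks) auto

text \<open>The family in \<open>smooth3\<close> is forced: each member is the derivative of an
  earlier one, so it must be \<open>pds\<close>. This trades the existential for canonical iterated
  derivatives.\<close>

lemma smooth3_iff:
  "smooth3 f \<longleftrightarrow> (\<forall>ks. continuous_on UNIV (pds ks f) \<and> has_partials (pds ks f) (partial (pds ks f)))"
proof
  assume "smooth3 f"
  then obtain D where D: "D [] = f" "\<And>ks. continuous_on UNIV (D ks)"
    "\<And>ks k x. ((\<lambda>t. D ks (x + t *\<^sub>R axis k 1)) has_real_derivative D (k # ks) x) (at 0)"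
    unfolding smooth3_def by blast
  have hp: "has_partials (D ks) (\<lambda>k. D (k # ks))" for ks
    using D(3) unfolding has_partials_def by blast
  have eq: "pds ks f = D ks" for ks
    by (induction ks) (auto simp: D(1) has_partials_imp_partial[OF hp])
  show "\<forall>ks. continuous_on UNIV (pds ks f) \<and> has_partials (pds ks f) (partial (pds ks f))"
    using D(2) hp has_partials_imp_partial[OF hp] by (auto simp: eq has_partials_def)
next
  assume "\<forall>ks. continuous_on UNIV (pds ks f) \<and> has_partials (pds ks f) (partial (pds ks f))"
  then show "smooth3 f"
    unfolding smooth3_def has_partials_def by (intro exI[of _ "\<lambda>ks. pds ks f"]) auto
qed

text \<open>Smoothness as a greatest fixed point: closure properties follow by exhibiting one set of
  continuous functions stable under differentiation, without formulas for higher
  derivatives.\<close>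

lemma smooth3_coinduct:
  assumes "f \<in> S" and "\<And>h. h \<in> S \<Longrightarrow> continuous_on UNIV h"
    and "\<And>h. h \<in> S \<Longrightarrow> \<exists>h'. (\<forall>k. h' k \<in> S) \<and> has_partials h h'"
  shows "smooth3 f"
proof -
  have mem: "pds ks f \<in> S" for ks
  proof (induction ks)
    case (Cons k ks)
    then obtain h' where "\<forall>k. h' k \<in> S" "has_partials (pds ks f) h'"
      using assms(3) by blast
    then show ?case using has_partials_imp_partial by auto
  qed (simp add: assms(1))
  have "has_partials (pds ks f) (partial (pds ks f))" for ks
  proof -
    obtain h' where "has_partials (pds ks f) h'" using assms(3) mem by blast
    moreover from this have "partial (pds ks f) = h'"
      using has_partials_imp_partial by (intro ext) auto
    ultimately show ?thesis by simp
  qed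
  then show ?thesis unfolding smooth3_iff using assms(2) mem by blast
qed

lemma smooth3_continuous: "smooth3 f \<Longrightarrow> continuous_on S f"
  using smooth3_iff[of f] pds.simps(1) continuous_on_subset by (metis subset_UNIV)

lemma smooth3_has_partials: "smooth3 f \<Longrightarrow> has_partials f (partial f)"
  using smooth3_iff[of f] pds.simps(1) by metis

lemma smooth3_pds: "smooth3 f \<Longrightarrow> smooth3 (pds ks f)"
  unfolding smooth3_iff by (metis pds_append)

lemma smooth3_partial: "smooth3 f \<Longrightarrow> smooth3 (partial f k)"
  using smooth3_pds[of f "[k]"] by simp

section \<open>Differentiation rules and closure properties of smooth functions\<close>

lemma has_partials_const: "has_partials (\<lambda>x. c) (\<lambda>k x. 0)"
  unfolding has_partials_def by auto

lemma has_partials_add: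
  "has_partials f f' \<Longrightarrow> has_partials h h' \<Longrightarrow> has_partials (\<lambda>x. f x + h x) (\<lambda>k x. f' k x + h' k x)"
  unfolding has_partials_def by (auto intro!: DERIV_add)

lemma has_partials_mult:
  "has_partials f f' \<Longrightarrow> has_partials h h' \<Longrightarrow>
    has_partials (\<lambda>x. f x * h x) (\<lambda>k x. f' k x * h x + f x * h' k x)"
  unfolding has_partials_def by (auto intro!: derivative_eq_intros)

lemma has_partials_powr:
  assumes "has_partials f f'" "\<And>x. f x > 0"
  shows "has_partials (\<lambda>x. f x powr a) (\<lambda>k x. a * f x powr (a - 1) * f' k x)"
  unfolding has_partials_def
proof (intro allI)
  fix k x
  have "((\<lambda>t. f (x + t *\<^sub>R axis k 1)) has_real_derivative f' k x) (at 0)"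
    using assms(1) unfolding has_partials_def by blast
  moreover have "((\<lambda>z. z powr a) has_real_derivative a * f x powr (a - 1)) (at (f (x + 0 *\<^sub>R axis k 1)))"
    using has_real_derivative_powr[OF assms(2)[of x], of a] by simp
  ultimately show "((\<lambda>t. f (x + t *\<^sub>R axis k 1) powr a) has_real_derivative
      a * f x powr (a - 1) * f' k x) (at 0)"
    using DERIV_chain2 by fastforce
qed

text \<open>The stable set for \<open>smooth3_coinduct\<close>. Derivatives of products and powers
  mix all the operations, so these are closed simultaneously; the function raised to a power is kept
  smooth so that its inner derivative falls under \<open>base\<close>.\<close>

inductive smooth_closure :: "(real^3 \<Rightarrow> real) \<Rightarrow> bool" where
  base: "smooth3 f \<Longrightarrow> smooth_closure f"
| const: "smooth_closure (\<lambda>x. c)"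
| add: "smooth_closure f \<Longrightarrow> smooth_closure h \<Longrightarrow> smooth_closure (\<lambda>x. f x + h x)"
| mult: "smooth_closure f \<Longrightarrow> smooth_closure h \<Longrightarrow> smooth_closure (\<lambda>x. f x * h x)"
| powr: "smooth3 f \<Longrightarrow> (\<And>x. f x > 0) \<Longrightarrow> smooth_closure (\<lambda>x. f x powr a)"

lemma smooth_closure_continuous: "smooth_closure f \<Longrightarrow> continuous_on UNIV f"
proof (induction rule: smooth_closure.induct)
  case (powr f a)
  then show ?case
    by (intro continuous_on_powr smooth3_continuous continuous_on_const) (auto simp: less_le)
next
  case (base f)
  then show ?case by (rule smooth3_continuous)
qed (intro continuous_intros; assumption)+

lemma smooth_closure_partials:
  "smooth_closure f \<Longrightarrow> \<exists>f'. (\<forall>k. smooth_closure (f' k)) \<and> has_partials f f'"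
proof (induction rule: smooth_closure.induct)
  case (base f)
  then show ?case
    using smooth3_has_partials smooth3_partial smooth_closure.base by blast
next
  case (const c)
  show ?case
    by (intro exI[of _ "\<lambda>k x. 0"]) (auto intro: has_partials_const smooth_closure.const)
next
  case (add f h)
  then obtain f' h' where "\<forall>k. smooth_closure (f' k)" "has_partials f f'"
    "\<forall>k. smooth_closure (h' k)" "has_partials h h'" by blast
  then show ?case
    by (intro exI[of _ "\<lambda>k x. f' k x + h' k x"]) (auto intro: smooth_closure.intros has_partials_add)
next
  case (mult f h)
  then obtain f' h' where "\<forall>k. smooth_closure (f' k)" "has_partials f f'"
    "\<forall>k. smooth_closure (h' k)" "has_partials h h'" by blast
  then show ?case
    using mult.hyps
    by (intro exI[of _ "\<lambda>k x. f' k x * h x + f x * h' k x"])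
       (auto intro!: smooth_closure.add smooth_closure.mult has_partials_mult)
next
  case (powr f a)
  have "smooth_closure (\<lambda>x. a * f x powr (a - 1) * partial f k x)" for k
    using powr smooth3_partial by (intro smooth_closure.mult smooth_closure.const
        smooth_closure.powr smooth_closure.base) auto
  then show ?case
    using has_partials_powr[OF smooth3_has_partials[OF powr(1)] powr(2)]
    by (intro exI[of _ "\<lambda>k x. a * f x powr (a - 1) * partial f k x"]) auto
qed

lemma smooth_closure_smooth3: "smooth_closure f \<Longrightarrow> smooth3 f"
  by (rule smooth3_coinduct[of f "Collect smooth_closure"])
     (auto simp: smooth_closure_continuous smooth_closure_partials)

lemma smooth3_const: "smooth3 (\<lambda>x. c)"
  and smooth3_add: "smooth3 f \<Longrightarrow> smooth3 h \<Longrightarrow> smooth3 (\<lambda>x. f x + h x)"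
  and smooth3_mult: "smooth3 f \<Longrightarrow> smooth3 h \<Longrightarrow> smooth3 (\<lambda>x. f x * h x)"
  and smooth3_powr: "smooth3 f \<Longrightarrow> (\<And>x. f x > 0) \<Longrightarrow> smooth3 (\<lambda>x. f x powr a)"
  by (blast intro: smooth_closure_smooth3 smooth_closure.intros)+

lemma smooth3_minus: "smooth3 f \<Longrightarrow> smooth3 (\<lambda>x. - f x)"
  using smooth3_mult[OF smooth3_const[of "-1"]] by simp

lemma smooth3_diff: "smooth3 f \<Longrightarrow> smooth3 h \<Longrightarrow> smooth3 (\<lambda>x. f x - h x)"
  using smooth3_add[OF _ smooth3_minus] by simp

lemma smooth3_sum: "finite I \<Longrightarrow> (\<And>i. i \<in> I \<Longrightarrow> smooth3 (f i)) \<Longrightarrow> smooth3 (\<lambda>x. \<Sum>i\<in>I. f i x)"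
  by (induction I rule: finite_induct) (auto intro: smooth3_const smooth3_add)

lemma partial_const: "partial (\<lambda>x. c) k = (\<lambda>x. 0)"
  using has_partials_imp_partial[OF has_partials_const] by simp

lemma partial_add:
  "smooth3 f \<Longrightarrow> smooth3 h \<Longrightarrow> partial (\<lambda>x. f x + h x) k = (\<lambda>x. partial f k x + partial h k x)"
  by (rule has_partials_imp_partial[OF has_partials_add]) (auto intro: smooth3_has_partials)

lemma partial_mult:
  "smooth3 f \<Longrightarrow> smooth3 h \<Longrightarrow>
    partial (\<lambda>x. f x * h x) k = (\<lambda>x. partial f k x * h x + f x * partial h k x)"
  by (rule has_partials_imp_partial[OF has_partials_mult]) (auto intro: smooth3_has_partials)

lemma partial_powr:
  "smooth3 f \<Longrightarrow> (\<And>x. f x > 0) \<Longrightarrow>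
    partial (\<lambda>x. f x powr a) k = (\<lambda>x. a * f x powr (a - 1) * partial f k x)"
  by (rule has_partials_imp_partial[OF has_partials_powr]) (auto intro: smooth3_has_partials)

lemma partial_cmult: "smooth3 f \<Longrightarrow> partial (\<lambda>x. c * f x) k = (\<lambda>x. c * partial f k x)"
  using partial_mult[OF smooth3_const] by (simp add: partial_const)

lemma partial_minus: "smooth3 f \<Longrightarrow> partial (\<lambda>x. - f x) k = (\<lambda>x. - partial f k x)"
  using partial_cmult[of f "-1"] by simp

lemma partial_diff:
  "smooth3 f \<Longrightarrow> smooth3 h \<Longrightarrow> partial (\<lambda>x. f x - h x) k = (\<lambda>x. partial f k x - partial h k x)"
  using partial_add[of f "\<lambda>x. - h x"] by (simp add: smooth3_minus partial_minus)

lemma partial_sum: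
  "finite I \<Longrightarrow> (\<And>i. i \<in> I \<Longrightarrow> smooth3 (f i)) \<Longrightarrow>
    partial (\<lambda>x. \<Sum>i\<in>I. f i x) k = (\<lambda>x. \<Sum>i\<in>I. partial (f i) k x)"
  by (induction I rule: finite_induct) (auto simp: partial_const partial_add smooth3_sum)

text \<open>Weierstrass test at every order: the majorant \<open>M ks\<close> may grow with the
  order but not with the point, so every differentiated series converges uniformly and its sum is
  the derivative of the sum one order below.\<close>

lemma smooth3_series:
  assumes sm: "\<And>n. smooth3 (f n)"
    and bd: "\<And>ks n x. \<bar>pds ks (f n) x\<bar> \<le> M ks n" and su: "\<And>ks. summable (M ks)"
  shows "smooth3 (\<lambda>x. \<Sum>n. f n x)"
    and "pds ks (\<lambda>x. \<Sum>n. f n x) = (\<lambda>x. \<Sum>n. pds ks (f n) x)"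
proof -
  define D where "D ks x = (\<Sum>n. pds ks (f n) x)" for ks x
  have ul: "uniform_limit A (\<lambda>n x. \<Sum>i<n. pds ks (f i) x) (D ks) sequentially" for ks A
    unfolding D_def by (rule Weierstrass_m_test[OF _ su[of ks]]) (use bd in auto)
  have cont: "continuous_on UNIV (D ks)" for ks
    by (rule uniform_limit_theorem[OF _ ul])
       (auto intro!: always_eventually smooth3_continuous smooth3_sum smooth3_pds sm)
  have summ: "summable (\<lambda>n. pds ks (f n) x)" for ks x
    by (rule summable_comparison_test'[OF su[of ks], of 0]) (use bd in simp)
  have hp: "has_partials (D ks) (\<lambda>k. D (k # ks))" for ks
    unfolding has_partials_def
  proof (intro allI)
    fix k x
    \<comment> \<open>On an axis line the claim is the one-variable theorem on termwise
      differentiation.\<close>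
    let ?l = "\<lambda>t::real. x + t *\<^sub>R (axis k 1 :: real^3)"
    have "\<exists>g. \<forall>t\<in>UNIV. (\<lambda>n. pds ks (f n) (?l t)) sums g t \<and>
        (g has_field_derivative D (k # ks) (?l t)) (at t within UNIV)"
    proof (rule has_field_derivative_series)
      show "((\<lambda>t. pds ks (f n) (?l t)) has_field_derivative pds (k # ks) (f n) (?l t)) (at t within UNIV)"
        for n t
        using has_partials_line[OF smooth3_has_partials[OF smooth3_pds[OF sm]]] by simp
      show "uniform_limit UNIV (\<lambda>n t. \<Sum>i<n. pds (k # ks) (f i) (?l t))
         (\<lambda>t. D (k # ks) (?l t)) sequentially"
        by (rule uniform_limit_compose'[OF ul[of "k # ks" UNIV]]) auto
      show "summable (\<lambda>n. pds ks (f n) (?l 0))" by (rule summ)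
    qed auto
    then obtain g where g: "\<And>t. (\<lambda>n. pds ks (f n) (?l t)) sums g t"
      "\<And>t. (g has_field_derivative D (k # ks) (?l t)) (at t)" by auto
    have "g = (\<lambda>t. D ks (?l t))"
      unfolding D_def using g(1) by (auto intro!: ext simp: sums_iff)
    then show "((\<lambda>t. D ks (x + t *\<^sub>R axis k 1)) has_real_derivative D (k # ks) x) (at 0)"
      using g(2)[of 0] by simp
  qed
  have f0: "(\<lambda>x. \<Sum>n. f n x) = D []" by (auto simp: D_def)
  have "pds ks (D []) = D ks" for ks
    by (induction ks) (auto simp: has_partials_imp_partial[OF hp])
  then show "pds ks (\<lambda>x. \<Sum>n. f n x) = (\<lambda>x. \<Sum>n. pds ks (f n) x)"
    by (auto simp: f0 D_def)
  show "smooth3 (\<lambda>x. \<Sum>n. f n x)"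
    unfolding f0
  proof (rule smooth3_coinduct[of _ "range D"])
    fix h assume "h \<in> range D"
    then obtain ks where h: "h = D ks" by blast
    show "continuous_on UNIV h" unfolding h by (rule cont)
    show "\<exists>h'. (\<forall>k. h' k \<in> range D) \<and> has_partials h h'"
      unfolding h using hp[of ks] by (intro exI[of _ "\<lambda>k. D (k # ks)"]) auto
  qed auto
qed

section \<open>Periodic functions and their mean\<close>

definition lattice_pt :: "int^3 \<Rightarrow> real^3" where
  "lattice_pt k = (\<chi> i. of_int (k $ i))"

lemma periodic3_int_axis:
  assumes "periodic3 f" shows "f (x + of_int n *\<^sub>R axis i 1) = f x"
proof (induction n rule: int_induct[where k=0])
  case (step1 n)
  have "f (x + of_int (n + 1) *\<^sub>R axis i 1) = f ((x + of_int n *\<^sub>R axis i 1) + axis i 1)"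
    by (simp add: algebra_simps)
  then show ?case using assms step1 unfolding periodic3_def by metis
next
  case (step2 n)
  have "f (x + of_int n *\<^sub>R axis i 1) = f ((x + of_int (n - 1) *\<^sub>R axis i 1) + axis i 1)"
    by (simp add: algebra_simps)
  then show ?case using assms step2 unfolding periodic3_def by metis
qed auto

lemma lattice_pt_sum: "lattice_pt k = (\<Sum>i\<in>UNIV. of_int (k $ i) *\<^sub>R axis i 1)"
  unfolding lattice_pt_def by (simp add: vec_eq_iff axis_def sum_3 forall_3)

lemma periodic3_lattice:
  assumes "periodic3 f" shows "f (x + lattice_pt k) = f x"
  unfolding lattice_pt_sum sum_3
  using periodic3_int_axis[OF assms] by (simp flip: add.assoc)

lemma ex_lattice_cube: "\<exists>k. x + lattice_pt k \<in> cbox 0 1"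
  by (rule exI[of _ "\<chi> i. - \<lfloor>x $ i\<rfloor>"]) (simp add: mem_box_cart lattice_pt_def, intro allI conjI, linarith+)

lemma periodic3_cube:
  assumes "periodic3 f" and "\<And>x. x \<in> cbox 0 1 \<Longrightarrow> P (f x)" shows "P (f x)"
  using ex_lattice_cube[of x] periodic3_lattice[OF assms(1)] assms(2) by metis

lemma periodic3_attains_sup:
  fixes f :: "real^3 \<Rightarrow> real"
  assumes "periodic3 f" "continuous_on UNIV f"
  shows "\<exists>x. \<forall>y. f y \<le> f x"
proof -
  have "\<exists>x\<in>cbox 0 (1::real^3). \<forall>y\<in>cbox 0 1. f y \<le> f x"
    by (rule continuous_attains_sup)
       (auto intro: continuous_on_subset[OF assms(2)] simp: interval_ne_empty_cart)
  then obtain x where "\<forall>y\<in>cbox 0 1. f y \<le> f x" by blast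
  then show ?thesis
    using periodic3_cube[OF assms(1), of "\<lambda>v. v \<le> f x"] by blast
qed

lemma periodic3_compose: "periodic3 f \<Longrightarrow> periodic3 (\<lambda>x. F (f x))"
  unfolding periodic3_def by auto

lemma periodic3_bounded:
  fixes f :: "real^3 \<Rightarrow> 'a::real_normed_vector"
  assumes "periodic3 f" "continuous_on UNIV f"
  shows "\<exists>B\<ge>0. \<forall>x. norm (f x) \<le> B"
proof -
  obtain z where "\<forall>y. norm (f y) \<le> norm (f z)"
    using periodic3_attains_sup[OF periodic3_compose[OF assms(1), of norm]]
      continuous_on_norm[OF assms(2)] by auto
  then show ?thesis by (intro exI[of _ "norm (f z)"]) auto
qed

section \<open>Averages over a fundamental cube\<close>

definition mean :: "(real^3 \<Rightarrow> 'b::banach) \<Rightarrow> 'b" where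
  "mean f = integral (cbox 0 1) f"

lemma mean_integrable:
  fixes f :: "real^3 \<Rightarrow> 'b::banach"
  shows "continuous_on UNIV f \<Longrightarrow> f integrable_on cbox a b"
  by (rule integrable_continuous) (rule continuous_on_subset, auto)

text \<open>Shifting the cube by \<open>t\<close> along one axis keeps \<open>?U\<close>, the part
  of the unit cube above height \<open>t\<close>, and adds an overhanging slab, which one period
  carries back to the lower part \<open>?L\<close>. This range of \<open>t\<close> is enough for a
  one-sided derivative at 0.\<close>

lemma mean_shift:
  fixes f :: "real^3 \<Rightarrow> 'b::banach"
  assumes per: "periodic3 f" and cont: "continuous_on UNIV f" and t: "0 \<le> t" "t \<le> 1"
  shows "mean (\<lambda>x. f (x + t *\<^sub>R axis j 1)) = mean f"
proof -
  let ?e = "axis j 1 :: real^3"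
  have e: "?e \<in> Basis" by (auto simp: axis_in_Basis_iff)
  let ?L = "cbox 0 (1 - (1 - t) *\<^sub>R ?e)" and ?U = "cbox (t *\<^sub>R ?e) 1"
  have ie: "x \<bullet> ?e = x $ j" for x by (simp add: inner_axis)
  have sets: "cbox 0 1 \<inter> {x. x \<bullet> ?e \<le> t} = ?L" "cbox 0 1 \<inter> {x. x \<bullet> ?e \<ge> t} = ?U"
    "cbox (t *\<^sub>R ?e) (1 + t *\<^sub>R ?e) \<inter> {x. x \<bullet> ?e \<le> 1} = ?U"
    "cbox (t *\<^sub>R ?e) (1 + t *\<^sub>R ?e) \<inter> {x. x \<bullet> ?e \<ge> 1} = cbox ?e (1 + t *\<^sub>R ?e)"
    unfolding ie interval_split_cart[unfolded interval_cbox_cart]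
    by (rule arg_cong2[where f=cbox]; use t in \<open>force simp: vec_eq_iff axis_def\<close>)+
  have "mean (\<lambda>x. f (x + t *\<^sub>R ?e)) = integral (cbox (t *\<^sub>R ?e) (1 + t *\<^sub>R ?e)) f"
    unfolding mean_def using integral_shift_cbox[of "t *\<^sub>R ?e" "t *\<^sub>R ?e" "1 + t *\<^sub>R ?e" f] by simp
  also have "\<dots> = integral ?U f + integral (cbox ?e (1 + t *\<^sub>R ?e)) f"
    using integral_split[OF mean_integrable[OF cont] e, of "t *\<^sub>R ?e" "1 + t *\<^sub>R ?e" 1]
    by (simp add: sets)
  also have "integral (cbox ?e (1 + t *\<^sub>R ?e)) f = integral ?L (\<lambda>x. f (x + ?e))"
    using integral_shift_cbox[of ?e ?e "1 + t *\<^sub>R ?e" f] by (simp add: algebra_simps)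
  also have "(\<lambda>x. f (x + ?e)) = f" using per unfolding periodic3_def by auto
  also have "integral ?U f + integral ?L f = mean f"
    unfolding mean_def
    using integral_split[OF mean_integrable[OF cont] e, of 0 1 t] by (simp add: sets)
  finally show ?thesis .
qed

text \<open>The average of a translate is constant in the translation parameter; differentiate under
  the integral at 0. Integration by parts and the orthogonality of characters both rest on
  this.\<close>

lemma mean_derivative_zero:
  fixes f f' :: "real^3 \<Rightarrow> 'b::banach"
  assumes per: "periodic3 f" and cont: "continuous_on UNIV f" "continuous_on UNIV f'"
    and der: "\<And>x. ((\<lambda>t. f (x + t *\<^sub>R axis j 1)) has_vector_derivative f' x) (at 0)"
  shows "mean f' = 0"
proof -
  let ?e = "axis j 1 :: real^3"
  have line: "((\<lambda>t. f (x + t *\<^sub>R ?e)) has_vector_derivative f' (x + s *\<^sub>R ?e)) (at s)" for x s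
  proof -
    have "((\<lambda>t. f ((x + s *\<^sub>R ?e) + t *\<^sub>R ?e)) \<circ> (\<lambda>t. t - s) has_vector_derivative
       1 *\<^sub>R f' (x + s *\<^sub>R ?e)) (at s)"
      by (rule vector_diff_chain_at) (auto intro!: derivative_eq_intros der)
    then show ?thesis by (simp add: o_def algebra_simps)
  qed
  have "((\<lambda>t. integral (cbox 0 1) (\<lambda>x. f (x + t *\<^sub>R ?e))) has_vector_derivative
      integral (cbox 0 1) (\<lambda>x. f' (x + 0 *\<^sub>R ?e))) (at 0 within {0..1})"
  proof (rule leibniz_rule_vector_derivative)
    show "((\<lambda>t. f (x + t *\<^sub>R ?e)) has_vector_derivative f' (x + t *\<^sub>R ?e)) (at t within {0..1})"
      for x t using line has_vector_derivative_at_within by blast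
    show "(\<lambda>x. f (x + t *\<^sub>R ?e)) integrable_on cbox 0 1" for t
      by (intro mean_integrable continuous_on_compose2[OF cont(1)] continuous_intros) auto
    show "continuous_on ({0..1} \<times> cbox 0 1) (\<lambda>(t, x). f' (x + t *\<^sub>R ?e))"
      unfolding split_beta
      by (intro continuous_on_compose2[OF cont(2)] continuous_intros) auto
  qed auto
  then have 1: "((\<lambda>t. mean (\<lambda>x. f (x + t *\<^sub>R ?e))) has_vector_derivative mean f') (at 0 within {0..1})"
    by (simp add: mean_def)
  have 2: "((\<lambda>t. mean (\<lambda>x. f (x + t *\<^sub>R ?e))) has_vector_derivative 0) (at 0 within {0..1})"
    by (rule has_vector_derivative_transform[of _ _ _ "\<lambda>t. mean f"])
       (auto simp: mean_shift[OF per cont(1)])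
  show ?thesis
    by (rule vector_derivative_unique_within[OF _ 1 2]) (simp add: trivial_limit_within islimpt_Icc)
qed

lemma mean_add:
  fixes f h :: "real^3 \<Rightarrow> 'b::banach"
  shows "continuous_on UNIV f \<Longrightarrow> continuous_on UNIV h \<Longrightarrow> mean (\<lambda>x. f x + h x) = mean f + mean h"
  unfolding mean_def by (intro integral_add mean_integrable)

lemma mean_diff:
  fixes f h :: "real^3 \<Rightarrow> 'b::banach"
  shows "continuous_on UNIV f \<Longrightarrow> continuous_on UNIV h \<Longrightarrow> mean (\<lambda>x. f x - h x) = mean f - mean h"
  unfolding mean_def by (intro integral_diff mean_integrable)

lemma mean_mult_left:
  fixes f :: "real^3 \<Rightarrow> 'b::{banach,real_normed_field}"
  shows "mean (\<lambda>x. c * f x) = c * mean f"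
  unfolding mean_def by (rule integral_mult_right)

lemma mean_const: "mean (\<lambda>x. c :: 'b::banach) = c"
proof -
  have "measure lborel (cbox 0 (1::real^3)) = 1"
    by (simp add: content_cbox_cart interval_ne_empty_cart)
  then show ?thesis by (simp add: mean_def)
qed

lemma mean_mono:
  fixes f h :: "real^3 \<Rightarrow> real"
  shows "continuous_on UNIV f \<Longrightarrow> continuous_on UNIV h \<Longrightarrow> (\<And>x. f x \<le> h x) \<Longrightarrow> mean f \<le> mean h"
  unfolding mean_def by (intro integral_le mean_integrable) auto

lemma mean_sum:
  fixes f :: "'i \<Rightarrow> real^3 \<Rightarrow> 'b::banach"
  shows "finite I \<Longrightarrow> (\<And>i. i \<in> I \<Longrightarrow> continuous_on UNIV (f i)) \<Longrightarrow>
    mean (\<lambda>x. \<Sum>i\<in>I. f i x) = (\<Sum>i\<in>I. mean (f i))"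
  unfolding mean_def by (intro integral_sum mean_integrable)

lemma mean_eq_0_imp:
  fixes f :: "real^3 \<Rightarrow> real"
  assumes "continuous_on UNIV f" "periodic3 f" "\<And>x. f x \<ge> 0" "mean f = 0"
  shows "f x = 0"
proof -
  have "box 0 (1::real^3) \<noteq> {}" by (simp add: interval_ne_empty_cart)
  then have "f y = 0" if "y \<in> cbox 0 1" for y
    using integral_cbox_eq_0_iff[of 0 1 f] continuous_on_subset[OF assms(1)] assms(3,4) that
    unfolding mean_def by auto
  then show ?thesis by (rule periodic3_cube[OF assms(2)])
qed

lemma mean_norm_le:
  fixes f :: "real^3 \<Rightarrow> 'b::banach"
  assumes "continuous_on UNIV f"
  shows "norm (mean f) \<le> mean (\<lambda>x. norm (f x))"
  unfolding mean_def using assms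
  by (intro integral_norm_bound_integral mean_integrable continuous_on_norm) auto

section \<open>Completeness of the trigonometric system\<close>

definition chr :: "int^3 \<Rightarrow> real^3 \<Rightarrow> complex" where
  "chr k x = cis (2 * pi * (lattice_pt k \<bullet> x))"

lemma lattice_pt_add: "lattice_pt (k + l) = lattice_pt k + lattice_pt l"
  by (simp add: lattice_pt_def vec_eq_iff)

lemma lattice_pt_minus: "lattice_pt (- k) = - lattice_pt k"
  by (simp add: lattice_pt_def vec_eq_iff)

lemma lattice_pt_0 [simp]: "lattice_pt 0 = 0"
  by (simp add: lattice_pt_def vec_eq_iff)

lemma lattice_pt_nth [simp]: "lattice_pt k $ i = of_int (k $ i)"
  by (simp add: lattice_pt_def)

lemma chr_add: "chr (k + l) x = chr k x * chr l x"
  by (simp add: chr_def lattice_pt_add inner_add_left cis_mult algebra_simps)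

lemma chr_0 [simp]: "chr 0 x = 1"
  by (simp add: chr_def)

lemma norm_chr [simp]: "norm (chr k x) = 1"
  by (simp add: chr_def)

lemma continuous_chr [continuous_intros]: "continuous_on S (chr k)"
  unfolding chr_def by (intro continuous_intros)

lemma periodic3_chr: "periodic3 (chr k)"
proof -
  have "chr k (x + axis i 1) = chr k x * cis (2 * pi * of_int (k $ i))" for x i
    by (simp add: chr_def inner_add_right inner_axis cis_mult algebra_simps)
  moreover have "cis (2 * pi * of_int n) = 1" for n :: int
    by (simp add: cis_multiple_2pi)
  ultimately show ?thesis unfolding periodic3_def by simp
qed

lemma chr_vector_derivative:
  "((\<lambda>t. chr k (x + t *\<^sub>R v)) has_vector_derivative
     2 * pi * (lattice_pt k \<bullet> v) * \<i> * chr k (x + s *\<^sub>R v)) (at s)"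
proof -
  let ?\<theta> = "complex_of_real (2 * pi * (lattice_pt k \<bullet> x))"
    and ?c = "complex_of_real (2 * pi * (lattice_pt k \<bullet> v))"
  have eq: "chr k (x + t *\<^sub>R v) = exp (\<i> * (?\<theta> + ?c * of_real t))" for t
    by (simp add: chr_def cis_conv_exp inner_add_right algebra_simps)
  have "((\<lambda>z. exp (\<i> * (?\<theta> + ?c * z))) has_field_derivative
      ?c * \<i> * exp (\<i> * (?\<theta> + ?c * of_real s))) (at (of_real s))"
    by (auto intro!: derivative_eq_intros)
  from has_vector_derivative_real_field[OF this] show ?thesis
    unfolding eq by simp
qed

text \<open>For \<open>k \<noteq> 0\<close> some coordinate is nonzero, and the derivative along
  that axis is a nonzero multiple of \<open>chr k\<close> itself.\<close>

lemma mean_chr: "mean (chr k) = (if k = 0 then 1 else 0)"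
proof (cases "k = 0")
  case True
  then have "chr k = (\<lambda>x. 1)" by auto
  then show ?thesis using True mean_const[of "1::complex"] by simp
next
  case False
  then obtain j where j: "k $ j \<noteq> 0" by (auto simp: vec_eq_iff)
  let ?c = "2 * pi * of_int (k $ j) * \<i> :: complex"
  have "mean (\<lambda>x. ?c * chr k x) = 0"
  proof (rule mean_derivative_zero[OF periodic3_chr])
    show "((\<lambda>t. chr k (x + t *\<^sub>R axis j 1)) has_vector_derivative ?c * chr k x) (at 0)" for x
      using chr_vector_derivative[of k x "axis j 1" 0] by (simp add: inner_axis)
  qed (intro continuous_intros)+
  then show ?thesis using j False by (simp add: mean_mult_left)
qed

inductive trig_poly :: "(real^3 \<Rightarrow> complex) \<Rightarrow> bool" where
  chr: "trig_poly (\<lambda>x. c * chr k x)"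
| add: "trig_poly f \<Longrightarrow> trig_poly h \<Longrightarrow> trig_poly (\<lambda>x. f x + h x)"

lemma trig_poly_const: "trig_poly (\<lambda>x. c)"
  using trig_poly.chr[of c 0] by simp

lemma trig_poly_mult_chr: "trig_poly f \<Longrightarrow> trig_poly (\<lambda>x. (c * chr k x) * f x)"
proof (induction rule: trig_poly.induct)
  case (chr d l)
  then show ?case
    using trig_poly.chr[of "c * d" "k + l"] by (simp add: chr_add algebra_simps)
next
  case (add f h)
  then show ?case using trig_poly.add[OF add.IH] by (simp add: algebra_simps)
qed

lemma trig_poly_mult: "trig_poly f \<Longrightarrow> trig_poly h \<Longrightarrow> trig_poly (\<lambda>x. f x * h x)"
proof (induction rule: trig_poly.induct)
  case (chr d l)
  then show ?case by (rule trig_poly_mult_chr)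
next
  case (add f1 f2)
  then show ?case using trig_poly.add[OF add.IH] by (simp add: algebra_simps)
qed

lemma trig_poly_sum: "finite I \<Longrightarrow> (\<And>i. i \<in> I \<Longrightarrow> trig_poly (f i)) \<Longrightarrow> trig_poly (\<lambda>x. \<Sum>i\<in>I. f i x)"
  by (induction I rule: finite_induct) (auto intro: trig_poly_const trig_poly.add)

lemma trig_poly_continuous: "trig_poly f \<Longrightarrow> continuous_on UNIV f"
  by (induction rule: trig_poly.induct) (intro continuous_intros; assumption)+

lemma trig_poly_periodic: "trig_poly f \<Longrightarrow> periodic3 f"
  by (induction rule: trig_poly.induct) (use periodic3_chr in \<open>auto simp: periodic3_def\<close>)

lemma trig_poly_orthogonal:
  assumes "trig_poly f" and h: "continuous_on UNIV h" "\<And>k. mean (\<lambda>x. h x * chr k x) = 0"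
  shows "mean (\<lambda>x. h x * f x) = 0"
  using assms(1)
proof (induction rule: trig_poly.induct)
  case (chr c k)
  then show ?case using mean_mult_left[of c "\<lambda>x. h x * chr k x"] h(2) by (simp add: algebra_simps)
next
  case (add f1 f2)
  then show ?case
    by (simp add: distrib_left mean_add continuous_on_mult trig_poly_continuous h(1))
qed

section \<open>The torus as a compact subset of \<open>complex^3\<close>\<close>

definition torus_map :: "real^3 \<Rightarrow> complex^3" where
  "torus_map x = (\<chi> i. cis (2 * pi * x $ i))"

lemma continuous_torus_map: "continuous_on S torus_map"
  unfolding torus_map_def by (intro continuous_intros continuous_on_vec_lambda)

text \<open>Points with equal image differ by a lattice vector, so periodic functions descend to the
  embedded torus.\<close>

lemma torus_map_eqD:
  assumes "torus_map x = torus_map y" "periodic3 f" shows "f x = f y"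
proof -
  have "\<exists>n::int. x $ i = y $ i + of_int n" for i
  proof -
    have "cis (2 * pi * x $ i) = cis (2 * pi * y $ i)"
      using assms(1) by (simp add: torus_map_def vec_eq_iff)
    then have "sin (2 * pi * x $ i) = sin (2 * pi * y $ i) \<and> cos (2 * pi * x $ i) = cos (2 * pi * y $ i)"
      by (simp add: complex_eq_iff)
    then obtain n :: int where "2 * pi * x $ i = 2 * pi * y $ i + 2 * pi * of_int n"
      unfolding sin_cos_eq_iff by auto
    then have "2 * pi * x $ i = 2 * pi * (y $ i + of_int n)" by (simp add: algebra_simps)
    then show ?thesis by auto
  qed
  then obtain k where "\<And>i. x $ i = y $ i + of_int (k i)" by metis
  then have "x = y + lattice_pt (\<chi> i. k i)" by (simp add: vec_eq_iff)
  then show ?thesis using periodic3_lattice[OF assms(2)] by simp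
qed

lemma chr_axis: "chr (axis i 1) x = cis (2 * pi * x $ i)" "chr (- axis i 1) x = cis (- 2 * pi * x $ i)"
proof -
  have "lattice_pt (axis i 1) = axis i 1" by (simp add: vec_eq_iff axis_def)
  then show "chr (axis i 1) x = cis (2 * pi * x $ i)" "chr (- axis i 1) x = cis (- 2 * pi * x $ i)"
    by (simp_all add: chr_def lattice_pt_minus inner_commute[of "axis i 1"] inner_axis)
qed

text \<open>Real and imaginary parts of the coordinates are cosines and sines, each a combination of
  two characters, and characters multiply to characters.\<close>

lemma polynomial_trig_poly:
  "real_polynomial_function p \<Longrightarrow> trig_poly (\<lambda>x. complex_of_real (p (torus_map x)))"
proof (induction rule: real_polynomial_function.induct)
  case (linear f)
  \<comment> \<open>The real basis vectors of \<open>complex^3\<close> are \<open>axis i 1\<close>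
    and \<open>axis i \<i>\<close>; they read off the cosine and the sine.\<close>
  have cs: "trig_poly (\<lambda>x. complex_of_real (torus_map x \<bullet> b))" if "b \<in> Basis" for b
  proof -
    obtain i u where "b = axis i u" "u \<in> Basis"
      using \<open>b \<in> Basis\<close> unfolding Basis_vec_def by blast
    then have i: "b = axis i 1 \<or> b = axis i \<i>" by (auto simp: Basis_complex_def)
    have c: "complex_of_real (cos (2 * pi * x $ i)) = 1/2 * chr (axis i 1) x + 1/2 * chr (- axis i 1) x"
      and s: "complex_of_real (sin (2 * pi * x $ i)) = (-\<i>/2) * chr (axis i 1) x + (\<i>/2) * chr (- axis i 1) x"
      for x
      unfolding chr_axis by (simp_all add: complex_eq_iff)
    show ?thesis
      using i
    proof
      assume "b = axis i 1"
      then have "(\<lambda>x. complex_of_real (torus_map x \<bullet> b)) = (\<lambda>x. 1/2 * chr (axis i 1) x + 1/2 * chr (- axis i 1) x)"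
        unfolding c[symmetric] by (simp add: inner_axis torus_map_def inner_complex_def)
      then show ?thesis by (simp only: trig_poly.intros)
    next
      assume "b = axis i \<i>"
      then have "(\<lambda>x. complex_of_real (torus_map x \<bullet> b)) = (\<lambda>x. (-\<i>/2) * chr (axis i 1) x + (\<i>/2) * chr (- axis i 1) x)"
        unfolding s[symmetric] by (simp add: inner_axis torus_map_def inner_complex_def)
      then show ?thesis by (simp only: trig_poly.intros)
    qed
  qed
  have "f z = (\<Sum>b\<in>Basis. f b * (z \<bullet> b))" for z
  proof -
    have "f z = f (\<Sum>b\<in>Basis. (z \<bullet> b) *\<^sub>R b)" by (simp add: euclidean_representation)
    also have "\<dots> = (\<Sum>b\<in>Basis. f b * (z \<bullet> b))"
      using linear by (simp add: linear_sum linear_cmul bounded_linear.linear mult.commute)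
    finally show ?thesis .
  qed
  then have "(\<lambda>x. complex_of_real (f (torus_map x))) =
      (\<lambda>x. \<Sum>b\<in>Basis. complex_of_real (f b) * complex_of_real (torus_map x \<bullet> b))"
    by (metis (no_types, lifting) of_real_mult of_real_sum sum.cong)
  then show ?case
    using trig_poly_sum[of Basis "\<lambda>b x. complex_of_real (f b) * complex_of_real (torus_map x \<bullet> b)"]
      trig_poly_mult[OF trig_poly_const cs] by simp
next
  case (const c)
  then show ?case by (simp add: trig_poly_const)
next
  case (add f g)
  then show ?case using trig_poly.add by fastforce
next
  case (mult f g)
  then show ?case using trig_poly_mult by fastforce
qed

text \<open>The torus embedded in \<open>complex^3\<close> is compact, so Stone--Weierstrass for polynomials applies there.\<close>
lemma trig_poly_dense:
  fixes u :: "real^3 \<Rightarrow> real"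
  assumes per: "periodic3 u" and cont: "continuous_on UNIV u" and "e > 0"
  shows "\<exists>p. trig_poly (\<lambda>x. complex_of_real (p x)) \<and> (\<forall>x. \<bar>u x - p x\<bar> < e)"
proof -
  let ?C = "cbox 0 (1::real^3)"
  let ?S = "torus_map ` ?C"
  \<comment> \<open>\<open>H\<close> is \<open>u\<close> pushed down to the image; the choice of
    representative is harmless because \<open>u\<close> is constant on fibres.\<close>
  define H where "H z = u (SOME x. x \<in> ?C \<and> torus_map x = z)" for z
  have H: "H (torus_map x) = u x" if "x \<in> ?C" for x
  proof -
    have "\<exists>y. y \<in> ?C \<and> torus_map y = torus_map x" using that by blast
    from someI_ex[OF this] show ?thesis
      unfolding H_def using torus_map_eqD[OF _ per] by blast
  qed
  have S: "compact ?S" by (intro compact_continuous_image continuous_torus_map compact_cbox)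
  \<comment> \<open>Quotient argument for a compact source: the preimage of a closed set under
    \<open>H\<close> is the image of a compact part of the cube, hence closed.\<close>
  have "continuous_on ?S H"
    unfolding continuous_on_closed_vimage[OF compact_imp_closed[OF S]]
  proof (intro allI impI)
    fix B :: "real set" assume "closed B"
    then have "closed (u -` B)"
      using continuous_on_closed_vimage[of UNIV u] cont by simp
    then have "compact (torus_map ` (?C \<inter> u -` B))"
      by (intro compact_continuous_image continuous_torus_map compact_Int_closed compact_cbox)
    moreover have "H -` B \<inter> ?S = torus_map ` (?C \<inter> u -` B)" using H by auto
    ultimately show "closed (H -` B \<inter> ?S)" by (simp add: compact_imp_closed)
  qed
  from Stone_Weierstrass_real_polynomial_function[OF S this \<open>e > 0\<close>]
  obtain p where p: "real_polynomial_function p" "\<And>z. z \<in> ?S \<Longrightarrow> \<bar>H z - p z\<bar> < e" by blast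
  have tp: "trig_poly (\<lambda>x. complex_of_real (p (torus_map x)))" by (rule polynomial_trig_poly[OF p(1)])
  have "periodic3 (\<lambda>x. Re (complex_of_real (p (torus_map x))))"
    by (rule periodic3_compose[OF trig_poly_periodic[OF tp], of Re])
  then have "periodic3 (\<lambda>x. u x - p (torus_map x))" using per by (simp add: periodic3_def)
  then have "\<bar>u x - p (torus_map x)\<bar> < e" for x
    by (rule periodic3_cube) (use H p(2) in force)
  then show ?thesis using tp by (intro exI[of _ "\<lambda>x. p (torus_map x)"]) auto
qed

lemma Re_mean: "continuous_on UNIV f \<Longrightarrow> Re (mean f) = mean (\<lambda>x. Re (f x))"
  unfolding mean_def
  using integral_linear[OF mean_integrable bounded_linear_Re, of f] by (simp add: o_def)

text \<open>A real trigonometric polynomial \<open>p\<close> close to \<open>u = Re h\<close> is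
  orthogonal to \<open>h\<close>, hence to \<open>u\<close>; so the mean of \<open>u * u\<close>
  equals that of \<open>u * (u - p)\<close> and is arbitrarily small.\<close>

lemma fourier_unique:
  assumes per: "periodic3 h" and cont: "continuous_on UNIV h"
    and ort: "\<And>k. mean (\<lambda>x. h x * chr k x) = 0"
  shows "Re (h x) = 0"
proof -
  define u where "u x = Re (h x)" for x
  have perU: "periodic3 u" and contU: "continuous_on UNIV u"
    unfolding u_def using periodic3_compose[OF per, of Re] by (auto intro!: continuous_intros cont)
  obtain B where B: "B \<ge> 0" "\<And>x. \<bar>u x\<bar> \<le> B" using periodic3_bounded[OF perU contU] by auto
  have "mean (\<lambda>x. u x * u x) \<le> e" if "e > 0" for e
  proof -
    \<comment> \<open>\<open>B + 1\<close> rather than \<open>B\<close>, since the bound may be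
      0.\<close>
    have "e / (B + 1) > 0" using that B by simp
    from trig_poly_dense[OF perU contU this] obtain p
      where tp: "trig_poly (\<lambda>x. complex_of_real (p x))" and p: "\<And>x. \<bar>u x - p x\<bar> < e / (B + 1)" by blast
    have "continuous_on UNIV (\<lambda>x. Re (complex_of_real (p x)))"
      by (intro continuous_intros trig_poly_continuous tp)
    then have contp: "continuous_on UNIV p" by simp
    have "mean (\<lambda>x. u x * p x) = Re (mean (\<lambda>x. h x * complex_of_real (p x)))"
      by (subst Re_mean[OF continuous_on_mult[OF cont trig_poly_continuous[OF tp]]]) (simp add: u_def)
    also have "\<dots> = 0" using trig_poly_orthogonal[OF tp cont ort] by simp
    finally have "mean (\<lambda>x. u x * u x) = mean (\<lambda>x. u x * u x) - mean (\<lambda>x. u x * p x)" by simp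
    also have "\<dots> = mean (\<lambda>x. u x * (u x - p x))"
      by (simp add: right_diff_distrib mean_diff contU contp continuous_on_mult)
    also have "\<dots> \<le> mean (\<lambda>x. e)"
    proof (rule mean_mono)
      fix x
      have "u x * (u x - p x) \<le> \<bar>u x\<bar> * \<bar>u x - p x\<bar>" by (metis abs_ge_self abs_mult)
      also have "\<dots> \<le> B * (e / (B + 1))" using B p[of x] by (intro mult_mono) auto
      also have "\<dots> \<le> e" using B that by (simp add: field_simps)
      finally show "u x * (u x - p x) \<le> e" .
    qed (intro continuous_intros contU contp)+
    finally show ?thesis by (simp add: mean_const)
  qed
  then have "mean (\<lambda>x. u x * u x) \<le> 0" by (rule dense_ge)
  moreover have "mean (\<lambda>x. 0) \<le> mean (\<lambda>x. u x * u x)"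
    by (rule mean_mono) (auto intro!: continuous_intros contU)
  ultimately have "mean (\<lambda>x. u x * u x) = 0" by (simp add: mean_const)
  then have "u x * u x = 0"
    using mean_eq_0_imp[of "\<lambda>x. u x * u x" x] continuous_on_mult[OF contU contU]
      periodic3_compose[OF perU, of "\<lambda>v. v * v"] by simp
  then show ?thesis by (simp add: u_def)
qed

section \<open>Fourier inversion for smooth periodic functions\<close>

lemma periodic3_partial:
  assumes "periodic3 f" shows "periodic3 (partial f k)"
proof -
  have "(\<lambda>t. f (x + axis i 1 + t *\<^sub>R axis k 1)) = (\<lambda>t. f (x + t *\<^sub>R axis k 1))" for x i
  proof
    fix t
    have "x + axis i 1 + t *\<^sub>R axis k 1 = (x + t *\<^sub>R axis k 1) + axis i 1" by simp
    then show "f (x + axis i 1 + t *\<^sub>R axis k 1) = f (x + t *\<^sub>R axis k 1)"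
      using assms unfolding periodic3_def by metis
  qed
  then show ?thesis unfolding periodic3_def partial_def by auto
qed

lemma smooth_T3_partial: "smooth_T3 f \<Longrightarrow> smooth_T3 (partial f k)"
  unfolding smooth_T3_def by (auto intro: smooth3_partial periodic3_partial)

lemma smooth_T3_pds: "smooth_T3 f \<Longrightarrow> smooth_T3 (pds ks f)"
  by (induction ks) (auto intro: smooth_T3_partial)

lemma smooth_T3_const: "smooth_T3 (\<lambda>x. c)"
  and smooth_T3_add: "smooth_T3 f \<Longrightarrow> smooth_T3 h \<Longrightarrow> smooth_T3 (\<lambda>x. f x + h x)"
  and smooth_T3_mult: "smooth_T3 f \<Longrightarrow> smooth_T3 h \<Longrightarrow> smooth_T3 (\<lambda>x. f x * h x)"
  and smooth_T3_minus: "smooth_T3 f \<Longrightarrow> smooth_T3 (\<lambda>x. - f x)"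
  and smooth_T3_diff: "smooth_T3 f \<Longrightarrow> smooth_T3 h \<Longrightarrow> smooth_T3 (\<lambda>x. f x - h x)"
  and smooth_T3_powr: "smooth_T3 f \<Longrightarrow> (\<And>x. f x > 0) \<Longrightarrow> smooth_T3 (\<lambda>x. f x powr a)"
  unfolding smooth_T3_def
  by (auto intro!: smooth3_const smooth3_add smooth3_mult smooth3_minus smooth3_diff smooth3_powr)
     (auto simp: periodic3_def)

lemma smooth_T3_sum:
  "finite I \<Longrightarrow> (\<And>i. i \<in> I \<Longrightarrow> smooth_T3 (f i)) \<Longrightarrow> smooth_T3 (\<lambda>x. \<Sum>i\<in>I. f i x)"
  by (induction I rule: finite_induct) (auto intro: smooth_T3_const smooth_T3_add)

lemma smooth_T3D:
  assumes "smooth_T3 f"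
  shows "smooth3 f" "periodic3 f" "continuous_on S f"
  using assms smooth3_continuous unfolding smooth_T3_def by auto

lemma mean_partial: "smooth_T3 f \<Longrightarrow> mean (partial f k) = 0"
  using smooth3_has_partials[of f] smooth_T3D[of f] smooth_T3D(3)[OF smooth_T3_partial]
  unfolding has_partials_def has_real_derivative_iff_has_vector_derivative
  by (intro mean_derivative_zero[of f _ k]) auto

definition coef :: "(real^3 \<Rightarrow> real) \<Rightarrow> int^3 \<Rightarrow> complex" where
  "coef f k = mean (\<lambda>x. complex_of_real (f x) * chr (- k) x)"

text \<open>The Fourier multiplier of \<open>pds ks\<close>.\<close>

definition symb :: "3 list \<Rightarrow> int^3 \<Rightarrow> complex" where
  "symb ks k = prod_list (map (\<lambda>j. 2 * pi * of_int (k $ j) * \<i>) ks)"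

lemma symb_simps [simp]:
  "symb [] k = 1" "symb (j # ks) k = (2 * pi * of_int (k $ j) * \<i>) * symb ks k"
  by (simp_all add: symb_def)

text \<open>Integration by parts against \<open>chr (- k)\<close>: the product is periodic, so its
  derivative has mean 0.\<close>

lemma coef_partial:
  assumes "smooth_T3 f"
  shows "coef (partial f j) k = (2 * pi * of_int (k $ j) * \<i>) * coef f k"
proof -
  let ?F = "\<lambda>x. complex_of_real (f x) * chr (- k) x"
  let ?G = "\<lambda>x. complex_of_real (partial f j x) * chr (- k) x"
  let ?c = "2 * pi * of_int (k $ j) * \<i> :: complex"
  have cF: "continuous_on UNIV ?F" and cG: "continuous_on UNIV ?G"
    by (intro continuous_intros smooth_T3D(3) assms smooth_T3_partial)+
  have "mean (\<lambda>x. ?G x - ?c * ?F x) = 0"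
  proof (rule mean_derivative_zero[of ?F _ j])
    show "periodic3 ?F"
      using smooth_T3D(2)[OF assms] periodic3_chr unfolding periodic3_def by simp
    fix x
    have "((\<lambda>t. complex_of_real (f (x + t *\<^sub>R axis j 1))) has_vector_derivative
        complex_of_real (partial f j x)) (at 0)"
      using smooth3_has_partials[OF smooth_T3D(1)[OF assms]]
      unfolding has_partials_def by (intro has_vector_derivative_of_real) auto
    from has_vector_derivative_mult[OF this chr_vector_derivative[of "- k" x "axis j 1" 0]]
    show "((\<lambda>t. ?F (x + t *\<^sub>R axis j 1)) has_vector_derivative ?G x - ?c * ?F x) (at 0)"
      by (simp add: lattice_pt_minus inner_axis algebra_simps)
  qed (intro continuous_intros cF cG)+
  then have "mean ?G - ?c * mean ?F = 0"
    by (subst (asm) mean_diff) (auto simp: mean_mult_left intro!: cG continuous_on_mult cF continuous_on_const)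
  then show ?thesis by (simp add: coef_def)
qed

lemma coef_pds: "smooth_T3 f \<Longrightarrow> coef (pds ks f) k = symb ks k * coef f k"
  by (induction ks) (auto simp: coef_partial smooth_T3_pds)

section \<open>Decay and absolute summability of Fourier coefficients\<close>

definition L1 :: "(real^3 \<Rightarrow> real) \<Rightarrow> real" where
  "L1 f = mean (\<lambda>x. \<bar>f x\<bar>)"

lemma coef_le_L1: "continuous_on UNIV f \<Longrightarrow> norm (coef f k) \<le> L1 f"
  unfolding coef_def L1_def
  by (rule order_trans[OF mean_norm_le])
     (auto simp: norm_mult intro!: continuous_intros)

text \<open>Lattice sums are indexed by naturals so that \<open>suminf\<close> and the M-test apply;
  the choice of enumeration is immaterial because the series used converge absolutely.\<close>

definition enumk :: "nat \<Rightarrow> int^3" where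
  "enumk = from_nat_into UNIV"

lemma bij_enumk: "bij enumk"
proof -
  have "inj (\<lambda>n::int. (\<chi> i. n) :: int^3)" by (auto simp: inj_on_def vec_eq_iff)
  then have "infinite (UNIV :: (int^3) set)"
    by (metis finite_imageD finite_subset infinite_UNIV_int subset_UNIV)
  then show ?thesis unfolding enumk_def by (intro bij_betw_from_nat_into) auto
qed

definition decay :: "int \<Rightarrow> real" where
  "decay m = 1 / (1 + \<bar>of_int m\<bar>)\<^sup>2"

text \<open>A product weight instead of a radial one, so that its sum over the lattice factors into
  three one-dimensional sums.\<close>

definition decay3 :: "int^3 \<Rightarrow> real" where
  "decay3 k = decay (k $ 1) * decay (k $ 2) * decay (k $ 3)"

lemma decay_nonneg: "decay m \<ge> 0" "decay3 k \<ge> 0"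
  by (simp_all add: decay_def decay3_def)

lemma decay_sum_bounded: "\<exists>B. \<forall>F. finite F \<longrightarrow> sum decay F \<le> B"
proof -
  let ?h = "\<lambda>n::nat. 1 / (1 + real n)\<^sup>2"
  have "summable (\<lambda>n. inverse (real (Suc n) ^ 2))"
    using inverse_power_summable[of 2, where 'a=real] by (subst summable_Suc_iff) simp
  then have su: "summable ?h" by (simp add: inverse_eq_divide add.commute)
  have "sum decay F \<le> 2 * suminf ?h" if "finite F" for F
  proof -
    \<comment> \<open>On each sign half the absolute value is injective, so the half is bounded by
      the series over naturals; two halves give the factor 2.\<close>
    have half: "sum decay G \<le> suminf ?h" if "finite G" "inj_on (\<lambda>m. nat \<bar>m\<bar>) G" for G
    proof -
      have "sum decay G = sum ?h ((\<lambda>m. nat \<bar>m\<bar>) ` G)"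
        by (subst sum.reindex[OF that(2)]) (auto simp: decay_def intro!: sum.cong)
      also have "\<dots> \<le> suminf ?h" using that(1) by (intro sum_le_suminf su) auto
      finally show ?thesis .
    qed
    have "sum decay F = sum decay (F \<inter> {0..}) + sum decay (F - {0..})"
      using that by (rule sum.Int_Diff)
    also have "\<dots> \<le> suminf ?h + suminf ?h"
      using that by (intro add_mono half) (auto simp: inj_on_def)
    finally show ?thesis by simp
  qed
  then show ?thesis by blast
qed

lemma summable_decay3: "summable (\<lambda>n. decay3 (enumk n))"
proof -
  obtain B where B: "\<And>F. finite F \<Longrightarrow> sum decay F \<le> B" using decay_sum_bounded by blast
  have "B \<ge> 0" using B[of "{}"] by simp
  have "sum decay3 F \<le> B * B * B" if "finite F" for F
  proof -
    \<comment> \<open>\<open>I\<close> collects all coordinates that occur, so \<open>F\<close>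
      embeds into a finite cube over \<open>I\<close>, where the sum factors.\<close>
    define I where "I = (\<lambda>k. k $ 1) ` F \<union> (\<lambda>k. k $ 2) ` F \<union> (\<lambda>k. k $ 3) ` F"
    have fI: "finite I" using that by (auto simp: I_def)
    define T where "T = (\<lambda>k::int^3. (k $ 1, k $ 2, k $ 3)) ` F"
    have inj: "inj_on (\<lambda>k::int^3. (k $ 1, k $ 2, k $ 3)) F"
      by (auto simp: inj_on_def vec_eq_iff forall_3)
    have "sum decay3 F = (\<Sum>(a, b, c)\<in>T. decay a * decay b * decay c)"
      unfolding T_def by (subst sum.reindex[OF inj]) (auto simp: decay3_def)
    also have "\<dots> \<le> (\<Sum>(a, b, c)\<in>I \<times> I \<times> I. decay a * decay b * decay c)"
      by (rule sum_mono2) (use fI decay_nonneg in \<open>auto simp: T_def I_def\<close>)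
    also have "\<dots> = (\<Sum>a\<in>I. \<Sum>b\<in>I. \<Sum>c\<in>I. decay a * (decay b * decay c))"
      by (simp add: sum.cartesian_product mult.assoc)
    also have "\<dots> = sum decay I * (sum decay I * sum decay I)"
      by (simp flip: sum_distrib_left sum_distrib_right)
    also have "\<dots> \<le> B * (B * B)"
      using B[OF fI] \<open>B \<ge> 0\<close> decay_nonneg by (intro mult_mono mult_nonneg_nonneg sum_nonneg) auto
    finally show ?thesis by (simp add: mult.assoc)
  qed
  then have "(\<Sum>n<N. decay3 (enumk n)) \<le> B * B * B" for N
    using sum.reindex[of enumk "{..<N}" decay3] bij_is_inj[OF bij_enumk]
    by (metis comp_apply finite_imageI finite_lessThan inj_on_subset subset_UNIV sum.cong)
  then show ?thesis
    using decay_nonneg by (intro summableI_nonneg_bounded[of _ "B * B * B"]) auto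
qed

text \<open>Differentiate six times along the axis where |k_j| takes its maximum \<open>m\<close>.
  The gained factor m^6 is shared out as m^2 to each coordinate, and 1 + |k_i| \<le> 2m; the
  resulting 2^6 is covered by (2 pi)^6. The sum over \<open>j\<close> makes the bound independent of
  the chosen axis.\<close>

lemma coef_decay:
  assumes f: "smooth_T3 f" and k: "k \<noteq> 0"
  shows "norm (coef f k) \<le> decay3 k * (\<Sum>j\<in>UNIV. L1 (pds (replicate 6 j) f))"
proof -
  define m where "m = Max (range (\<lambda>j. \<bar>k $ j\<bar>))"
  have "m \<in> range (\<lambda>j. \<bar>k $ j\<bar>)" unfolding m_def by (rule Max_in) auto
  then obtain j where j: "m = \<bar>k $ j\<bar>" by auto
  have le: "\<bar>k $ i\<bar> \<le> m" for i unfolding m_def by (rule Max_ge) auto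
  have m1: "m \<ge> 1"
  proof -
    obtain i where "k $ i \<noteq> 0" using k by (auto simp: vec_eq_iff)
    then show ?thesis using le[of i] by linarith
  qed
  have w: "1 / (2 * of_int m)\<^sup>2 \<le> decay (k $ i)" for i
    unfolding decay_def using le[of i] m1 by (intro divide_left_mono power_mono) (auto simp: zero_less_mult_iff)
  have "1 / (2 * of_int m)\<^sup>2 * (1 / (2 * of_int m)\<^sup>2) * (1 / (2 * of_int m)\<^sup>2) \<le> decay3 k"
    unfolding decay3_def by (intro mult_mono w) (auto simp: decay_nonneg)
  then have w3: "1 / (2 * of_int m) ^ 6 \<le> decay3 k"
    by (simp add: power_mult_distrib flip: power_add power_mult)
  have rep: "symb (replicate n j) k = (2 * pi * of_int (k $ j) * \<i>) ^ n" for n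
    by (induction n) auto
  have "(2 * of_int m) ^ 6 * norm (coef f k) \<le> (2 * pi * of_int m) ^ 6 * norm (coef f k)"
    using m1 pi_ge_two by (intro mult_right_mono power_mono) auto
  also have "\<dots> = norm (coef (pds (replicate 6 j) f) k)"
    unfolding coef_pds[OF f] rep by (simp add: norm_mult norm_power j)
  also have "\<dots> \<le> L1 (pds (replicate 6 j) f)"
    by (intro coef_le_L1 smooth_T3D(3) smooth_T3_pds f)
  also have "\<dots> \<le> (\<Sum>j\<in>UNIV. L1 (pds (replicate 6 j) f))"
  proof (rule member_le_sum)
    fix i
    have "0 \<le> norm (coef (pds (replicate 6 i) f) k)" by simp
    also have "\<dots> \<le> L1 (pds (replicate 6 i) f)"
      by (intro coef_le_L1 smooth_T3D(3) smooth_T3_pds f)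
    finally show "0 \<le> L1 (pds (replicate 6 i) f)" .
  qed auto
  finally have "norm (coef f k) \<le> 1 / (2 * of_int m) ^ 6 * (\<Sum>j\<in>UNIV. L1 (pds (replicate 6 j) f))"
    using m1 by (simp add: field_simps)
  also have "\<dots> \<le> decay3 k * (\<Sum>j\<in>UNIV. L1 (pds (replicate 6 j) f))"
    using w3 order_trans[OF norm_ge_zero coef_le_L1[OF smooth_T3D(3)[OF smooth_T3_pds[OF f]]]]
    by (intro mult_right_mono sum_nonneg) auto
  finally show ?thesis .
qed

lemma L1_nonneg: "continuous_on UNIV f \<Longrightarrow> L1 f \<ge> 0"
  using order_trans[OF norm_ge_zero coef_le_L1] by blast

lemma summable_coef:
  assumes "smooth_T3 f" shows "summable (\<lambda>n. norm (coef f (enumk n)))"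
proof -
  let ?B = "\<Sum>j\<in>UNIV. L1 (pds (replicate 6 j) f)"
  \<comment> \<open>\<open>coef_decay\<close> excludes the zero frequency, which enters as one extra
    term.\<close>
  have le: "norm (coef f (enumk n)) \<le> decay3 (enumk n) * ?B + (if n = inv enumk 0 then norm (coef f 0) else 0)" for n
  proof (cases "enumk n = 0")
    case True
    then have "n = inv enumk 0" using bij_enumk by (metis bij_inv_eq_iff)
    moreover have "?B \<ge> 0" by (intro sum_nonneg L1_nonneg smooth_T3D(3) smooth_T3_pds assms)
    ultimately show ?thesis using True decay_nonneg by simp
  next
    case False
    then show ?thesis using coef_decay[OF assms False] by (simp add: add_increasing2)
  qed
  have "summable (\<lambda>n. decay3 (enumk n) * ?B + (if n = inv enumk 0 then norm (coef f 0) else 0))"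
    by (rule summable_add[OF summable_mult2[OF summable_decay3]
          sums_summable[OF sums_single[of "inv enumk 0" "\<lambda>_. norm (coef f 0)"]]])
  then show ?thesis by (rule summable_comparison_test'[where N=0]) (use le in simp)
qed

lemma mean_series:
  fixes F :: "nat \<Rightarrow> real^3 \<Rightarrow> 'b::banach"
  assumes "\<And>n. continuous_on UNIV (F n)" "\<And>n x. norm (F n x) \<le> M n" "summable M"
  shows "(\<lambda>n. mean (F n)) sums mean (\<lambda>x. \<Sum>n. F n x)"
proof -
  have "uniform_limit (cbox 0 (1::real^3)) (\<lambda>n x. \<Sum>i<n. F i x) (\<lambda>x. \<Sum>n. F n x) sequentially"
    by (rule Weierstrass_m_test[OF assms(2,3)])
  moreover have "continuous_on (cbox 0 (1::real^3)) (\<lambda>x. \<Sum>i<n. F i x)" for n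
    by (intro continuous_on_sum continuous_on_subset[OF assms(1)]) auto
  ultimately obtain I J where IJ: "\<And>n. ((\<lambda>x. \<Sum>i<n. F i x) has_integral I n) (cbox 0 (1::real^3))"
    "((\<lambda>x. \<Sum>n. F n x) has_integral J) (cbox 0 (1::real^3))" "I \<longlonglongrightarrow> J"
    using uniform_limit_integral_cbox[OF _ _ sequentially_bot] by metis
  have "I = (\<lambda>n. \<Sum>i<n. mean (F i))"
  proof
    show "I n = (\<Sum>i<n. mean (F i))" for n
      using integral_unique[OF IJ(1)] mean_sum[of "{..<n}" F] assms(1) by (simp add: mean_def)
  qed
  moreover have "J = mean (\<lambda>x. \<Sum>n. F n x)"
    using integral_unique[OF IJ(2)] by (simp add: mean_def)
  ultimately show ?thesis using IJ(3) by (simp add: sums_def)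
qed

text \<open>Real parts are taken termwise, so any complex sequence gives a real function and no
  conjugate symmetry of the coefficients has to be tracked.\<close>

definition fser :: "(nat \<Rightarrow> complex) \<Rightarrow> real^3 \<Rightarrow> real" where
  "fser c x = (\<Sum>n. Re (c n * chr (enumk n) x))"

text \<open>The Fourier series \<open>S\<close> converges uniformly, and termwise averaging shows
  that its difference to \<open>f\<close> has all coefficients zero; \<open>fourier_unique\<close>
  applies to that difference.\<close>

theorem fourier_inversion:
  assumes f: "smooth_T3 f"
  shows "f x = fser (\<lambda>n. coef f (enumk n)) x"
proof -
  let ?F = "\<lambda>n x. coef f (enumk n) * chr (enumk n) x"
  define S where "S x = (\<Sum>n. ?F n x)" for x
  let ?h = "\<lambda>x. complex_of_real (f x) - S x"
  have su: "summable (\<lambda>n. norm (coef f (enumk n)))" by (rule summable_coef[OF f])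
  have contS: "continuous_on UNIV S"
    unfolding S_def
  proof (rule uniform_limit_theorem[OF _ Weierstrass_m_test[OF _ su]])
    show "\<forall>\<^sub>F n in sequentially. continuous_on UNIV (\<lambda>x. \<Sum>i<n. ?F i x)"
      by (intro always_eventually allI continuous_intros)
  qed (auto simp: norm_mult)
  have perS: "periodic3 S"
    using periodic3_chr unfolding S_def periodic3_def by simp
  have "mean (\<lambda>x. ?h x * chr k x) = 0" for k
  proof -
    have "(\<lambda>n. mean (\<lambda>x. ?F n x * chr k x)) sums mean (\<lambda>x. \<Sum>n. ?F n x * chr k x)"
      by (rule mean_series[OF _ _ su]) (auto simp: norm_mult intro!: continuous_intros)
    moreover have "(\<lambda>x. \<Sum>n. ?F n x * chr k x) = (\<lambda>x. S x * chr k x)"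
    proof
      fix x
      have "summable (\<lambda>n. ?F n x)"
        by (rule summable_norm_cancel) (use su in \<open>simp add: norm_mult\<close>)
      then show "(\<Sum>n. ?F n x * chr k x) = S x * chr k x"
        unfolding S_def by (rule suminf_mult2[symmetric])
    qed
    \<comment> \<open>Orthogonality: only the frequency \<open>- k\<close> survives pairing with
      \<open>chr k\<close>.\<close>
    moreover have "mean (\<lambda>x. ?F n x * chr k x) = (if n = inv enumk (- k) then coef f (- k) else 0)" for n
    proof -
      have "(\<lambda>x. ?F n x * chr k x) = (\<lambda>x. coef f (enumk n) * chr (enumk n + k) x)"
        by (simp add: chr_add mult.assoc)
      moreover have "enumk n + k = 0 \<longleftrightarrow> n = inv enumk (- k)"
        using bij_inv_eq_iff[OF bij_enumk] by (metis eq_neg_iff_add_eq_0)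
      moreover have "enumk (inv enumk (- k)) = - k" using bij_enumk by (simp add: bij_is_surj surj_f_inv_f)
      ultimately show ?thesis by (simp add: mean_mult_left mean_chr)
    qed
    ultimately have "(\<lambda>n. if n = inv enumk (- k) then coef f (- k) else 0) sums mean (\<lambda>x. S x * chr k x)"
      by simp
    then have "mean (\<lambda>x. S x * chr k x) = coef f (- k)"
      using sums_unique2 sums_single[of "inv enumk (- k)" "\<lambda>_. coef f (- k)"] by blast
    then show ?thesis
      by (simp add: left_diff_distrib mean_diff coef_def continuous_intros contS smooth_T3D(3)[OF f])
  qed
  then have "Re (?h x) = 0"
    using perS smooth_T3D(2)[OF f]
    by (intro fourier_unique[of ?h] continuous_intros contS smooth_T3D(3)[OF f]) (simp add: periodic3_def)
  moreover have "Re (S x) = fser (\<lambda>n. coef f (enumk n)) x"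
  proof -
    have "summable (\<lambda>n. ?F n x)"
      by (rule summable_norm_cancel) (use su in \<open>simp add: norm_mult\<close>)
    from bounded_linear.suminf[OF bounded_linear_Re this] show ?thesis
      unfolding S_def fser_def .
  qed
  ultimately show ?thesis by simp
qed

section \<open>The Poisson equation on the torus\<close>

lemma abs_Re_chr_le: "\<bar>Re (z * chr k x)\<bar> \<le> norm z"
  by (rule order_trans[OF abs_Re_le_cmod]) (simp add: norm_mult)

lemma has_partials_chr:
  "has_partials (\<lambda>x. Re (c * chr k x)) (\<lambda>j x. Re ((2 * pi * of_int (k $ j) * \<i> * c) * chr k x))"
  unfolding has_partials_def
proof (intro allI)
  fix j x
  have "((\<lambda>t. c * chr k (x + t *\<^sub>R axis j 1)) has_vector_derivative
      c * (2 * pi * of_int (k $ j) * \<i> * chr k x)) (at 0)"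
    using has_vector_derivative_mult_right[OF chr_vector_derivative[of k x "axis j 1" 0], of c]
    by (simp add: inner_axis)
  from bounded_linear.has_vector_derivative[OF bounded_linear_Re this]
  show "((\<lambda>t. Re (c * chr k (x + t *\<^sub>R axis j 1))) has_real_derivative
      Re ((2 * pi * of_int (k $ j) * \<i> * c) * chr k x)) (at 0)"
    unfolding has_real_derivative_iff_has_vector_derivative by (simp only: mult_ac)
qed

lemma smooth3_chr: "smooth3 (\<lambda>x. Re (c * chr k x))"
proof (rule smooth3_coinduct[of _ "range (\<lambda>c x. Re (c * chr k x))"])
  fix h assume "h \<in> range (\<lambda>c x. Re (c * chr k x))"
  then obtain c where h: "h = (\<lambda>x. Re (c * chr k x))" by blast
  show "continuous_on UNIV h" unfolding h by (intro continuous_intros)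
  show "\<exists>h'. (\<forall>j. h' j \<in> range (\<lambda>c x. Re (c * chr k x))) \<and> has_partials h h'"
    unfolding h using has_partials_chr[of c k]
    by (intro exI[of _ "\<lambda>j x. Re ((2 * pi * of_int (k $ j) * \<i> * c) * chr k x)"]) blast
qed auto

lemma pds_chr: "pds ks (\<lambda>x. Re (c * chr k x)) = (\<lambda>x. Re ((symb ks k * c) * chr k x))"
proof (induction ks)
  case (Cons j ks)
  show ?case
    unfolding pds.simps Cons has_partials_imp_partial[OF has_partials_chr] by (simp add: mult_ac)
qed simp

lemma fser_smooth:
  assumes "\<And>ks. summable (\<lambda>n. norm (symb ks (enumk n) * c n))"
  shows "smooth_T3 (fser c)"
    and "pds ks (fser c) = fser (\<lambda>n. symb ks (enumk n) * c n)"
proof -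
  have bd: "\<bar>pds ks (\<lambda>x. Re (c n * chr (enumk n) x)) x\<bar> \<le> norm (symb ks (enumk n) * c n)" for ks n x
    unfolding pds_chr by (rule abs_Re_chr_le)
  have fs: "fser c = (\<lambda>x. \<Sum>n. Re (c n * chr (enumk n) x))"
    by (rule ext) (simp add: fser_def)
  note ser = smooth3_series[of "\<lambda>n x. Re (c n * chr (enumk n) x)", OF smooth3_chr bd assms]
  have "periodic3 (fser c)"
    using periodic3_chr unfolding fser_def periodic3_def by simp
  then show "smooth_T3 (fser c)"
    unfolding smooth_T3_def fs using ser(1) by simp
  show "pds ks (fser c) = fser (\<lambda>n. symb ks (enumk n) * c n)"
    unfolding fs ser(2) pds_chr by (rule ext) (simp add: fser_def)
qed

lemma coef_eqI:
  assumes "smooth_T3 f" "smooth_T3 h" "\<And>k. coef f k = coef h k" shows "f = h"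
  using fourier_inversion[OF assms(1)] fourier_inversion[OF assms(2)] assms(3) by (intro ext) simp

text \<open>Both orders multiply the Fourier coefficients by the same factors, and the coefficients
  determine the function.\<close>

lemma partial_commute:
  assumes "smooth_T3 f" shows "partial (partial f i) j = partial (partial f j) i"
  by (rule coef_eqI) (simp_all add: coef_partial smooth_T3_partial assms)

text \<open>Smoothness provides derivatives along axes. The Fourier series can be differentiated
  termwise in any direction, because the frequency factor is linear in \<open>v\<close> and the
  result is dominated by the coefficients of the partials.\<close>

lemma directional_derivative:
  assumes f: "smooth_T3 f"
  shows "((\<lambda>t. f (x + t *\<^sub>R v)) has_real_derivative (\<Sum>j\<in>UNIV. v $ j * partial f j (x + s *\<^sub>R v))) (at s)"
proof -
  let ?l = "\<lambda>t::real. x + t *\<^sub>R v"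
  let ?c = "\<lambda>n. coef f (enumk n)" and ?d = "\<lambda>n. 2 * pi * (lattice_pt (enumk n) \<bullet> v) * \<i>"
  define D where "D n t = Re (?d n * ?c n * chr (enumk n) (?l t))" for n t
  let ?M = "\<lambda>n. \<Sum>j\<in>UNIV. \<bar>v $ j\<bar> * norm (coef (partial f j) (enumk n))"
  have Dj: "D n t = (\<Sum>j\<in>UNIV. v $ j * Re (coef (partial f j) (enumk n) * chr (enumk n) (?l t)))" for n t
    unfolding D_def coef_partial[OF f] inner_vec_def sum_3
    by (simp add: algebra_simps)
  have bd: "norm (D n t) \<le> ?M n" for n t
    unfolding Dj
    unfolding real_norm_def abs_mult
    by (intro order_trans[OF sum_abs] sum_mono) (auto simp only: abs_mult intro!: mult_left_mono abs_Re_chr_le abs_ge_zero)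
  have suc: "summable (\<lambda>n. norm (coef (partial f j) (enumk n)))" for j
    by (intro summable_coef smooth_T3_partial f)
  have suM: "summable ?M" by (intro summable_sum summable_mult suc)
  have "\<exists>g. \<forall>t\<in>UNIV. (\<lambda>n. Re (?c n * chr (enumk n) (?l t))) sums g t \<and>
      (g has_field_derivative (\<Sum>n. D n t)) (at t within UNIV)"
  proof (rule has_field_derivative_series)
    show "((\<lambda>t. Re (?c n * chr (enumk n) (?l t))) has_field_derivative D n t) (at t within UNIV)" for n t
    proof -
      have "((\<lambda>t. ?c n * chr (enumk n) (?l t)) has_vector_derivative
          ?c n * (?d n * chr (enumk n) (?l t))) (at t)"
        by (rule has_vector_derivative_mult_right[OF chr_vector_derivative])
      from bounded_linear.has_vector_derivative[OF bounded_linear_Re this]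
      show ?thesis
        unfolding has_real_derivative_iff_has_vector_derivative D_def by (simp only: mult_ac)
    qed
    show "uniform_limit UNIV (\<lambda>n t. \<Sum>i<n. D i t) (\<lambda>t. \<Sum>n. D n t) sequentially"
      by (rule Weierstrass_m_test[OF bd suM])
    have "norm (Re (?c n * chr (enumk n) (?l 0))) \<le> norm (?c n)" for n
      by (simp only: real_norm_def abs_Re_chr_le)
    then show "summable (\<lambda>n. Re (?c n * chr (enumk n) (?l 0)))"
      by (intro summable_comparison_test'[OF summable_coef[OF f], of 0]) auto
  qed auto
  then obtain g where g: "\<And>t. (\<lambda>n. Re (?c n * chr (enumk n) (?l t))) sums g t"
    "\<And>t. (g has_field_derivative (\<Sum>n. D n t)) (at t)" by auto
  have "g = (\<lambda>t. f (?l t))"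
  proof
    show "g t = f (?l t)" for t
      using sums_unique[OF g(1)[of t]] fourier_inversion[OF f, of "?l t"] by (simp add: fser_def)
  qed
  moreover have "(\<Sum>n. D n s) = (\<Sum>j\<in>UNIV. v $ j * partial f j (?l s))"
  proof -
    have "summable (\<lambda>n. Re (coef (partial f j) (enumk n) * chr (enumk n) (?l s)))" for j
      by (rule summable_comparison_test'[OF suc[of j], of 0])
         (simp only: real_norm_def abs_Re_chr_le)
    then show ?thesis
      unfolding Dj
      by (simp add: suminf_sum summable_mult suminf_mult
          fourier_inversion[OF smooth_T3_partial[OF f]] fser_def)
  qed
  ultimately show ?thesis using g(2)[of s] by simp
qed

lemma coef_0:
  assumes "smooth_T3 f" shows "coef f 0 = complex_of_real (mean f)"
  using integral_linear[OF mean_integrable[OF smooth_T3D(3)[OF assms]] bounded_linear_of_real, of 0 1]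
  by (simp add: coef_def mean_def o_def)

lemma poisson_solvable:
  assumes f: "smooth_T3 f" and mean0: "mean f = 0"
  shows "\<exists>u. smooth_T3 u \<and> mean u = 0 \<and> (\<forall>x. (\<Sum>i\<in>UNIV. partial (partial u i) i x) = f x)"
proof -
  define q where "q k = (\<Sum>i\<in>UNIV. (2 * pi * real_of_int (k $ i))\<^sup>2)" for k :: "int^3"
  \<comment> \<open>At frequency 0 both \<open>q\<close> and, by convention, the quotient are 0; the
    zero mode of the equation then holds because \<open>f\<close> has mean 0.\<close>
  define c where "c n = - coef f (enumk n) / q (enumk n)" for n
  have q1: "q k \<ge> 1" if "k \<noteq> 0" for k
  proof -
    obtain i where i: "k $ i \<noteq> 0" using \<open>k \<noteq> 0\<close> by (auto simp: vec_eq_iff)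
    have "1 \<le> \<bar>2 * pi * real_of_int (k $ i)\<bar>"
    proof -
      have "1 * 1 \<le> (2 * pi) * \<bar>real_of_int (k $ i)\<bar>"
        using i pi_ge_two by (intro mult_mono) auto
      then show ?thesis by (simp add: abs_mult)
    qed
    then have "1 \<le> (2 * pi * real_of_int (k $ i))\<^sup>2" using one_le_power[of "\<bar>2 * pi * real_of_int (k $ i)\<bar>" 2] by (simp only: power2_abs)
    also have "\<dots> \<le> q k" unfolding q_def by (rule member_le_sum) auto
    finally show ?thesis .
  qed
  have sm: "summable (\<lambda>n. norm (symb ks (enumk n) * c n))" for ks
  proof (rule summable_comparison_test'[OF summable_coef[OF smooth_T3_pds[OF f, of ks]], of 0])
    fix n
    have "norm (c n) \<le> norm (coef f (enumk n))"
    proof (cases "enumk n = 0")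
      case True
      then show ?thesis by (simp add: c_def q_def)
    next
      case False
      then show ?thesis
        using q1[OF False] unfolding c_def
        by (simp add: norm_divide divide_le_eq mult_le_cancel_left1)
    qed
    then show "norm (norm (symb ks (enumk n) * c n)) \<le> norm (coef (pds ks f) (enumk n))"
      by (simp add: coef_pds[OF f] norm_mult mult_left_mono)
  qed
  define u where "u = fser c"
  have u: "smooth_T3 u" unfolding u_def by (rule fser_smooth(1)[OF sm])
  have lap: "(\<Sum>i\<in>UNIV. partial (partial u i) i x) = f x" for x
  proof -
    have pu: "partial (partial u i) i x = fser (\<lambda>n. symb [i, i] (enumk n) * c n) x" for i
      using fser_smooth(2)[OF sm, of "[i, i]"] by (simp add: u_def)
    have "summable (\<lambda>n. Re (symb [i, i] (enumk n) * c n * chr (enumk n) x))" for i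
      by (rule summable_comparison_test'[OF sm[of "[i, i]"], of 0])
         (simp only: real_norm_def abs_Re_chr_le)
    then have "(\<Sum>i\<in>UNIV. partial (partial u i) i x) =
        (\<Sum>n. \<Sum>i\<in>UNIV. Re (symb [i, i] (enumk n) * c n * chr (enumk n) x))"
      unfolding pu fser_def by (intro suminf_sum[symmetric])
    also have "\<dots> = (\<Sum>n. Re (coef f (enumk n) * chr (enumk n) x))"
    proof (rule suminf_cong)
      fix n
      have "(\<Sum>i\<in>UNIV. symb [i, i] (enumk n) * c n) = coef f (enumk n)"
      proof (cases "enumk n = 0")
        case True
        then show ?thesis using coef_0[OF f] mean0 by (simp add: c_def)
      next
        case False
        have "(\<Sum>i\<in>UNIV. symb [i, i] (enumk n)) = - complex_of_real (q (enumk n))"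
          unfolding q_def by (simp add: sum_negf[symmetric] power2_eq_square algebra_simps)
        moreover have "- complex_of_real (q (enumk n)) * c n = coef f (enumk n)"
          using q1[OF False] by (simp add: c_def)
        ultimately show ?thesis by (simp only: flip: sum_distrib_right)
      qed
      then show "(\<Sum>i\<in>UNIV. Re (symb [i, i] (enumk n) * c n * chr (enumk n) x)) =
          Re (coef f (enumk n) * chr (enumk n) x)"
        by (simp only: flip: Re_sum sum_distrib_right)
    qed
    also have "\<dots> = f x" using fourier_inversion[OF f] by (simp add: fser_def)
    finally show ?thesis .
  qed
  \<comment> \<open>Normalising the mean changes no derivative.\<close>
  define w where "w x = u x - mean u" for x
  have "partial w i = partial u i" for i
    unfolding w_def by (subst partial_diff) (auto simp: partial_const smooth3_const smooth_T3D(1)[OF u])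
  moreover have "smooth_T3 w" unfolding w_def by (intro smooth_T3_diff smooth_T3_const u)
  moreover have "mean w = 0"
    unfolding w_def by (subst mean_diff) (auto simp: mean_const smooth_T3D(3)[OF u])
  ultimately show ?thesis using lap by (intro exI[of _ w]) simp
qed

text \<open>A crude Sobolev embedding through \<open>coef_decay\<close>: mean zero removes the one
  frequency that the decay bound misses. The constant stays existential, as it serves only
  convergence.\<close>

lemma sup_le_L1_derivatives:
  "\<exists>K\<ge>0. \<forall>f x. smooth_T3 f \<longrightarrow> mean f = 0 \<longrightarrow> \<bar>f x\<bar> \<le> K * (\<Sum>j\<in>UNIV. L1 (pds (replicate 6 j) f))"
proof (intro exI conjI allI impI)
  let ?K = "\<Sum>n. decay3 (enumk n)"
  show "?K \<ge> 0" by (intro suminf_nonneg summable_decay3 decay_nonneg)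
  fix f x assume f: "smooth_T3 f" and "mean f = 0"
  then have c0: "coef f 0 = 0" by (simp add: coef_0)
  let ?B = "\<Sum>j\<in>UNIV. L1 (pds (replicate 6 j) f)"
  have B: "?B \<ge> 0" by (intro sum_nonneg L1_nonneg smooth_T3D(3) smooth_T3_pds f)
  have le: "norm (Re (coef f (enumk n) * chr (enumk n) x)) \<le> decay3 (enumk n) * ?B" for n
  proof -
    have "norm (Re (coef f (enumk n) * chr (enumk n) x)) \<le> norm (coef f (enumk n))"
      by (simp only: real_norm_def abs_Re_chr_le)
    also have "\<dots> \<le> decay3 (enumk n) * ?B"
      using coef_decay[OF f, of "enumk n"] c0 B decay_nonneg by (cases "enumk n = 0") auto
    finally show ?thesis .
  qed
  have "\<bar>f x\<bar> = norm (\<Sum>n. Re (coef f (enumk n) * chr (enumk n) x))"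
    using fourier_inversion[OF f] by (simp add: fser_def)
  also have "\<dots> \<le> (\<Sum>n. decay3 (enumk n) * ?B)"
    by (rule norm_suminf_le[OF le]) (intro summable_mult2 summable_decay3)
  also have "\<dots> = ?K * ?B" by (rule suminf_mult2[symmetric]) (rule summable_decay3)
  finally show "\<bar>f x\<bar> \<le> ?K * ?B" .
qed

section \<open>Sobolev seminorms and the energy estimate\<close>

definition L2 :: "(real^3 \<Rightarrow> real) \<Rightarrow> real" where
  "L2 f = sqrt (mean (\<lambda>x. (f x)\<^sup>2))"

lemma mean_nonneg:
  fixes f :: "real^3 \<Rightarrow> real"
  shows "continuous_on UNIV f \<Longrightarrow> (\<And>x. f x \<ge> 0) \<Longrightarrow> mean f \<ge> 0"
  using mean_mono[of "\<lambda>x. 0" f] by (simp add: mean_const)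

lemma L2_nonneg: "continuous_on UNIV f \<Longrightarrow> L2 f \<ge> 0"
  unfolding L2_def by (intro real_sqrt_ge_zero mean_nonneg continuous_intros) auto

lemma L2_square: "continuous_on UNIV f \<Longrightarrow> (L2 f)\<^sup>2 = mean (\<lambda>x. (f x)\<^sup>2)"
  unfolding L2_def by (intro real_sqrt_pow2 mean_nonneg continuous_intros) auto

text \<open>Cauchy--Schwarz: the mean of (s f - h)^2 is nonnegative for every \<open>s\<close>. The
  degenerate cases of a vanishing norm get their own choices of \<open>s\<close>.\<close>

lemma mean_mult_le:
  assumes f: "continuous_on UNIV f" and h: "continuous_on UNIV h"
  shows "mean (\<lambda>x. f x * h x) \<le> L2 f * L2 h"
proof -
  have *: "2 * s * mean (\<lambda>x. f x * h x) \<le> s\<^sup>2 * (L2 f)\<^sup>2 + (L2 h)\<^sup>2" for s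
  proof -
    have "0 \<le> mean (\<lambda>x. (s * f x - h x)\<^sup>2)"
      by (intro mean_nonneg continuous_intros f h) auto
    also have "(\<lambda>x. (s * f x - h x)\<^sup>2) = (\<lambda>x. (s\<^sup>2 * (f x)\<^sup>2 + (h x)\<^sup>2) - 2 * s * (f x * h x))"
      by (simp add: power2_eq_square algebra_simps)
    also have "mean \<dots> = s\<^sup>2 * (L2 f)\<^sup>2 + (L2 h)\<^sup>2 - 2 * s * mean (\<lambda>x. f x * h x)"
      by (simp add: mean_diff mean_add mean_mult_left L2_square f h continuous_intros)
    finally show ?thesis by simp
  qed
  have L: "L2 f \<ge> 0" "L2 h \<ge> 0" by (intro L2_nonneg f h)+
  show ?thesis
  proof (cases "L2 f = 0")
    case True
    have "mean (\<lambda>x. f x * h x) \<le> e" if "e > 0" for e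
    proof -
      define P where "P = (L2 h)\<^sup>2 + 1"
      have P: "P > 0" "(L2 h)\<^sup>2 \<le> P" by (simp_all add: P_def add_nonneg_pos)
      have "2 * (P / e) * mean (\<lambda>x. f x * h x) \<le> P"
        using *[of "P / e"] True P by simp
      then have "P * (2 * mean (\<lambda>x. f x * h x)) \<le> P * e"
        using \<open>e > 0\<close> by (simp add: field_simps)
      then have "2 * mean (\<lambda>x. f x * h x) \<le> e" using P by simp
      then show ?thesis using \<open>e > 0\<close> by linarith
    qed
    then have "mean (\<lambda>x. f x * h x) \<le> 0" by (rule dense_ge)
    then show ?thesis using True by simp
  next
    case False
    then have p: "L2 f > 0" using L by simp
    have "2 * (L2 h / L2 f) * mean (\<lambda>x. f x * h x) \<le> 2 * (L2 h)\<^sup>2"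
      using *[of "L2 h / L2 f"] p by (simp add: power_divide)
    then have "L2 h * mean (\<lambda>x. f x * h x) \<le> L2 h * (L2 f * L2 h)"
      using p by (simp add: field_simps power2_eq_square)
    moreover have "mean (\<lambda>x. f x * h x) \<le> 0" if "L2 h = 0"
    proof (rule ccontr)
      assume "\<not> ?thesis"
      then have m: "mean (\<lambda>x. f x * h x) > 0" by simp
      let ?m = "mean (\<lambda>x. f x * h x)"
      have "2 * (?m / (L2 f)\<^sup>2) * ?m \<le> (?m / (L2 f)\<^sup>2)\<^sup>2 * (L2 f)\<^sup>2"
        using *[of "?m / (L2 f)\<^sup>2"] \<open>L2 h = 0\<close> by simp
      also have "\<dots> = (?m / (L2 f)\<^sup>2) * ?m" using p by (simp add: power2_eq_square)
      finally have "(?m / (L2 f)\<^sup>2) * ?m \<le> 0" by simp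
      moreover have "(?m / (L2 f)\<^sup>2) * ?m > 0" using m p by simp
      ultimately show False by linarith
    qed
    ultimately show ?thesis using L by (cases "L2 h = 0") auto
  qed
qed

lemma L2_add:
  assumes f: "continuous_on UNIV f" and h: "continuous_on UNIV h"
  shows "L2 (\<lambda>x. f x + h x) \<le> L2 f + L2 h"
proof (rule power2_le_imp_le)
  have "(L2 (\<lambda>x. f x + h x))\<^sup>2 = mean (\<lambda>x. (f x + h x)\<^sup>2)"
    by (intro L2_square continuous_intros f h)
  also have "(\<lambda>x. (f x + h x)\<^sup>2) = (\<lambda>x. ((f x)\<^sup>2 + (h x)\<^sup>2) + 2 * (f x * h x))"
    by (simp add: power2_eq_square algebra_simps)
  also have "mean \<dots> = (L2 f)\<^sup>2 + (L2 h)\<^sup>2 + 2 * mean (\<lambda>x. f x * h x)"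
    by (simp add: mean_add mean_mult_left L2_square f h continuous_intros)
  also have "\<dots> \<le> (L2 f + L2 h)\<^sup>2"
    using mean_mult_le[OF f h] by (simp add: power2_eq_square algebra_simps)
  finally show "(L2 (\<lambda>x. f x + h x))\<^sup>2 \<le> (L2 f + L2 h)\<^sup>2" .
qed (intro add_nonneg_nonneg L2_nonneg f h)

lemma L2_mult_le:
  assumes f: "continuous_on UNIV f" and b: "continuous_on UNIV b" "\<And>x. \<bar>b x\<bar> \<le> B"
  shows "L2 (\<lambda>x. b x * f x) \<le> B * L2 f"
proof (rule power2_le_imp_le)
  have "B \<ge> 0" using b(2)[of 0] by linarith
  then show "0 \<le> B * L2 f" using L2_nonneg[OF f] by simp
  have "(L2 (\<lambda>x. b x * f x))\<^sup>2 = mean (\<lambda>x. (b x * f x)\<^sup>2)"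
    by (intro L2_square continuous_intros f b)
  also have "\<dots> \<le> mean (\<lambda>x. B\<^sup>2 * (f x)\<^sup>2)"
    by (intro mean_mono continuous_intros f b)
       (auto simp: power_mult_distrib intro!: mult_right_mono abs_le_square_iff[THEN iffD1] order_trans[OF b(2)])
  also have "\<dots> = (B * L2 f)\<^sup>2" by (simp add: mean_mult_left L2_square f power_mult_distrib)
  finally show "(L2 (\<lambda>x. b x * f x))\<^sup>2 \<le> (B * L2 f)\<^sup>2" .
qed

lemma L1_le_L2: "continuous_on UNIV f \<Longrightarrow> L1 f \<le> L2 f"
  using mean_mult_le[of "\<lambda>x. \<bar>f x\<bar>" "\<lambda>x. 1"]
  by (simp add: L1_def L2_def continuous_intros mean_const)

text \<open>Homogeneous seminorm: order exactly \<open>s\<close>, as the plain sum of L2 norms over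
  all words of \<open>s\<close> indices. Sums instead of square roots let estimates be proved one
  derivative at a time.\<close>

primrec sob :: "nat \<Rightarrow> (real^3 \<Rightarrow> real) \<Rightarrow> real" where
  "sob 0 f = L2 f"
| "sob (Suc s) f = (\<Sum>k\<in>UNIV. sob s (partial f k))"

lemma sob_nonneg: "smooth_T3 f \<Longrightarrow> sob s f \<ge> 0"
  by (induction s arbitrary: f) (auto intro!: L2_nonneg smooth_T3D(3) sum_nonneg smooth_T3_partial)

lemma sob_add: "smooth_T3 f \<Longrightarrow> smooth_T3 h \<Longrightarrow> sob s (\<lambda>x. f x + h x) \<le> sob s f + sob s h"
proof (induction s arbitrary: f h)
  case 0
  then show ?case by (simp add: L2_add smooth_T3D(3))
next
  case (Suc s)
  have "sob (Suc s) (\<lambda>x. f x + h x) = (\<Sum>k\<in>UNIV. sob s (\<lambda>x. partial f k x + partial h k x))"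
    by (simp add: partial_add smooth_T3D(1) Suc.prems)
  also have "\<dots> \<le> (\<Sum>k\<in>UNIV. sob s (partial f k) + sob s (partial h k))"
    by (intro sum_mono Suc.IH smooth_T3_partial Suc.prems)
  finally show ?case by (simp add: sum.distrib)
qed

lemma sob_zero: "sob s (\<lambda>x. 0) = 0"
  by (induction s) (simp_all add: L2_def mean_const partial_const)

lemma sob_sum:
  "finite I \<Longrightarrow> (\<And>i. i \<in> I \<Longrightarrow> smooth_T3 (f i)) \<Longrightarrow> sob s (\<lambda>x. \<Sum>i\<in>I. f i x) \<le> (\<Sum>i\<in>I. sob s (f i))"
proof (induction I rule: finite_induct)
  case (insert i I)
  then show ?case
    using sob_add[of "f i" "\<lambda>x. \<Sum>i\<in>I. f i x" s] by (force simp: smooth_T3_sum)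
qed (simp add: sob_zero)

lemma L2_pds_le_sob: "smooth_T3 f \<Longrightarrow> L2 (pds ks f) \<le> sob (length ks) f"
proof (induction ks arbitrary: f rule: rev_induct)
  case (snoc k ks)
  have "L2 (pds (ks @ [k]) f) \<le> sob (length ks) (partial f k)"
    using snoc by (simp add: pds_append smooth_T3_partial)
  also have "\<dots> \<le> (\<Sum>k\<in>UNIV. sob (length ks) (partial f k))"
    by (rule member_le_sum) (auto intro: sob_nonneg smooth_T3_partial snoc.prems)
  finally show ?case by simp
qed simp

lemma smooth_T3_bounded: "smooth_T3 f \<Longrightarrow> \<exists>B\<ge>0. \<forall>x. \<bar>f x\<bar> \<le> B"
  using periodic3_bounded[of f] smooth_T3D(2,3)[of f] by auto

text \<open>The top-order coefficient is the bare sup norm of \<open>b\<close>, uniformly in \<open>s\<close>; this is what keeps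
  the iteration below contracting in every Sobolev norm.\<close>
lemma sob_mult:
  assumes "smooth_T3 b"
  shows "\<exists>C\<ge>0. \<forall>B h. (\<forall>x. \<bar>b x\<bar> \<le> B) \<longrightarrow> smooth_T3 h \<longrightarrow>
    sob s (\<lambda>x. b x * h x) \<le> B * sob s h + C * (\<Sum>r<s. sob r h)"
  using assms
proof (induction s arbitrary: b)
  case 0
  then show ?case by (intro exI[of _ 0]) (auto intro!: L2_mult_le smooth_T3D(3))
next
  case (Suc s)
  from Suc.IH[OF Suc.prems] obtain C where C: "C \<ge> 0"
    "\<And>B h. \<lbrakk>\<forall>x. \<bar>b x\<bar> \<le> B; smooth_T3 h\<rbrakk> \<Longrightarrow>
      sob s (\<lambda>x. b x * h x) \<le> B * sob s h + C * (\<Sum>r<s. sob r h)" by blast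
  \<comment> \<open>A derivative falling on \<open>b\<close> leaves at most \<open>s\<close> of them
    on \<open>h\<close>, so this term is of lower order and any constant is acceptable.\<close>
  have "\<exists>D\<ge>0. \<forall>h. smooth_T3 h \<longrightarrow> sob s (\<lambda>x. partial b k x * h x) \<le> D * (\<Sum>r<Suc s. sob r h)" for k
  proof -
    obtain B where B: "B \<ge> 0" "\<forall>x. \<bar>partial b k x\<bar> \<le> B"
      using smooth_T3_bounded[OF smooth_T3_partial[OF Suc.prems]] by blast
    from Suc.IH[OF smooth_T3_partial[OF Suc.prems]] obtain C' where C': "C' \<ge> 0"
      "\<And>B h. \<lbrakk>\<forall>x. \<bar>partial b k x\<bar> \<le> B; smooth_T3 h\<rbrakk> \<Longrightarrow>
        sob s (\<lambda>x. partial b k x * h x) \<le> B * sob s h + C' * (\<Sum>r<s. sob r h)" by blast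
    show ?thesis
    proof (intro exI[of _ "B + C'"] conjI allI impI)
      fix h assume h: "smooth_T3 h"
      have p: "sob s h \<ge> 0" "(\<Sum>r<s. sob r h) \<ge> 0" by (intro sum_nonneg sob_nonneg h)+
      have "sob s (\<lambda>x. partial b k x * h x) \<le> B * sob s h + C' * (\<Sum>r<s. sob r h)"
        by (rule C'(2)[OF B(2) h])
      also have "\<dots> \<le> (B + C') * (\<Sum>r<Suc s. sob r h)"
        using p B C' by (simp add: algebra_simps)
      finally show "sob s (\<lambda>x. partial b k x * h x) \<le> (B + C') * (\<Sum>r<Suc s. sob r h)" .
    qed (use B C' in simp)
  qed
  then obtain D where D: "\<And>k. D k \<ge> 0"
    "\<And>k h. smooth_T3 h \<Longrightarrow> sob s (\<lambda>x. partial b k x * h x) \<le> D k * (\<Sum>r<Suc s. sob r h)" by metis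
  show ?case
  proof (intro exI[of _ "(\<Sum>k\<in>UNIV. D k) + C"] conjI allI impI)
    fix B h assume B: "\<forall>x. \<bar>b x\<bar> \<le> B" and h: "smooth_T3 h"
    have "sob (Suc s) (\<lambda>x. b x * h x) = (\<Sum>k\<in>UNIV. sob s (\<lambda>x. partial b k x * h x + b x * partial h k x))"
      by (simp add: partial_mult smooth_T3D(1) Suc.prems h)
    also have "\<dots> \<le> (\<Sum>k\<in>UNIV. D k * (\<Sum>r<Suc s. sob r h) +
        (B * sob s (partial h k) + C * (\<Sum>r<s. sob r (partial h k))))"
      by (intro sum_mono order_trans[OF sob_add] add_mono D C(2)[OF B] smooth_T3_mult smooth_T3_partial h Suc.prems)
    also have "\<dots> = (\<Sum>k\<in>UNIV. D k) * (\<Sum>r<Suc s. sob r h) + B * sob (Suc s) h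
        + C * (\<Sum>k\<in>UNIV. \<Sum>r<s. sob r (partial h k))"
      by (simp add: sum.distrib sum_distrib_left sum_distrib_right)
    also have "(\<Sum>k\<in>UNIV. \<Sum>r<s. sob r (partial h k)) = (\<Sum>r<s. sob (Suc r) h)"
      by (subst sum.swap) simp
    also have "(\<Sum>k\<in>UNIV. D k) * (\<Sum>r<Suc s. sob r h) + B * sob (Suc s) h + C * (\<Sum>r<s. sob (Suc r) h)
       \<le> (\<Sum>k\<in>UNIV. D k) * (\<Sum>r<Suc s. sob r h) + B * sob (Suc s) h + C * (\<Sum>r<Suc s. sob r h)"
      using C(1) sob_nonneg[OF h, of 0] by (intro add_left_mono mult_left_mono) (auto simp: sum.lessThan_Suc_shift simp del: sum.lessThan_Suc sob.simps)
    finally show "sob (Suc s) (\<lambda>x. b x * h x) \<le> B * sob (Suc s) h + ((\<Sum>k\<in>UNIV. D k) + C) * (\<Sum>r<Suc s. sob r h)"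
      by (simp add: algebra_simps)
  qed (use C D in \<open>simp add: sum_nonneg\<close>)
qed

lemma integration_by_parts:
  assumes u: "smooth_T3 u" and w: "smooth_T3 w"
  shows "mean (\<lambda>x. u x * partial w j x) = - mean (\<lambda>x. partial u j x * w x)"
proof -
  have "0 = mean (\<lambda>x. partial u j x * w x + u x * partial w j x)"
    using mean_partial[OF smooth_T3_mult[OF u w], of j]
    by (simp add: partial_mult smooth_T3D(1) u w)
  then show ?thesis
    by (simp add: mean_add continuous_on_mult smooth_T3D(3) smooth_T3_partial u w)
qed

text \<open>Testing the equation with \<open>u\<close> expresses the squared L2 norm of the gradient
  as minus the sum of the pairings of \<open>partial u j\<close> with \<open>F j\<close>, and one
  factor cancels. Derivatives of \<open>u\<close> solve the differentiated equation, so every order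
  follows with the same constant 1.\<close>

lemma energy_estimate:
  assumes "smooth_T3 u" "\<And>j. smooth_T3 (F j)"
    and "\<And>x. (\<Sum>i\<in>UNIV. partial (partial u i) i x) = - (\<Sum>j\<in>UNIV. partial (F j) j x)"
  shows "sob s (partial u i) \<le> (\<Sum>j\<in>UNIV. sob s (F j))"
  using assms
proof (induction s arbitrary: u F i)
  case (0 u F i)
  note u = 0(1) and F = 0(2) and eq = 0(3)
  note cont = smooth_T3D(3)
  define G where "G = (\<Sum>i\<in>UNIV. (L2 (partial u i))\<^sup>2)"
  have G: "G \<ge> 0" unfolding G_def by (intro sum_nonneg) auto
  have le: "L2 (partial u j) \<le> sqrt G" for j
    unfolding G_def by (intro real_le_rsqrt member_le_sum) auto
  have "G = (\<Sum>i\<in>UNIV. mean (\<lambda>x. partial u i x * partial u i x))"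
    unfolding G_def L2_square[OF cont[OF smooth_T3_partial[OF u]]] by (simp add: power2_eq_square)
  also have "\<dots> = - (\<Sum>i\<in>UNIV. mean (\<lambda>x. u x * partial (partial u i) i x))"
    by (simp add: integration_by_parts u smooth_T3_partial sum_negf)
  also have "(\<Sum>i\<in>UNIV. mean (\<lambda>x. u x * partial (partial u i) i x)) =
      mean (\<lambda>x. u x * (\<Sum>i\<in>UNIV. partial (partial u i) i x))"
    unfolding sum_distrib_left
    by (intro mean_sum[symmetric] continuous_on_mult cont smooth_T3_partial u) auto
  also have "(\<lambda>x. u x * (\<Sum>i\<in>UNIV. partial (partial u i) i x)) = (\<lambda>x. - 1 * (\<Sum>j\<in>UNIV. u x * partial (F j) j x))"
    by (simp add: eq sum_distrib_left sum_negf)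
  also have "mean \<dots> = - (\<Sum>j\<in>UNIV. mean (\<lambda>x. u x * partial (F j) j x))"
    unfolding mean_mult_left
    by (subst mean_sum) (auto intro!: cont smooth_T3_mult smooth_T3_partial u F)
  also have "- (- (\<Sum>j\<in>UNIV. mean (\<lambda>x. u x * partial (F j) j x))) = (\<Sum>j\<in>UNIV. - mean (\<lambda>x. partial u j x * F j x))"
    by (simp add: integration_by_parts u F sum_negf)
  also have "\<dots> = (\<Sum>j\<in>UNIV. mean (\<lambda>x. (-1 * partial u j x) * F j x))"
    by (simp only: mult.assoc mean_mult_left) simp
  also have "\<dots> \<le> (\<Sum>j\<in>UNIV. sqrt G * L2 (F j))"
  proof (rule sum_mono)
    fix j
    have "mean (\<lambda>x. (-1 * partial u j x) * F j x) \<le> L2 (\<lambda>x. -1 * partial u j x) * L2 (F j)"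
      by (intro mean_mult_le continuous_on_mult continuous_on_const cont smooth_T3_partial u F)
    also have "L2 (\<lambda>x. -1 * partial u j x) = L2 (partial u j)" by (simp add: L2_def)
    also have "\<dots> * L2 (F j) \<le> sqrt G * L2 (F j)"
      by (intro mult_right_mono le L2_nonneg cont F)
    finally show "mean (\<lambda>x. (-1 * partial u j x) * F j x) \<le> sqrt G * L2 (F j)" .
  qed
  also have "\<dots> = sqrt G * (\<Sum>j\<in>UNIV. L2 (F j))" by (simp add: sum_distrib_left)
  finally have *: "sqrt G * sqrt G \<le> sqrt G * (\<Sum>j\<in>UNIV. L2 (F j))" using G by simp
  have "sqrt G \<le> (\<Sum>j\<in>UNIV. L2 (F j))"
  proof (cases "G = 0")
    case True
    then show ?thesis by (simp add: sum_nonneg L2_nonneg cont F)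
  next
    case False
    then have "sqrt G > 0" using G by simp
    then show ?thesis by (rule mult_left_le_imp_le[OF *])
  qed
  then show ?case using le[of i] by simp
next
  case (Suc s u F i)
  note u = Suc.prems(1) and F = Suc.prems(2) and eq = Suc.prems(3)
  have "sob s (partial (partial u i) k) \<le> (\<Sum>j\<in>UNIV. sob s (partial (F j) k))" for k
  proof -
    have "sob s (partial (partial u k) i) \<le> (\<Sum>j\<in>UNIV. sob s (partial (F j) k))"
    proof (rule Suc.IH)
      fix x
      have c: "partial (partial (partial u k) i) i = partial (partial (partial u i) i) k" for i
        by (metis partial_commute smooth_T3_partial u)
      have c': "partial (partial (F j) k) j = partial (partial (F j) j) k" for j
        by (metis partial_commute F)
      have "(\<Sum>i\<in>UNIV. partial (partial (partial u k) i) i x) =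
          partial (\<lambda>x. \<Sum>i\<in>UNIV. partial (partial u i) i x) k x"
        unfolding c by (subst partial_sum) (auto intro: smooth_T3D(1) smooth_T3_partial u)
      also have "\<dots> = - partial (\<lambda>x. \<Sum>j\<in>UNIV. partial (F j) j x) k x"
        unfolding eq by (subst partial_minus) (auto intro!: smooth_T3D(1) smooth_T3_sum smooth_T3_partial F)
      also have "\<dots> = - (\<Sum>j\<in>UNIV. partial (partial (F j) k) j x)"
        unfolding c' by (subst partial_sum) (auto intro: smooth_T3D(1) smooth_T3_partial F)
      finally show "(\<Sum>i\<in>UNIV. partial (partial (partial u k) i) i x) = - (\<Sum>j\<in>UNIV. partial (partial (F j) k) j x)" .
    qed (intro smooth_T3_partial u F)+
    then show ?thesis by (simp add: partial_commute[OF u, of i k])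
  qed
  then have "sob (Suc s) (partial u i) \<le> (\<Sum>k\<in>UNIV. \<Sum>j\<in>UNIV. sob s (partial (F j) k))"
    by (auto intro: sum_mono)
  also have "\<dots> = (\<Sum>j\<in>UNIV. sob (Suc s) (F j))" by (subst sum.swap) simp
  finally show ?case .
qed

text \<open>Summing the recursion bounds (1 - q) times each partial sum by
  \<open>a 0 + suminf b\<close>. In the application \<open>b\<close> holds the lower-order terms,
  whose summability is known by induction.\<close>

lemma summable_recurrence:
  fixes a b :: "nat \<Rightarrow> real"
  assumes "\<And>n. a n \<ge> 0" "\<And>n. b n \<ge> 0" "\<And>n. a (Suc n) \<le> q * a n + b n" "q < 1" "summable b"
  shows "summable a"
proof (rule summableI_nonneg_bounded)
  fix N
  have "(\<Sum>n<N. a n) \<le> (\<Sum>n<Suc N. a n)" using assms(1) by simp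
  also have "\<dots> = a 0 + (\<Sum>n<N. a (Suc n))" by (rule sum.lessThan_Suc_shift)
  also have "(\<Sum>n<N. a (Suc n)) \<le> (\<Sum>n<N. q * a n + b n)" by (intro sum_mono assms)
  also have "\<dots> = q * (\<Sum>n<N. a n) + (\<Sum>n<N. b n)" by (simp add: sum.distrib sum_distrib_left)
  also have "(\<Sum>n<N. b n) \<le> suminf b" by (intro sum_le_suminf assms) auto
  finally have "(1 - q) * (\<Sum>n<N. a n) \<le> a 0 + suminf b" by (simp add: algebra_simps)
  then show "(\<Sum>n<N. a n) \<le> (a 0 + suminf b) / (1 - q)"
    using assms(4) by (simp add: field_simps)
qed (rule assms)

section \<open>Solvability of the divergence-form equation\<close>

definition flux :: "(3 \<Rightarrow> 3 \<Rightarrow> real^3 \<Rightarrow> real) \<Rightarrow> (real^3 \<Rightarrow> real) \<Rightarrow> 3 \<Rightarrow> real^3 \<Rightarrow> real" where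
  "flux B u i x = (\<Sum>j\<in>UNIV. B i j x * partial u j x)"

lemma smooth_T3_flux:
  "(\<And>i j. smooth_T3 (B i j)) \<Longrightarrow> smooth_T3 u \<Longrightarrow> smooth_T3 (flux B u i)"
  unfolding flux_def by (intro smooth_T3_sum smooth_T3_mult smooth_T3_partial) auto

lemma partial_flux:
  assumes "\<And>i j. smooth_T3 (B i j)" "smooth_T3 u"
  shows "partial (flux B u i) k x =
    (\<Sum>j\<in>UNIV. partial (B i j) k x * partial u j x + B i j x * partial (partial u j) k x)"
  unfolding flux_def
  by (subst partial_sum)
     (auto simp: partial_mult smooth_T3D(1) smooth_T3_partial smooth_T3_mult assms
       intro!: smooth_T3D(1) smooth_T3_mult smooth_T3_partial assms)

lemma mean_divergence:
  assumes "\<And>j. smooth_T3 (F j)" shows "mean (\<lambda>x. - (\<Sum>j\<in>UNIV. partial (F j) j x)) = 0"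
proof -
  have "mean (\<lambda>x. \<Sum>j\<in>UNIV. partial (F j) j x) = 0"
    by (subst mean_sum) (auto simp: mean_partial assms intro!: smooth_T3D(3) smooth_T3_partial)
  then show ?thesis
    using mean_mult_left[of "-1" "\<lambda>x. \<Sum>j\<in>UNIV. partial (F j) j x"] by simp
qed

lemma poisson_divergence:
  assumes "\<And>j. smooth_T3 (F j)"
  shows "\<exists>u. smooth_T3 u \<and> mean u = 0 \<and>
    (\<forall>x. (\<Sum>i\<in>UNIV. partial (partial u i) i x) = - (\<Sum>j\<in>UNIV. partial (F j) j x))"
  by (intro poisson_solvable mean_divergence smooth_T3_minus smooth_T3_sum smooth_T3_partial assms) auto

text \<open>\<open>sob_mult\<close> fed into the energy estimate. The 9 counts three derivatives of
  \<open>v\<close> times three flux components; \<open>C\<close> may depend on \<open>s\<close> and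
  \<open>B\<close> but must serve all pairs \<open>u\<close>, \<open>v\<close>, because it is
  applied along the whole iteration.\<close>

lemma sob_flux_step:
  assumes B: "\<And>i j. smooth_T3 (B i j)" and bd: "\<And>i j x. \<bar>B i j x\<bar> \<le> \<beta>"
  shows "\<exists>C\<ge>0. \<forall>u v. smooth_T3 u \<longrightarrow> smooth_T3 v \<longrightarrow>
    (\<forall>x. (\<Sum>i\<in>UNIV. partial (partial v i) i x) = - (\<Sum>i\<in>UNIV. partial (flux B u i) i x)) \<longrightarrow>
    sob (Suc s) v \<le> 9 * \<beta> * sob (Suc s) u + C * (\<Sum>r<s. sob (Suc r) u)"
proof -
  obtain C where C: "\<And>i j. C i j \<ge> 0" "\<And>i j h. smooth_T3 h \<Longrightarrow>
      sob s (\<lambda>x. B i j x * h x) \<le> \<beta> * sob s h + C i j * (\<Sum>r<s. sob r h)"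
    using sob_mult[OF B, where s=s] bd by metis
  define D where "D = (\<Sum>i\<in>UNIV. \<Sum>j\<in>UNIV. C i j)"
  have CD: "C i j \<le> D" for i j
  proof -
    have "C i j \<le> (\<Sum>j\<in>UNIV. C i j)" by (rule member_le_sum) (auto simp: C)
    also have "\<dots> \<le> D" unfolding D_def by (rule member_le_sum) (auto simp: C sum_nonneg)
    finally show ?thesis .
  qed
  have D0: "D \<ge> 0" unfolding D_def by (intro sum_nonneg C)
  show ?thesis
  proof (intro exI[of _ "9 * D"] conjI allI impI)
    fix u v assume u: "smooth_T3 u" and v: "smooth_T3 v"
      and eq: "\<forall>x. (\<Sum>i\<in>UNIV. partial (partial v i) i x) = - (\<Sum>i\<in>UNIV. partial (flux B u i) i x)"
    let ?R = "\<Sum>r<s. sob (Suc r) u"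
    have fl: "sob s (flux B u i) \<le> \<beta> * sob (Suc s) u + D * ?R" for i
    proof -
      have "sob s (flux B u i) \<le> (\<Sum>j\<in>UNIV. sob s (\<lambda>x. B i j x * partial u j x))"
        unfolding flux_def[abs_def] by (intro sob_sum smooth_T3_mult B smooth_T3_partial u) auto
      also have "\<dots> \<le> (\<Sum>j\<in>UNIV. \<beta> * sob s (partial u j) + D * (\<Sum>r<s. sob r (partial u j)))"
      proof (rule sum_mono)
        fix j
        have "sob s (\<lambda>x. B i j x * partial u j x) \<le>
            \<beta> * sob s (partial u j) + C i j * (\<Sum>r<s. sob r (partial u j))"
          by (intro C smooth_T3_partial u)
        also have "\<dots> \<le> \<beta> * sob s (partial u j) + D * (\<Sum>r<s. sob r (partial u j))"
          by (intro add_left_mono mult_right_mono CD sum_nonneg sob_nonneg smooth_T3_partial u)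
        finally show "sob s (\<lambda>x. B i j x * partial u j x) \<le>
            \<beta> * sob s (partial u j) + D * (\<Sum>r<s. sob r (partial u j))" .
      qed
      also have "\<dots> = \<beta> * sob (Suc s) u + D * (\<Sum>j\<in>UNIV. \<Sum>r<s. sob r (partial u j))"
        by (simp add: sum.distrib sum_distrib_left)
      also have "(\<Sum>j\<in>UNIV. \<Sum>r<s. sob r (partial u j)) = ?R"
        by (subst sum.swap) simp
      finally show ?thesis .
    qed
    have "sob (Suc s) v = (\<Sum>i\<in>UNIV. sob s (partial v i))" by simp
    also have "\<dots> \<le> (\<Sum>i\<in>(UNIV::3 set). \<Sum>j\<in>UNIV. sob s (flux B u j))"
      using eq by (intro sum_mono energy_estimate v smooth_T3_flux B u) auto
    also have "\<dots> \<le> (\<Sum>i\<in>(UNIV::3 set). \<Sum>j\<in>(UNIV::3 set). \<beta> * sob (Suc s) u + D * ?R)"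
      by (intro sum_mono fl)
    also have "\<dots> = 9 * \<beta> * sob (Suc s) u + 9 * D * ?R" by (simp add: algebra_simps)
    finally show "sob (Suc s) v \<le> 9 * \<beta> * sob (Suc s) u + 9 * D * ?R" .
  qed (use D0 in simp)
qed

lemma sup_pds_le_sob:
  "\<exists>K\<ge>0. \<forall>f ks x. smooth_T3 f \<longrightarrow> mean f = 0 \<longrightarrow> \<bar>pds ks f x\<bar> \<le> K * sob (6 + length ks) f"
proof -
  obtain K where K: "K \<ge> 0"
    "\<And>f x. \<lbrakk>smooth_T3 f; mean f = 0\<rbrakk> \<Longrightarrow> \<bar>f x\<bar> \<le> K * (\<Sum>j\<in>UNIV. L1 (pds (replicate 6 j) f))"
    using sup_le_L1_derivatives by blast
  show ?thesis
  proof (intro exI[of _ "K * 3"] conjI allI impI)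
    fix f :: "real^3 \<Rightarrow> real" and ks x assume f: "smooth_T3 f" and "mean f = 0"
    \<comment> \<open>The empty word keeps the mean of \<open>f\<close>; any other word is a
      derivative and has mean 0.\<close>
    then have "mean (pds ks f) = 0"
      by (cases ks) (auto intro!: mean_partial smooth_T3_pds)
    from K(2)[OF smooth_T3_pds[OF f] this]
    have "\<bar>pds ks f x\<bar> \<le> K * (\<Sum>j\<in>UNIV. L1 (pds (replicate 6 j) (pds ks f)))" .
    also have "\<dots> \<le> K * (\<Sum>j\<in>(UNIV::3 set). sob (6 + length ks) f)"
    proof (intro mult_left_mono sum_mono K(1))
      fix j
      have "L1 (pds (replicate 6 j) (pds ks f)) \<le> L2 (pds (replicate 6 j @ ks) f)"
        unfolding pds_append by (intro L1_le_L2 smooth_T3D(3) smooth_T3_pds f)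
      also have "\<dots> \<le> sob (length (replicate 6 j @ ks)) f" by (rule L2_pds_le_sob[OF f])
      finally show "L1 (pds (replicate 6 j) (pds ks f)) \<le> sob (6 + length ks) f" by simp
    qed
    finally show "\<bar>pds ks f x\<bar> \<le> K * 3 * sob (6 + length ks) f" by simp
  qed (use K in simp)
qed

theorem divergence_equation_solvable:
  assumes B: "\<And>i j. smooth_T3 (B i j)" and bd: "\<And>i j x. \<bar>B i j x\<bar> \<le> \<beta>" and \<beta>: "9 * \<beta> < 1"
    and h: "\<And>i. smooth_T3 (h i)"
  shows "\<exists>\<xi>. smooth_T3 \<xi> \<and> (\<forall>x. (\<Sum>i\<in>UNIV. partial (partial \<xi> i) i x) =
    - (\<Sum>i\<in>UNIV. partial (h i) i x) - (\<Sum>i\<in>UNIV. partial (flux B \<xi> i) i x))"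
proof -
  define lap where "lap u x = (\<Sum>i\<in>UNIV. partial (partial u i) i x)" for u x
  define dv where "dv u x = (\<Sum>i\<in>UNIV. partial (flux B u i) i x)" for u x
  obtain \<eta>0 where \<eta>0: "smooth_T3 \<eta>0" "mean \<eta>0 = 0"
    "\<And>x. lap \<eta>0 x = - (\<Sum>i\<in>UNIV. partial (h i) i x)"
    using poisson_divergence[of h, OF h] unfolding lap_def by blast
  \<comment> \<open>The premise sits inside the existential so that choice yields one total solution
    operator \<open>T\<close>.\<close>
  have "\<exists>v. smooth_T3 u \<longrightarrow> smooth_T3 v \<and> mean v = 0 \<and> (\<forall>x. lap v x = - dv u x)" for u
    using poisson_divergence[of "flux B u", OF smooth_T3_flux[OF B]] unfolding lap_def dv_def by blast
  then obtain T where T: "\<And>u. smooth_T3 u \<Longrightarrow> smooth_T3 (T u)" "\<And>u. smooth_T3 u \<Longrightarrow> mean (T u) = 0"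
    "\<And>u x. smooth_T3 u \<Longrightarrow> lap (T u) x = - dv u x" by metis
  define \<eta> where "\<eta> n = (T ^^ n) \<eta>0" for n
  have S: "\<eta> (Suc n) = T (\<eta> n)" "\<eta> 0 = \<eta>0" for n by (simp_all add: \<eta>_def)
  have sm: "smooth_T3 (\<eta> n)" for n by (induction n) (auto simp: S \<eta>0 T)
  have m0: "mean (\<eta> n) = 0" for n by (cases n) (auto simp: S \<eta>0 T sm)
  have lap_Suc: "lap (\<eta> (Suc n)) x = - dv (\<eta> n) x" for n x by (simp add: S T sm)
  \<comment> \<open>Strong induction on the order: the seminorm of order \<open>Suc s\<close>
    contracts by \<open>9 * \<beta>\<close> up to lower orders, summable by hypothesis.\<close>
  have su: "summable (\<lambda>n. sob (Suc s) (\<eta> n))" for s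
  proof (induction s rule: less_induct)
    case (less s)
    obtain C where C: "C \<ge> 0" "\<And>u v. \<lbrakk>smooth_T3 u; smooth_T3 v; \<forall>x. lap v x = - dv u x\<rbrakk> \<Longrightarrow>
        sob (Suc s) v \<le> 9 * \<beta> * sob (Suc s) u + C * (\<Sum>r<s. sob (Suc r) u)"
      using sob_flux_step[of B, OF B bd, of s] unfolding lap_def dv_def by blast
    show ?case
    proof (rule summable_recurrence)
      show "sob (Suc s) (\<eta> (Suc n)) \<le> 9 * \<beta> * sob (Suc s) (\<eta> n) + C * (\<Sum>r<s. sob (Suc r) (\<eta> n))" for n
        by (intro C sm) (simp add: lap_Suc)
      show "summable (\<lambda>n. C * (\<Sum>r<s. sob (Suc r) (\<eta> n)))"
        by (intro summable_mult summable_sum less) auto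
      show "sob (Suc s) (\<eta> n) \<ge> 0" for n by (intro sob_nonneg sm)
      show "C * (\<Sum>r<s. sob (Suc r) (\<eta> n)) \<ge> 0" for n
        by (intro mult_nonneg_nonneg C sum_nonneg sob_nonneg sm)
    qed (rule \<beta>)
  qed
  obtain K where K: "K \<ge> 0" "\<And>f ks x. \<lbrakk>smooth_T3 f; mean f = 0\<rbrakk> \<Longrightarrow> \<bar>pds ks f x\<bar> \<le> K * sob (6 + length ks) f"
    using sup_pds_le_sob by blast
  define M where "M ks n = K * sob (6 + length ks) (\<eta> n)" for ks :: "3 list" and n
  have bdM: "\<bar>pds ks (\<eta> n) x\<bar> \<le> M ks n" for ks n x unfolding M_def by (intro K sm m0)
  have suM: "summable (M ks)" for ks
    using su[of "5 + length ks"] unfolding M_def by (intro summable_mult) (simp add: eval_nat_numeral)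
  define \<xi> where "\<xi> x = (\<Sum>n. \<eta> n x)" for x
  note ser = smooth3_series[of \<eta> M, OF smooth_T3D(1)[OF sm] bdM suM, folded \<xi>_def]
  have "periodic3 \<xi>"
    using smooth_T3D(2)[OF sm] unfolding \<xi>_def periodic3_def by simp
  then have \<xi>: "smooth_T3 \<xi>" using ser(1) by (simp add: smooth_T3_def \<xi>_def[abs_def])
  have pds_sums: "(\<lambda>n. pds ks (\<eta> n) x) sums pds ks \<xi> x" for ks x
  proof -
    have "summable (\<lambda>n. pds ks (\<eta> n) x)"
      by (rule summable_comparison_test'[OF suM[of ks], of 0]) (use bdM in simp)
    then show ?thesis using ser(2)[of ks] by (simp add: \<xi>_def[abs_def] summable_sums)
  qed
  have p1: "(\<lambda>n. partial (\<eta> n) j x) sums partial \<xi> j x" for j x using pds_sums[of "[j]"] by simp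
  have p2: "(\<lambda>n. partial (partial (\<eta> n) j) i x) sums partial (partial \<xi> j) i x" for i j x
    using pds_sums[of "[i, j]"] by simp
  have lap_sums: "(\<lambda>n. lap (\<eta> n) x) sums lap \<xi> x" for x
    unfolding lap_def by (intro sums_sum p2)
  have "(\<lambda>n. dv (\<eta> n) x) sums dv \<xi> x" for x
    unfolding dv_def partial_flux[of B, OF B sm] partial_flux[of B, OF B \<xi>]
    by (intro sums_sum sums_add sums_mult p1 p2)
  then have "(\<lambda>n. lap (\<eta> (Suc n)) x) sums (- dv \<xi> x)" for x
    unfolding lap_Suc by (intro sums_minus)
  \<comment> \<open>The shifted Laplacian series lacks the first term, which carries the source
    \<open>h\<close>.\<close>
  then have "(\<lambda>n. lap (\<eta> n) x) sums (- dv \<xi> x + lap (\<eta> 0) x)" for x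
    using sums_Suc_iff by force
  then have "lap \<xi> x = - dv \<xi> x + lap \<eta>0 x" for x
    using sums_unique2[OF lap_sums[of x]] by (simp add: S)
  then show ?thesis
    using \<xi> \<eta>0(3) unfolding lap_def dv_def by (intro exI[of _ \<xi>]) simp
qed

section \<open>The gradient bound by doubling of variables\<close>

text \<open>If \<open>d > c\<close>, the symmetrised remainder \<open>u\<close> vanishes at 0 with
  its first derivative and has second derivative 2(d - c) > 0 there, so \<open>u'\<close> and then
  \<open>u\<close> are positive just to the right, against \<open>le\<close>.\<close>

lemma second_derivative_le:
  fixes w w' :: "real \<Rightarrow> real"
  assumes w: "\<And>t. (w has_real_derivative w' t) (at t)" and w': "(w' has_real_derivative d) (at 0)"
    and "\<epsilon> > 0" and le: "\<And>t. \<lbrakk>0 < t; t < \<epsilon>\<rbrakk> \<Longrightarrow> w t + w (- t) - 2 * w 0 \<le> c * t\<^sup>2"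
  shows "d \<le> c"
proof (rule ccontr)
  assume "\<not> d \<le> c"
  define u where "u t = w t + w (- t) - 2 * w 0 - c * t\<^sup>2" for t
  define u' where "u' t = w' t - w' (- t) - 2 * c * t" for t
  have du: "(u has_real_derivative u' t) (at t)" for t
    unfolding u_def u'_def
    by (rule derivative_eq_intros w DERIV_chain2[OF w, where g = uminus] refl | simp)+
  have "((\<lambda>t. w' (- t)) has_real_derivative d * (- 1)) (at 0)"
    by (rule DERIV_chain2[where f = w']) (use w' in \<open>auto intro!: derivative_eq_intros\<close>)
  then have "(u' has_real_derivative 2 * d - 2 * c) (at 0)"
    unfolding u'_def by (auto intro!: derivative_eq_intros w')
  from DERIV_pos_inc_right[OF this] \<open>\<not> d \<le> c\<close>
  obtain \<delta> where \<delta>: "\<delta> > 0" "\<And>t. \<lbrakk>0 < t; t < \<delta>\<rbrakk> \<Longrightarrow> u' 0 < u' t" by auto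
  define t where "t = min \<delta> \<epsilon> / 2"
  have t: "0 < t" "t < \<delta>" "t < \<epsilon>" using \<delta> \<open>\<epsilon> > 0\<close> by (auto simp: t_def min_def)
  have "u 0 < u t"
  proof (rule DERIV_pos_imp_increasing_open[OF t(1)])
    fix s assume "0 < s" "s < t"
    then have "u' s > 0" using \<delta>(2)[of s] t by (simp add: u'_def)
    then show "\<exists>y. (u has_real_derivative y) (at s) \<and> 0 < y" using du by blast
  qed (rule DERIV_continuous_on, rule has_field_derivative_at_within, rule du)
  then show False using le[OF t(1,3)] by (simp add: u_def)
qed

definition hess :: "(real^3 \<Rightarrow> real) \<Rightarrow> real^3 \<Rightarrow> real^3 \<Rightarrow> real" where
  "hess f x v = (\<Sum>i\<in>UNIV. \<Sum>j\<in>UNIV. v $ i * v $ j * partial (partial f i) j x)"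

lemma line_second_derivative:
  assumes f: "smooth_T3 f"
  shows "((\<lambda>t. f (x + t *\<^sub>R v)) has_real_derivative (\<Sum>i\<in>UNIV. v $ i * partial f i (x + s *\<^sub>R v))) (at s)"
    and "((\<lambda>s. \<Sum>i\<in>UNIV. v $ i * partial f i (x + s *\<^sub>R v)) has_real_derivative hess f x v) (at 0)"
proof -
  show "((\<lambda>t. f (x + t *\<^sub>R v)) has_real_derivative (\<Sum>i\<in>UNIV. v $ i * partial f i (x + s *\<^sub>R v))) (at s)"
    by (rule directional_derivative[OF f])
  have "((\<lambda>s. \<Sum>i\<in>UNIV. v $ i * partial f i (x + s *\<^sub>R v)) has_real_derivative
      (\<Sum>i\<in>UNIV. v $ i * (\<Sum>j\<in>UNIV. v $ j * partial (partial f i) j (x + 0 *\<^sub>R v)))) (at 0)"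
    by (intro DERIV_sum DERIV_cmult directional_derivative smooth_T3_partial f)
  then show "((\<lambda>s. \<Sum>i\<in>UNIV. v $ i * partial f i (x + s *\<^sub>R v)) has_real_derivative hess f x v) (at 0)"
    by (simp add: hess_def sum_distrib_left mult.assoc)
qed

lemma lipschitz_of_partials:
  assumes f: "smooth_T3 f" and bd: "\<And>k x. \<bar>partial f k x\<bar> \<le> \<beta>"
  shows "\<bar>f x - f y\<bar> \<le> 3 * \<beta> * norm (x - y)"
proof -
  let ?v = "x - y"
  have "\<beta> \<ge> 0" using bd[of 1 0] by linarith
  have le: "\<bar>\<Sum>j\<in>UNIV. ?v $ j * partial f j z\<bar> \<le> 3 * \<beta> * norm ?v" for z
  proof -
    have "\<bar>\<Sum>j\<in>UNIV. ?v $ j * partial f j z\<bar> \<le> (\<Sum>j\<in>(UNIV::3 set). norm ?v * \<beta>)"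
    proof (rule order_trans[OF sum_abs sum_mono])
      fix j :: 3
      show "\<bar>?v $ j * partial f j z\<bar> \<le> norm ?v * \<beta>"
        unfolding abs_mult by (intro mult_mono bd component_le_norm_cart) auto
    qed
    then show ?thesis by (simp add: algebra_simps)
  qed
  have "\<exists>t>0. t < 1 \<and> f (y + 1 *\<^sub>R ?v) - f (y + 0 *\<^sub>R ?v) =
      (1 - 0) * (\<Sum>j\<in>UNIV. ?v $ j * partial f j (y + t *\<^sub>R ?v))"
    by (rule MVT2[where f = "\<lambda>t. f (y + t *\<^sub>R ?v)"]) (simp, rule directional_derivative[OF f])
  then show ?thesis using le by auto
qed

text \<open>Rounding leaves coordinates of size at most 1/2, so the norm is at most sqrt 3 / 2. In
  the doubling argument this keeps the maximum away from the boundary.\<close>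

lemma ex_lattice_small: "\<exists>k. norm (z + lattice_pt k) < 1"
proof -
  define k :: "int^3" where "k = (\<chi> i. - round (z $ i))"
  have "\<bar>(z + lattice_pt k) $ i\<bar> \<le> 1 / 2" for i
    using of_int_round_abs_le[of "z $ i"] by (simp add: k_def abs_minus_commute)
  then have "((z + lattice_pt k) $ i)\<^sup>2 \<le> (1 / 2)\<^sup>2" for i
    by (metis abs_ge_zero power2_abs power_mono)
  then have "(norm (z + lattice_pt k))\<^sup>2 \<le> (\<Sum>i\<in>(UNIV::3 set). (1 / 2)\<^sup>2)"
    unfolding power2_norm_eq_inner inner_vec_def
    by (intro sum_mono) (simp add: power2_eq_square)
  then have "(norm (z + lattice_pt k))\<^sup>2 < 1\<^sup>2" by (simp add: power2_eq_square)
  then have "norm (z + lattice_pt k) < 1" by (rule power2_less_imp_less) simp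
  then show ?thesis by blast
qed

text \<open>Only \<open>Hx\<close> and \<open>- Hy\<close> are bounded from above. Pulling out the
  smaller coefficient leaves a multiple of \<open>Hx - Hy \<le> 0\<close>, and the excess
  coefficient then multiplies exactly one of these two.\<close>

lemma coupling_excess:
  fixes cx cy :: real
  assumes "cx \<ge> 0" "cy \<ge> 0" "Hx \<le> Hy" "Hx \<le> P" "- Hy \<le> P" "\<bar>cx - cy\<bar> \<le> Q" "P \<ge> 0"
  shows "cx * Hx - cy * Hy \<le> Q * P"
proof (cases "cx \<le> cy")
  case True
  have "cx * Hx - cy * Hy = cx * (Hx - Hy) + (cy - cx) * (- Hy)" by (simp add: algebra_simps)
  also have "\<dots> \<le> 0 + (cy - cx) * P"
    using assms True by (intro add_mono mult_left_mono mult_nonneg_nonpos) auto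
  also have "\<dots> \<le> Q * P" using assms True by (simp add: mult_right_mono)
  finally show ?thesis .
next
  case False
  have "cx * Hx - cy * Hy = cy * (Hx - Hy) + (cx - cy) * Hx" by (simp add: algebra_simps)
  also have "\<dots> \<le> 0 + (cx - cy) * P"
    using assms False by (intro add_mono mult_left_mono mult_nonneg_nonpos) auto
  also have "\<dots> \<le> Q * P" using assms False by (simp add: mult_right_mono)
  finally show ?thesis .
qed

text \<open>Sums and differences of axes express off-diagonal second derivatives through pure
  directional ones, the kind that the maximum principle controls.\<close>

lemma hess_axis_combinations:
  "hess f x (axis i 1) = partial (partial f i) i x"
  "hess f x (axis i 1 + axis j 1) = partial (partial f i) i x + partial (partial f j) j x
     + partial (partial f i) j x + partial (partial f j) i x"
  "hess f x (axis i 1 - axis j 1) = partial (partial f i) i x + partial (partial f j) j x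
     - partial (partial f i) j x - partial (partial f j) i x"
proof -
  have *: "(\<Sum>a\<in>UNIV. (if a = k then 1 else 0) * F a) = F k" for k :: 3 and F :: "3 \<Rightarrow> real"
    by (simp add: if_distrib[of "\<lambda>c. c * _"] cong: if_cong)
  show "hess f x (axis i 1) = partial (partial f i) i x"
    unfolding hess_def by (simp add: axis_def mult.assoc * flip: sum_distrib_left)
  show "hess f x (axis i 1 + axis j 1) = partial (partial f i) i x + partial (partial f j) j x
     + partial (partial f i) j x + partial (partial f j) i x"
    unfolding hess_def
    by (simp add: axis_def mult.assoc distrib_right sum.distrib * flip: sum_distrib_left)
  show "hess f x (axis i 1 - axis j 1) = partial (partial f i) i x + partial (partial f j) j x
     - partial (partial f i) j x - partial (partial f j) i x"
    unfolding hess_def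
    by (simp add: axis_def mult.assoc left_diff_distrib sum_subtractf * flip: sum_distrib_left)
qed

text \<open>A reflection is orthogonal, so the mirrored axes form an orthonormal frame and the trace
  of the Hessian is unchanged.\<close>

lemma hess_reflected_frame:
  assumes f: "smooth_T3 f" and e: "norm e = 1"
  shows "(\<Sum>i\<in>UNIV. hess f x (axis i 1 - (2 * e $ i) *\<^sub>R e)) = (\<Sum>i\<in>UNIV. partial (partial f i) i x)"
proof -
  have "e \<bullet> e = 1" using e by (simp add: norm_eq_1)
  then have e2: "e $ 1 * e $ 1 + e $ 2 * e $ 2 + e $ 3 * e $ 3 = 1" by (simp add: inner_vec_def sum_3)
  let ?d = "\<lambda>a b. (if a = b then 1 else 0) :: real"
  have frame: "(\<Sum>i\<in>UNIV. (axis i 1 - (2 * e $ i) *\<^sub>R e) $ a * (axis i 1 - (2 * e $ i) *\<^sub>R e) $ b) = ?d a b"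
    for a b :: 3
  proof -
    have "(\<Sum>i\<in>UNIV. (axis i 1 - (2 * e $ i) *\<^sub>R e) $ a * (axis i 1 - (2 * e $ i) *\<^sub>R e) $ b) =
      (\<Sum>i\<in>UNIV. ?d a i * ?d b i - 2 * (?d a i * e $ i) * e $ b - 2 * (?d b i * e $ i) * e $ a
         + 4 * e $ a * e $ b * (e $ i * e $ i))"
      by (intro sum.cong) (auto simp: axis_def algebra_simps)
    also have "\<dots> = (\<Sum>i\<in>UNIV. ?d a i * ?d b i) - 2 * (\<Sum>i\<in>UNIV. ?d a i * e $ i) * e $ b
        - 2 * (\<Sum>i\<in>UNIV. ?d b i * e $ i) * e $ a + 4 * e $ a * e $ b * (\<Sum>i\<in>UNIV. e $ i * e $ i)"
      by (simp only: sum.distrib sum_subtractf sum_distrib_left sum_distrib_right)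
    also have "\<dots> = ?d a b - 2 * e $ a * e $ b - 2 * e $ b * e $ a + 4 * e $ a * e $ b * 1"
    proof -
      have "(\<Sum>i\<in>UNIV. e $ i * e $ i) = 1" using e2 by (simp add: sum_3)
      moreover have "(\<Sum>i\<in>UNIV. ?d a i * F i) = F a" for a and F :: "3 \<Rightarrow> real"
        by (simp add: if_distrib[of "\<lambda>c. c * _"] cong: if_cong)
      moreover have "?d b a = ?d a b" by simp
      ultimately show ?thesis by (simp only:)
    qed
    finally show ?thesis by simp
  qed
  have "(\<Sum>i\<in>UNIV. hess f x (axis i 1 - (2 * e $ i) *\<^sub>R e)) =
    (\<Sum>a\<in>UNIV. \<Sum>b\<in>UNIV. (\<Sum>i\<in>UNIV. (axis i 1 - (2 * e $ i) *\<^sub>R e) $ a * (axis i 1 - (2 * e $ i) *\<^sub>R e) $ b)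
       * partial (partial f a) b x)"
    unfolding hess_def sum_distrib_right
    by (subst sum.swap, rule sum.cong[OF refl], rule sum.swap)
  also have "\<dots> = (\<Sum>i\<in>UNIV. partial (partial f i) i x)"
    unfolding frame by (simp add: if_distrib[of "\<lambda>c. c * _"] cong: if_cong)
  finally show ?thesis .
qed

text \<open>Doubling of variables: at a positive maximum of \<open>\<xi> x - \<xi> y - \<phi> (norm (x - y))\<close> the
  Laplacian half of the operator is coupled by reflection along \<open>x - y\<close>, which sees \<open>\<phi>'' < 0\<close>,
  and the remaining half, a nonnegative combination of fixed directional second derivatives, is
  coupled in parallel up to the Lipschitz variation of its coefficients.\<close>
lemma doubling_estimate:
  fixes a :: "3 \<Rightarrow> 3 \<Rightarrow> real^3 \<Rightarrow> real"
  assumes \<xi>: "smooth_T3 \<xi>" and a: "\<And>i j. smooth_T3 (a i j)" and sym: "\<And>i j x. a i j x = a j i x"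
    and near: "\<And>i j x. \<bar>a i j x - (if i = j then 1 else 0)\<bar> \<le> \<beta>"
    and da: "\<And>i j k x. \<bar>partial (a i j) k x\<bar> \<le> \<beta>" and \<beta>: "\<beta> \<le> 1 / 8"
    and rhs: "\<And>x. \<bar>\<Sum>i\<in>UNIV. \<Sum>j\<in>UNIV. a i j x * partial (partial \<xi> i) j x\<bar> \<le> \<Lambda>"
    and M: "M > 0" "2 * \<Lambda> < M * (1 - 27 * \<beta>)" and "norm (x - y) \<le> 2"
  shows "\<xi> x - \<xi> y \<le> M * norm (x - y)"
proof -
  \<comment> \<open>On [0, 2] this is concave, strictly increasing and at most \<open>M * s\<close>;
    its second derivative - M / 2 is the source of the negative term below.\<close>
  define \<phi> where "\<phi> s = M * (s - s\<^sup>2 / 4)" for s :: real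
  \<comment> \<open>The second point is written as \<open>x + z\<close>: for fixed \<open>z\<close>
    this is periodic in \<open>x\<close>, so a maximum over a compact set of pairs is global in
    \<open>x\<close>.\<close>
  define G where "G x z = \<xi> x - \<xi> (x + z) - \<phi> (norm z)" for x z
  have cont\<xi>: "continuous_on S \<xi>" for S by (rule smooth_T3D(3)[OF \<xi>])
  have "\<beta> \<ge> 0" using da[of 1 1 1 0] by linarith
  have G0: "G x z \<le> 0" if "norm z \<le> 2" for x z
  proof (rule ccontr)
    assume pos: "\<not> G x z \<le> 0"
    let ?K = "cbox 0 (1::real^3) \<times> cball (0::real^3) 2"
    have "\<exists>p\<in>?K. \<forall>q\<in>?K. G (fst q) (snd q) \<le> G (fst p) (snd p)"
    proof (rule continuous_attains_sup)
      show "compact ?K" by (intro compact_Times compact_cbox compact_cball)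
      show "?K \<noteq> {}" by (simp add: interval_ne_empty_cart)
      show "continuous_on ?K (\<lambda>p. G (fst p) (snd p))"
        unfolding G_def \<phi>_def
        by (intro continuous_intros continuous_on_compose2[OF cont\<xi>[of UNIV]]) auto
    qed
    then obtain p where p: "p \<in> ?K"
      "\<And>q. q \<in> ?K \<Longrightarrow> G (fst q) (snd q) \<le> G (fst p) (snd p)"
      by blast
    define x0 z0 where "x0 = fst p" and "z0 = snd p"
    have z02: "norm z0 \<le> 2" using p(1) by (auto simp: z0_def)
    have mx: "G x z \<le> G x0 z0" if "norm z \<le> 2" for x z
    proof -
      have "\<xi> (x + axis i 1 + z) = \<xi> (x + z)" for x i
      proof -
        have "x + axis i 1 + z = (x + z) + axis i 1" by (simp add: algebra_simps)
        then show ?thesis using smooth_T3D(2)[OF \<xi>] by (simp only: periodic3_def)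
      qed
      then have "periodic3 (\<lambda>x. G x z)"
        using smooth_T3D(2)[OF \<xi>] unfolding periodic3_def G_def by simp
      then show ?thesis
      proof (rule periodic3_cube)
        fix y :: "real^3" assume "y \<in> cbox 0 1"
        then show "G y z \<le> G x0 z0"
          using p(2)[of "(y, z)"] \<open>norm z \<le> 2\<close> by (simp add: x0_def z0_def)
      qed
    qed
    have Gpos: "G x0 z0 > 0" using mx[OF \<open>norm z \<le> 2\<close>, of x] pos by linarith
    define r where "r = norm z0"
    have "z0 \<noteq> 0" using Gpos by (auto simp: G_def \<phi>_def)
    then have r0: "r > 0" by (simp add: r_def)
    \<comment> \<open>If r \<ge> 1, a lattice translate of \<open>z0\<close> is shorter with the
      same values of \<xi>, and \<phi> is smaller there. So the maximum is interior to the ball of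
      radius 2.\<close>
    have r1: "r < 1"
    proof (rule ccontr)
      assume "\<not> r < 1"
      obtain k where k: "norm (z0 + lattice_pt k) < 1" using ex_lattice_small by blast
      define s where "s = norm (z0 + lattice_pt k)"
      have s: "s < r" "r \<le> 2" "s < 1" using k \<open>\<not> r < 1\<close> z02 by (simp_all add: s_def r_def)
      have "\<xi> (x0 + (z0 + lattice_pt k)) = \<xi> (x0 + z0)"
        using periodic3_lattice[OF smooth_T3D(2)[OF \<xi>], of "x0 + z0" k] by (simp add: add.assoc)
      then have "\<phi> r \<le> \<phi> s"
        using mx[of "z0 + lattice_pt k" x0] k by (simp add: G_def s_def r_def)
      then have "r - r\<^sup>2 / 4 \<le> s - s\<^sup>2 / 4" using M by (simp add: \<phi>_def)
      then have "(r - s) * (4 - (r + s)) \<le> 0" by (simp add: power2_eq_square algebra_simps)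
      moreover have "(r - s) * (4 - (r + s)) > 0" using s by (intro mult_pos_pos) auto
      ultimately show False by linarith
    qed
    define y0 where "y0 = x0 + z0"
    \<comment> \<open>Second-order condition at the maximum when the two points move with velocities
      \<open>v\<close> and \<open>w\<close>. The bound t |w - v| < r keeps the displacement within
      radius 2; the + 1 in the step size covers \<open>v = w\<close>.\<close>
    have second: "hess \<xi> x0 v - hess \<xi> y0 w \<le> c"
      if c: "\<And>t. 0 < t \<Longrightarrow> t * norm (w - v) < r \<Longrightarrow>
        \<phi> (norm (z0 + t *\<^sub>R (w - v))) + \<phi> (norm (z0 - t *\<^sub>R (w - v))) - 2 * \<phi> r \<le> c * t\<^sup>2" for v w c
    proof (rule second_derivative_le[where w = "\<lambda>t. \<xi> (x0 + t *\<^sub>R v) - \<xi> (y0 + t *\<^sub>R w)"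
          and \<epsilon> = "r / (norm (w - v) + 1)"])
      show "((\<lambda>t. \<xi> (x0 + t *\<^sub>R v) - \<xi> (y0 + t *\<^sub>R w)) has_real_derivative
          (\<Sum>i\<in>UNIV. v $ i * partial \<xi> i (x0 + t *\<^sub>R v)) - (\<Sum>i\<in>UNIV. w $ i * partial \<xi> i (y0 + t *\<^sub>R w))) (at t)" for t
        by (intro DERIV_diff line_second_derivative \<xi>)
      show "((\<lambda>t. (\<Sum>i\<in>UNIV. v $ i * partial \<xi> i (x0 + t *\<^sub>R v)) - (\<Sum>i\<in>UNIV. w $ i * partial \<xi> i (y0 + t *\<^sub>R w)))
          has_real_derivative hess \<xi> x0 v - hess \<xi> y0 w) (at 0)"
        by (intro DERIV_diff line_second_derivative \<xi>)
      show "r / (norm (w - v) + 1) > 0" using r0 by (simp add: add_nonneg_pos)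
      fix t :: real assume t: "0 < t" "t < r / (norm (w - v) + 1)"
      have n1: "norm (w - v) + 1 > 0" by (simp add: add_nonneg_pos)
      have "t * norm (w - v) + t < r" using t n1 by (simp add: pos_less_divide_eq algebra_simps)
      then have tr: "t * norm (w - v) < r" using t by linarith
      have small: "norm (z0 + s *\<^sub>R (w - v)) \<le> 2" if "\<bar>s\<bar> = t" for s
        using norm_triangle_ineq[of z0 "s *\<^sub>R (w - v)"] tr r1 that by (simp add: r_def)
      have "\<xi> (x0 + s *\<^sub>R v) - \<xi> (y0 + s *\<^sub>R w) - \<phi> (norm (z0 + s *\<^sub>R (w - v))) \<le> \<xi> x0 - \<xi> y0 - \<phi> r" if "\<bar>s\<bar> = t" for s
        using mx[OF small[OF that], of "x0 + s *\<^sub>R v"] by (simp add: G_def y0_def r_def algebra_simps)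
      from this[of t] this[of "- t"] c[OF t(1) tr] t(1)
      show "\<xi> (x0 + t *\<^sub>R v) - \<xi> (y0 + t *\<^sub>R w) + (\<xi> (x0 + (- t) *\<^sub>R v) - \<xi> (y0 + (- t) *\<^sub>R w))
          - 2 * (\<xi> (x0 + 0 *\<^sub>R v) - \<xi> (y0 + 0 *\<^sub>R w)) \<le> c * t\<^sup>2"
        by simp
    qed
    have par: "hess \<xi> x0 v \<le> hess \<xi> y0 v" for v
      using second[of v v 0] by (simp add: r_def)
    \<comment> \<open>Parallelogram law and AM-GM give a crude bound in every direction. It
      degenerates like 1 / r, which the Lipschitz variation of the coefficients, of order
      \<open>r\<close>, will offset.\<close>
    have arb: "\<phi> (norm (z0 + t *\<^sub>R v)) + \<phi> (norm (z0 - t *\<^sub>R v)) - 2 * \<phi> r \<le> (M * (norm v)\<^sup>2 / r) * t\<^sup>2" for t v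
    proof -
      define n1 n2 where "n1 = norm (z0 + t *\<^sub>R v)" and "n2 = norm (z0 - t *\<^sub>R v)"
      have sq: "n1\<^sup>2 + n2\<^sup>2 = 2 * r\<^sup>2 + 2 * t\<^sup>2 * (norm v)\<^sup>2"
        unfolding n1_def n2_def r_def power2_norm_eq_inner
        by (simp add: inner_add_left inner_add_right inner_diff_left inner_diff_right inner_commute power2_eq_square)
      have am: "n \<le> (r\<^sup>2 + n\<^sup>2) / (2 * r)" for n
        using r0 zero_le_power2[of "r - n"] by (simp add: field_simps power2_eq_square)
      have "n1 + n2 \<le> (2 * r\<^sup>2 + (n1\<^sup>2 + n2\<^sup>2)) / (2 * r)"
        using am[of n1] am[of n2] by (simp add: add_divide_distrib)
      also have "\<dots> = 2 * r + t\<^sup>2 * (norm v)\<^sup>2 / r"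
        unfolding sq using r0 by (simp add: field_simps power2_eq_square)
      finally have "n1 + n2 - (n1\<^sup>2 + n2\<^sup>2) / 4 - 2 * (r - r\<^sup>2 / 4) \<le> t\<^sup>2 * (norm v)\<^sup>2 / r"
        using sq mult_nonneg_nonneg[OF zero_le_power2[of t] zero_le_power2[of "norm v"]] by argo
      then have "M * (n1 + n2 - (n1\<^sup>2 + n2\<^sup>2) / 4 - 2 * (r - r\<^sup>2 / 4)) \<le> M * (t\<^sup>2 * (norm v)\<^sup>2 / r)"
        using M by (intro mult_left_mono) auto
      then show ?thesis
        unfolding n1_def[symmetric] n2_def[symmetric] \<phi>_def
        by (simp add: algebra_simps add_divide_distrib)
    qed
    \<comment> \<open>Letting only one of the two points move gives one-sided Hessian
      bounds.\<close>
    have upx: "hess \<xi> x0 v \<le> M * (norm v)\<^sup>2 / r" for v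
    proof -
      have "hess \<xi> x0 v - hess \<xi> y0 0 \<le> M * (norm v)\<^sup>2 / r"
        by (rule second) (use arb[of _ "0 - v"] in simp)
      then show ?thesis by (simp add: hess_def)
    qed
    have upy: "- hess \<xi> y0 v \<le> M * (norm v)\<^sup>2 / r" for v
    proof -
      have "hess \<xi> x0 0 - hess \<xi> y0 v \<le> M * (norm v)\<^sup>2 / r"
        by (rule second) (use arb[of _ "v - 0"] in simp)
      then show ?thesis by (simp add: hess_def)
    qed
    define e where "e = (1 / r) *\<^sub>R z0"
    have e: "norm e = 1" "z0 = r *\<^sub>R e" using r0 by (simp_all add: e_def r_def)
    \<comment> \<open>Moving \<open>x0\<close> along an axis and \<open>y0\<close> along its mirror
      image changes the displacement along \<open>e\<close> alone, by 2 t e_i, so the concavity of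
      \<phi> appears; summed over \<open>i\<close> it gives - 2 M.\<close>
    have refl: "hess \<xi> x0 (axis i 1) - hess \<xi> y0 (axis i 1 - (2 * e $ i) *\<^sub>R e) \<le> - 2 * M * (e $ i)\<^sup>2" for i
    proof (rule second)
      fix t :: real assume t: "0 < t" "t * norm (axis i 1 - (2 * e $ i) *\<^sub>R e - axis i 1) < r"
      let ?h = "t * (2 * e $ i)"
      have h: "\<bar>?h\<bar> < r" using t e by (simp add: abs_mult)
      have eqs: "z0 + t *\<^sub>R (axis i 1 - (2 * e $ i) *\<^sub>R e - axis i 1) = (r - ?h) *\<^sub>R e"
        "z0 - t *\<^sub>R (axis i 1 - (2 * e $ i) *\<^sub>R e - axis i 1) = (r + ?h) *\<^sub>R e"
        unfolding e(2) by (simp_all add: algebra_simps)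
      have nrm: "norm ((r - ?h) *\<^sub>R e) = r - ?h" "norm ((r + ?h) *\<^sub>R e) = r + ?h"
        using h e(1) by (simp_all only: norm_scaleR mult_1_right)
      show "\<phi> (norm (z0 + t *\<^sub>R (axis i 1 - (2 * e $ i) *\<^sub>R e - axis i 1)))
          + \<phi> (norm (z0 - t *\<^sub>R (axis i 1 - (2 * e $ i) *\<^sub>R e - axis i 1))) - 2 * \<phi> r \<le> - 2 * M * (e $ i)\<^sup>2 * t\<^sup>2"
        unfolding eqs nrm \<phi>_def by (simp add: power2_eq_square field_simps)
    qed
    let ?hx = "\<lambda>i j. partial (partial \<xi> i) j x0" and ?hy = "\<lambda>i j. partial (partial \<xi> i) j y0"
    have lap: "(\<Sum>i\<in>UNIV. ?hx i i) - (\<Sum>i\<in>UNIV. ?hy i i) \<le> - 2 * M"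
    proof -
      have "(\<Sum>i\<in>UNIV. ?hx i i) - (\<Sum>i\<in>UNIV. ?hy i i) =
          (\<Sum>i\<in>UNIV. hess \<xi> x0 (axis i 1) - hess \<xi> y0 (axis i 1 - (2 * e $ i) *\<^sub>R e))"
        by (simp add: sum_subtractf hess_axis_combinations(1) hess_reflected_frame[OF \<xi> e(1)])
      also have "\<dots> \<le> (\<Sum>i\<in>UNIV. - 2 * M * (e $ i)\<^sup>2)" by (intro sum_mono refl)
      also have "\<dots> = - 2 * M * (e \<bullet> e)"
        by (simp add: inner_vec_def sum_distrib_left power2_eq_square)
      also have "e \<bullet> e = 1" using e(1) by (simp add: norm_eq_1)
      finally show ?thesis by simp
    qed
    have lip: "\<bar>a i j x0 - a i j y0\<bar> \<le> 3 * \<beta> * r" for i j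
      using lipschitz_of_partials[OF a da, of i j x0 y0] by (simp add: y0_def r_def)
    have cpl: "cx * hess \<xi> x0 v - cy * hess \<xi> y0 v \<le> 3 * \<beta> * M"
      if "cx \<ge> 0" "cy \<ge> 0" "\<bar>cx - cy\<bar> * (norm v)\<^sup>2 \<le> 3 * \<beta> * r" "norm v > 0" for cx cy v
    proof -
      have "cx * hess \<xi> x0 v - cy * hess \<xi> y0 v \<le> (3 * \<beta> * r / (norm v)\<^sup>2) * (M * (norm v)\<^sup>2 / r)"
        using that M r0
        by (intro coupling_excess par upx upy) (auto simp: pos_le_divide_eq)
      also have "\<dots> = 3 * \<beta> * M" using r0 that(4) by simp
      finally show ?thesis .
    qed
    \<comment> \<open>Of each a_ii, 1/2 goes to the reflected Laplacian and 1/4 to the off-diagonal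
      directions, as each index lies in two pairs with weight 1/16 + 1/16. The remaining a_ii - 3/4
      and the coefficients 1/16 +- a_ij / 2 are nonnegative since \<beta> \<le> 1/8.\<close>
    have diag: "(a i i x0 - 3/4) * ?hx i i - (a i i y0 - 3/4) * ?hy i i \<le> 3 * \<beta> * M" for i
      using cpl[of "a i i x0 - 3/4" "a i i y0 - 3/4" "axis i 1"] lip[of i i] near[of i i x0] near[of i i y0] \<beta>
      by (simp add: hess_axis_combinations(1) abs_le_iff)
    have off: "(1/16 + a i j x0 / 2) * hess \<xi> x0 (axis i 1 + axis j 1) - (1/16 + a i j y0 / 2) * hess \<xi> y0 (axis i 1 + axis j 1) \<le> 3 * \<beta> * M"
      "(1/16 - a i j x0 / 2) * hess \<xi> x0 (axis i 1 - axis j 1) - (1/16 - a i j y0 / 2) * hess \<xi> y0 (axis i 1 - axis j 1) \<le> 3 * \<beta> * M"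
      if "i \<noteq> j" for i j
    proof -
      have n: "(norm (axis i 1 + axis j 1 :: real^3))\<^sup>2 = 2" "(norm (axis i 1 - axis j 1 :: real^3))\<^sup>2 = 2"
        using that unfolding power2_norm_eq_inner
        by (simp_all add: inner_add_left inner_add_right inner_diff_left inner_diff_right inner_axis_axis)
      have "norm u > 0" if "(norm u)\<^sup>2 = 2" for u :: "real^3"
        using that by (cases "u = 0") auto
      note pos = this[OF n(1)] this[OF n(2)]
      have b: "\<bar>a i j x\<bar> \<le> 1 / 8" for x using near[of i j x] \<beta> \<open>i \<noteq> j\<close> by simp
      have c: "0 \<le> 1/16 + a i j x / 2" "0 \<le> 1/16 - a i j x / 2" for x
        using b[of x] by linarith+
      have d: "\<bar>1/16 + a i j x0 / 2 - (1/16 + a i j y0 / 2)\<bar> * 2 \<le> 3 * \<beta> * r"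
        "\<bar>1/16 - a i j x0 / 2 - (1/16 - a i j y0 / 2)\<bar> * 2 \<le> 3 * \<beta> * r"
      proof -
        have "\<bar>1/16 + A / 2 - (1/16 + B / 2)\<bar> * 2 = \<bar>A - B\<bar>"
          "\<bar>1/16 - A / 2 - (1/16 - B / 2)\<bar> * 2 = \<bar>A - B\<bar>" for A B :: real
          by (simp_all add: abs_real_def)
        then show "\<bar>1/16 + a i j x0 / 2 - (1/16 + a i j y0 / 2)\<bar> * 2 \<le> 3 * \<beta> * r"
          "\<bar>1/16 - a i j x0 / 2 - (1/16 - a i j y0 / 2)\<bar> * 2 \<le> 3 * \<beta> * r"
          using lip[of i j] by (simp_all only:)
      qed
      show "(1/16 + a i j x0 / 2) * hess \<xi> x0 (axis i 1 + axis j 1) - (1/16 + a i j y0 / 2) * hess \<xi> y0 (axis i 1 + axis j 1) \<le> 3 * \<beta> * M"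
        by (rule cpl[OF _ _ _ pos(1)]) (simp_all only: n c d)
      show "(1/16 - a i j x0 / 2) * hess \<xi> x0 (axis i 1 - axis j 1) - (1/16 - a i j y0 / 2) * hess \<xi> y0 (axis i 1 - axis j 1) \<le> 3 * \<beta> * M"
        by (rule cpl[OF _ _ _ pos(2)]) (simp_all only: n c d)
    qed
    have hs: "partial (partial \<xi> j) i = partial (partial \<xi> i) j" for i j by (rule partial_commute[OF \<xi>])
    have decomp: "(\<Sum>i\<in>UNIV. \<Sum>j\<in>UNIV. a i j x * partial (partial \<xi> i) j x) =
        (\<Sum>i\<in>UNIV. partial (partial \<xi> i) i x) / 2 + (\<Sum>i\<in>UNIV. (a i i x - 3/4) * partial (partial \<xi> i) i x)
        + ((1/16 + a 1 2 x / 2) * hess \<xi> x (axis 1 1 + axis 2 1) + (1/16 - a 1 2 x / 2) * hess \<xi> x (axis 1 1 - axis 2 1))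
        + ((1/16 + a 1 3 x / 2) * hess \<xi> x (axis 1 1 + axis 3 1) + (1/16 - a 1 3 x / 2) * hess \<xi> x (axis 1 1 - axis 3 1))
        + ((1/16 + a 2 3 x / 2) * hess \<xi> x (axis 2 1 + axis 3 1) + (1/16 - a 2 3 x / 2) * hess \<xi> x (axis 2 1 - axis 3 1))" for x
      unfolding sum_3 hess_axis_combinations sym[of 2 1] sym[of 3 1] sym[of 3 2] hs[of 2 1] hs[of 3 1] hs[of 3 2]
      by (simp add: field_simps)
    \<comment> \<open>- M is half the Laplacian bound; 27 stands for nine parallel couplings at 3
      \<beta> M each.\<close>
    have "(\<Sum>i\<in>UNIV. \<Sum>j\<in>UNIV. a i j x0 * ?hx i j) - (\<Sum>i\<in>UNIV. \<Sum>j\<in>UNIV. a i j y0 * ?hy i j) \<le> - M + 27 * \<beta> * M"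
    proof -
      have ne: "(1::3) \<noteq> 2" "(1::3) \<noteq> 3" "(2::3) \<noteq> 3" by simp_all
      show ?thesis
        unfolding decomp
        using lap diag[of 1] diag[of 2] diag[of 3] off[OF ne(1)] off[OF ne(2)] off[OF ne(3)]
        unfolding sum_3 by argo
    qed
    then have "- 2 * \<Lambda> \<le> - M + 27 * \<beta> * M" using rhs[of x0] rhs[of y0] by linarith
    then show False using M(2) by (simp add: algebra_simps)
  qed
  have "G x (y - x) \<le> 0" using assms(10) by (intro G0) (simp add: norm_minus_commute)
  then have "\<xi> x - \<xi> y \<le> \<phi> (norm (x - y))" by (simp add: G_def norm_minus_commute)
  also have "\<dots> \<le> M * norm (x - y)" using M unfolding \<phi>_def by (intro mult_left_mono) auto
  finally show ?thesis .
qed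

lemma abs_derivative_le:
  assumes "(f has_real_derivative d) (at 0)" and le: "\<And>t. \<lbrakk>0 < t; t < \<epsilon>\<rbrakk> \<Longrightarrow> \<bar>f t - f 0\<bar> \<le> M * t" and "\<epsilon> > 0"
  shows "\<bar>d\<bar> \<le> M"
proof -
  have "((\<lambda>t. (f t - f 0) / t) \<longlongrightarrow> d) (at_right 0)"
    using assms(1) unfolding has_field_derivative_iff by (auto intro: tendsto_mono at_le)
  then have "((\<lambda>t. \<bar>(f t - f 0) / t\<bar>) \<longlongrightarrow> \<bar>d\<bar>) (at_right 0)" by (rule tendsto_rabs)
  moreover have "\<forall>\<^sub>F t in at_right 0. \<bar>(f t - f 0) / t\<bar> \<le> M"
    unfolding eventually_at_right_field
    by (rule exI[of _ \<epsilon>]) (use le \<open>\<epsilon> > 0\<close> in \<open>auto simp: divide_le_eq\<close>)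
  ultimately show ?thesis by (rule tendsto_upperbound) simp
qed

section \<open>The coefficients of the Hodge star and the main theorem\<close>

lemma abs_partial_le:
  assumes \<xi>: "smooth_T3 \<xi>" and le: "\<And>x y. norm (x - y) \<le> 2 \<Longrightarrow> \<xi> x - \<xi> y \<le> M * norm (x - y)"
  shows "\<bar>partial \<xi> k x\<bar> \<le> M"
proof (rule abs_derivative_le)
  show "((\<lambda>t. \<xi> (x + t *\<^sub>R axis k 1)) has_real_derivative partial \<xi> k x) (at 0)"
    using smooth3_has_partials[OF smooth_T3D(1)[OF \<xi>]] unfolding has_partials_def by blast
  fix t :: real assume "0 < t" "t < 2"
  then show "\<bar>\<xi> (x + t *\<^sub>R axis k 1) - \<xi> (x + 0 *\<^sub>R axis k 1)\<bar> \<le> M * t"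
    using le[of "x + t *\<^sub>R axis k 1" x] le[of x "x + t *\<^sub>R axis k 1"] by (simp add: abs_le_iff)
qed simp

lemma partial_sup_attained:
  assumes \<xi>: "smooth_T3 \<xi>"
  obtains k0 x0 where "\<And>k x. \<bar>partial \<xi> k x\<bar> \<le> \<bar>partial \<xi> k0 x0\<bar>"
proof -
  have "\<exists>z. \<forall>x. \<bar>partial \<xi> k x\<bar> \<le> \<bar>partial \<xi> k z\<bar>" for k
    by (rule periodic3_attains_sup)
       (use periodic3_compose[OF smooth_T3D(2)[OF smooth_T3_partial[OF \<xi>]], of abs]
          continuous_on_rabs[OF smooth_T3D(3)[OF smooth_T3_partial[OF \<xi>]]] in auto)
  then obtain z where z: "\<And>k x. \<bar>partial \<xi> k x\<bar> \<le> \<bar>partial \<xi> k (z k)\<bar>" by metis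
  let ?S = "range (\<lambda>k. \<bar>partial \<xi> k (z k)\<bar>)"
  have "Max ?S \<in> ?S" by (rule Max_in) auto
  then obtain k0 where k0: "Max ?S = \<bar>partial \<xi> k0 (z k0)\<bar>" by (rule rangeE)
  have "\<bar>partial \<xi> k (z k)\<bar> \<le> Max ?S" for k by (rule Max_ge) auto
  then show ?thesis using z k0 that by (metis order_trans)
qed

text \<open>Expanding the divergence leaves first-order terms of size at most 9 \<beta> (1 + L) on
  the right, with \<open>L\<close> the largest partial of \<xi>. Doubling turns this into L \<le> 20
  \<beta> (1 + L) \<le> (1 + L) / 50, hence L < 1.\<close>

lemma corrector_small_gradient:
  fixes a :: "3 \<Rightarrow> 3 \<Rightarrow> real^3 \<Rightarrow> real" and v :: "real^3"
  assumes a: "\<And>i j. smooth_T3 (a i j)" and sym: "\<And>i j x. a i j x = a j i x"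
    and near: "\<And>i j x. \<bar>a i j x - (if i = j then 1 else 0)\<bar> \<le> \<beta>"
    and da: "\<And>i j k x. \<bar>partial (a i j) k x\<bar> \<le> \<beta>" and \<beta>: "0 < \<beta>" "\<beta> \<le> 1 / 1000"
    and v: "\<And>j. \<bar>v $ j\<bar> \<le> 1"
  shows "\<exists>\<xi>. smooth_T3 \<xi> \<and> (\<forall>k x. \<bar>partial \<xi> k x\<bar> < 1) \<and>
    (\<forall>x. (\<Sum>i\<in>UNIV. partial (\<lambda>y. \<Sum>j\<in>UNIV. a i j y * (v $ j + partial \<xi> j y)) i x) = 0)"
proof -
  let ?d = "\<lambda>i j :: 3. (if i = j then 1 else 0) :: real"
  define B where "B i j x = a i j x - ?d i j" for i j x
  have B: "smooth_T3 (B i j)" for i j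
    unfolding B_def by (intro smooth_T3_diff smooth_T3_const a)
  define h where "h i x = (\<Sum>j\<in>UNIV. a i j x * v $ j)" for i x
  have h: "smooth_T3 (h i)" for i
    unfolding h_def by (intro smooth_T3_sum smooth_T3_mult smooth_T3_const a) auto
  obtain \<xi> where \<xi>: "smooth_T3 \<xi>" and eq: "\<And>x. (\<Sum>i\<in>UNIV. partial (partial \<xi> i) i x) =
    - (\<Sum>i\<in>UNIV. partial (h i) i x) - (\<Sum>i\<in>UNIV. partial (flux B \<xi> i) i x)"
    using divergence_equation_solvable[of B \<beta> h, OF B _ _ h] near \<beta> by (auto simp: B_def)
  have term_smooth: "smooth_T3 (\<lambda>y. v $ j + partial \<xi> j y)" for j
    by (intro smooth_T3_add smooth_T3_const smooth_T3_partial \<xi>)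
  have divform: "(\<Sum>i\<in>UNIV. partial (\<lambda>y. \<Sum>j\<in>UNIV. a i j y * (v $ j + partial \<xi> j y)) i x) = 0" for x
  proof -
    have "(\<Sum>j\<in>UNIV. a i j y * (v $ j + partial \<xi> j y)) = h i y + (flux B \<xi> i y + partial \<xi> i y)" for i y
    proof -
      have "(\<Sum>j\<in>UNIV. ?d i j * partial \<xi> j y) = partial \<xi> i y"
        by (simp add: if_distrib[of "\<lambda>c. c * _"] cong: if_cong)
      then show ?thesis
        by (simp add: h_def flux_def B_def distrib_left left_diff_distrib sum.distrib sum_subtractf)
    qed
    then have "(\<Sum>i\<in>UNIV. partial (\<lambda>y. \<Sum>j\<in>UNIV. a i j y * (v $ j + partial \<xi> j y)) i x) =
        (\<Sum>i\<in>UNIV. partial (h i) i x + (partial (flux B \<xi> i) i x + partial (partial \<xi> i) i x))"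
      by (simp add: partial_add smooth_T3D(1) h smooth_T3_flux B \<xi> smooth_T3_add smooth_T3_partial)
    then show ?thesis using eq[of x] by (simp add: sum.distrib)
  qed
  obtain k0 x0 where max: "\<And>k x. \<bar>partial \<xi> k x\<bar> \<le> \<bar>partial \<xi> k0 x0\<bar>"
    using partial_sup_attained[OF \<xi>] by blast
  define L where "L = \<bar>partial \<xi> k0 x0\<bar>"
  have L: "L \<ge> 0" "\<And>k x. \<bar>partial \<xi> k x\<bar> \<le> L" using max by (auto simp: L_def)
  have rhs: "\<bar>\<Sum>i\<in>UNIV. \<Sum>j\<in>UNIV. a i j x * partial (partial \<xi> i) j x\<bar> \<le> 9 * \<beta> * (1 + L)" for x
  proof -
    have "partial (\<lambda>y. \<Sum>j\<in>UNIV. a i j y * (v $ j + partial \<xi> j y)) i x =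
        (\<Sum>j\<in>UNIV. partial (a i j) i x * (v $ j + partial \<xi> j x) + a i j x * partial (partial \<xi> j) i x)" for i
      by (subst partial_sum)
         (auto simp: partial_mult partial_add partial_const smooth3_const smooth_T3D(1) a \<xi> smooth_T3_partial term_smooth
           intro!: smooth_T3D(1)[OF smooth_T3_mult] a term_smooth)
    then have "(\<Sum>i\<in>UNIV. \<Sum>j\<in>UNIV. a i j x * partial (partial \<xi> j) i x) =
        - (\<Sum>i\<in>UNIV. \<Sum>j\<in>UNIV. partial (a i j) i x * (v $ j + partial \<xi> j x))"
      using divform[of x] by (simp add: sum.distrib)
    then have "\<bar>\<Sum>i\<in>UNIV. \<Sum>j\<in>UNIV. a i j x * partial (partial \<xi> i) j x\<bar> =
        \<bar>\<Sum>i\<in>UNIV. \<Sum>j\<in>UNIV. partial (a i j) i x * (v $ j + partial \<xi> j x)\<bar>"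
      by (simp add: partial_commute[OF \<xi>])
    also have "\<dots> \<le> (\<Sum>i\<in>(UNIV::3 set). \<Sum>j\<in>(UNIV::3 set). \<beta> * (1 + L))"
    proof (intro order_trans[OF sum_abs] sum_mono)
      fix i j :: 3
      have "\<bar>v $ j + partial \<xi> j x\<bar> \<le> 1 + L"
        using abs_triangle_ineq[of "v $ j" "partial \<xi> j x"] v[of j] L(2)[of j x] by linarith
      then show "\<bar>partial (a i j) i x * (v $ j + partial \<xi> j x)\<bar> \<le> \<beta> * (1 + L)"
        unfolding abs_mult using da[of i j i x] \<beta> by (intro mult_mono) auto
    qed
    finally show ?thesis by simp
  qed
  \<comment> \<open>Doubling asks for a factor above 18 / (1 - 27 \<beta>), and 20 exceeds this for
    \<beta> \<le> 1/1000.\<close>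
  define M where "M = 20 * \<beta> * (1 + L)"
  have P: "\<beta> * (1 + L) > 0" using \<beta> L by simp
  have M: "M > 0" "2 * (9 * \<beta> * (1 + L)) < M * (1 - 27 * \<beta>)"
  proof -
    show "M > 0" unfolding M_def using P by simp
    have "(\<beta> * (1 + L)) * 18 < (\<beta> * (1 + L)) * (20 * (1 - 27 * \<beta>))"
      using P \<beta> by (intro mult_strict_left_mono) auto
    then show "2 * (9 * \<beta> * (1 + L)) < M * (1 - 27 * \<beta>)" unfolding M_def by (simp add: algebra_simps)
  qed
  have "\<bar>partial \<xi> k x\<bar> \<le> M" for k x
    by (rule abs_partial_le[OF \<xi>], rule doubling_estimate[of \<xi> a, OF \<xi> a sym near da _ rhs M])
       (use \<beta> in auto)
  then have "L \<le> M" unfolding L_def .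
  moreover have "20 * \<beta> * (1 + L) \<le> (1 / 50) * (1 + L)" using \<beta> L by (intro mult_right_mono) auto
  ultimately have "L \<le> (1 / 50) * (1 + L)" unfolding M_def by (rule order_trans)
  then have "L < 1" by simp
  then show ?thesis using \<xi> L(2) divform by (intro exI[of _ \<xi>]) (auto intro: le_less_trans)
qed

section \<open>Cofactors, determinant and inverse near the identity\<close>

text \<open>Indices are cyclic in the type \<open>3\<close>, so the signs of the cofactors are automatic.\<close>
definition cofactor :: "real^3^3 \<Rightarrow> 3 \<Rightarrow> 3 \<Rightarrow> real" where
  "cofactor G i j = G $ (j + 1) $ (i + 1) * G $ (j + 2) $ (i + 2) - G $ (j + 1) $ (i + 2) * G $ (j + 2) $ (i + 1)"

lemma cyclic_3: "(1::3) + 1 = 2" "(2::3) + 1 = 3" "(3::3) + 1 = 1" "(1::3) + 2 = 3" "(2::3) + 2 = 1" "(3::3) + 2 = 2"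
  "(4::3) = 1" "(5::3) = 2"
  by simp_all

lemma cofactor_inverse:
  "(\<Sum>k\<in>UNIV. G $ i $ k * cofactor G k j) = (if i = j then det G else 0)"
  "(\<Sum>k\<in>UNIV. cofactor G i k * G $ k $ j) = (if i = j then det G else 0)"
  using exhaust_3[of i] exhaust_3[of j]
  by (auto simp: cofactor_def sum_3 cyclic_3 det_3 algebra_simps)

text \<open>\<open>matrix_inv\<close> is a choice among inverses; the cofactor matrix over the
  determinant is a two-sided inverse, and such inverses are unique.\<close>

lemma matrix_inv_3:
  assumes "det G \<noteq> 0" shows "matrix_inv G $ i $ j = cofactor G i j / det G"
proof -
  define C where "C = (\<chi> i j. cofactor G i j / det G)"
  have C: "G ** C = mat 1" "C ** G = mat 1"
    using assms cofactor_inverse[of G]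
    by (auto simp: C_def matrix_matrix_mult_def mat_def vec_eq_iff simp flip: sum_divide_distrib)
  then have "G ** matrix_inv G = mat 1 \<and> matrix_inv G ** G = mat 1"
    unfolding matrix_inv_def by (intro someI_ex[of "\<lambda>A'. G ** A' = mat 1 \<and> A' ** G = mat 1"]) blast
  then have "matrix_inv G = C"
    using C by (metis matrix_mul_assoc matrix_mul_lid matrix_mul_rid)
  then show ?thesis by (simp add: C_def)
qed

lemma abs_mult_diff_le:
  fixes a b :: real
  assumes "\<bar>a - p\<bar> \<le> \<epsilon>" "\<bar>b - q\<bar> \<le> \<epsilon>" "\<bar>p\<bar> \<le> 1" "\<bar>q\<bar> \<le> 1" "\<epsilon> \<le> 1"
  shows "\<bar>a * b - p * q\<bar> \<le> 3 * \<epsilon>"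
proof -
  have "a * b - p * q = (a - p) * (b - q) + (a - p) * q + p * (b - q)" by (simp add: algebra_simps)
  then have "\<bar>a * b - p * q\<bar> \<le> \<bar>a - p\<bar> * \<bar>b - q\<bar> + \<bar>a - p\<bar> * \<bar>q\<bar> + \<bar>p\<bar> * \<bar>b - q\<bar>"
    by (metis (no_types, opaque_lifting) abs_mult abs_triangle_ineq add_mono_thms_linordered_semiring(3) order_trans)
  also have "\<dots> \<le> \<epsilon> * 1 + \<epsilon> * 1 + 1 * \<epsilon>"
    using assms by (intro add_mono mult_mono) auto
  finally show ?thesis by simp
qed

text \<open>A cofactor is a difference of two products, each off by at most 3 \<epsilon>. The
  determinant is a sum of three products with one factor already off by 6 \<epsilon>, which
  \<epsilon> \<le> 1/6 keeps at most 1.\<close>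

lemma cofactor_near_identity:
  assumes "\<And>i j. \<bar>G $ i $ j - (if i = j then 1 else 0)\<bar> \<le> \<epsilon>" "\<epsilon> \<le> 1 / 6"
  shows "\<bar>cofactor G i j - (if i = j then 1 else 0)\<bar> \<le> 6 * \<epsilon>" and "\<bar>det G - 1\<bar> \<le> 54 * \<epsilon>"
proof -
  let ?d = "\<lambda>i j :: 3. (if i = j then 1 else 0) :: real"
  have c: "\<bar>cofactor G i j - ?d i j\<bar> \<le> 6 * \<epsilon>" for i j
  proof -
    have p: "\<bar>G $ a $ b * G $ c $ d - ?d a b * ?d c d\<bar> \<le> 3 * \<epsilon>" for a b c d
      by (rule abs_mult_diff_le) (use assms in auto)
    \<comment> \<open>The identity matrix is its own cofactor matrix.\<close>
    have "?d i j = ?d (j + 1) (i + 1) * ?d (j + 2) (i + 2) - ?d (j + 1) (i + 2) * ?d (j + 2) (i + 1)"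
      using exhaust_3[of i] exhaust_3[of j] by (auto simp: cyclic_3)
    then have "cofactor G i j - ?d i j =
      (G $ (j + 1) $ (i + 1) * G $ (j + 2) $ (i + 2) - ?d (j + 1) (i + 1) * ?d (j + 2) (i + 2))
      - (G $ (j + 1) $ (i + 2) * G $ (j + 2) $ (i + 1) - ?d (j + 1) (i + 2) * ?d (j + 2) (i + 1))"
      unfolding cofactor_def by linarith
    then show ?thesis
      using p[of "j + 1" "i + 1" "j + 2" "i + 2"] p[of "j + 1" "i + 2" "j + 2" "i + 1"] by linarith
  qed
  then show "\<bar>cofactor G i j - ?d i j\<bar> \<le> 6 * \<epsilon>" .
  have e0: "\<epsilon> \<ge> 0" using assms(1)[of 1 1] by linarith
  have t: "\<bar>G $ 1 $ k * cofactor G k 1 - ?d 1 k * ?d k 1\<bar> \<le> 3 * (6 * \<epsilon>)" for k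
    by (rule abs_mult_diff_le) (use assms(1)[of 1 k] c[of k 1] assms(2) e0 in auto)
  have "det G = (\<Sum>k\<in>UNIV. G $ 1 $ k * cofactor G k 1)" using cofactor_inverse(1)[of G 1 1] by simp
  then show "\<bar>det G - 1\<bar> \<le> 54 * \<epsilon>"
    using t[of 1] t[of 2] t[of 3] by (simp add: sum_3 abs_le_iff)
qed

lemma smooth_T3_cofactor:
  "(\<And>i j. smooth_T3 (\<lambda>x. g x $ i $ j)) \<Longrightarrow> smooth_T3 (\<lambda>x. cofactor (g x) i j)"
  unfolding cofactor_def by (intro smooth_T3_diff smooth_T3_mult)

lemma det_cofactor: "det G = (\<Sum>k\<in>UNIV. G $ 1 $ k * cofactor G k 1)"
  using cofactor_inverse(1)[of G 1 1] by simp

lemma smooth_T3_det: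
  fixes g :: "real^3 \<Rightarrow> real^3^3"
  shows "(\<And>i j. smooth_T3 (\<lambda>x. g x $ i $ j)) \<Longrightarrow> smooth_T3 (\<lambda>x. det (g x))"
  unfolding det_cofactor by (intro smooth_T3_sum smooth_T3_mult smooth_T3_cofactor) auto

lemma abs_partial_mult_le:
  assumes "smooth_T3 f" "smooth_T3 h" "\<bar>f x\<bar> \<le> A" "\<bar>h x\<bar> \<le> B" "\<bar>partial f k x\<bar> \<le> A'" "\<bar>partial h k x\<bar> \<le> B'"
  shows "\<bar>partial (\<lambda>x. f x * h x) k x\<bar> \<le> A' * B + A * B'"
proof -
  have "\<bar>partial (\<lambda>x. f x * h x) k x\<bar> \<le> \<bar>partial f k x\<bar> * \<bar>h x\<bar> + \<bar>f x\<bar> * \<bar>partial h k x\<bar>"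
    using assms(1,2) by (simp add: partial_mult smooth_T3D(1) order_trans[OF abs_triangle_ineq] abs_mult)
  also have "\<dots> \<le> A' * B + A * B'" using assms(3-) by (intro add_mono mult_mono) auto
  finally show ?thesis .
qed

text \<open>The coefficients \<open>sqrt (det g) g^{ij}\<close> of the Hodge star on 1-forms.\<close>
definition star_coeff :: "(real^3 \<Rightarrow> real^3^3) \<Rightarrow> 3 \<Rightarrow> 3 \<Rightarrow> real^3 \<Rightarrow> real" where
  "star_coeff g i j x = cofactor (g x) i j * det (g x) powr (- 1 / 2)"

lemma star_coeff_eq:
  assumes "det (g x) > 0"
  shows "sqrt (det (g x)) * matrix_inv (g x) $ i $ j = star_coeff g i j x"
proof -
  have "sqrt (det (g x)) / det (g x) = det (g x) powr (- 1 / 2)"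
    using assms by (simp add: powr_minus_divide powr_half_sqrt field_simps)
  moreover have "sqrt (det (g x)) * matrix_inv (g x) $ i $ j = cofactor (g x) i j * (sqrt (det (g x)) / det (g x))"
    using assms by (simp add: matrix_inv_3)
  ultimately show ?thesis by (simp only: star_coeff_def)
qed

text \<open>500 is a round bound: the computation gives 324 \<delta> for the distance to the
  identity and 232 \<delta> for the derivatives. Keeping the determinant above 9/10 tames its
  negative powers.\<close>

lemma star_coeff_bounds:
  assumes g: "\<And>i j. smooth_T3 (\<lambda>x. g x $ i $ j)"
    and near: "\<And>i j x. \<bar>g x $ i $ j - (if i = j then 1 else 0)\<bar> \<le> \<delta>"
    and dg: "\<And>i j k x. \<bar>partial (\<lambda>x. g x $ i $ j) k x\<bar> \<le> \<delta>" and \<delta>: "\<delta> \<le> 1 / 1000"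
  shows "det (g x) > 0" and "smooth_T3 (star_coeff g i j)"
    and "\<bar>star_coeff g i j x - (if i = j then 1 else 0)\<bar> \<le> 500 * \<delta>"
    and "\<bar>partial (star_coeff g i j) k x\<bar> \<le> 500 * \<delta>"
proof -
  have \<delta>0: "\<delta> \<ge> 0" using near[of 0 1 1] by linarith
  note cn = cofactor_near_identity[of "g x" \<delta> for x, OF near]
  have D: "\<bar>det (g x) - 1\<bar> \<le> 54 * \<delta>" for x using cn(2) \<delta> by simp
  have C: "\<bar>cofactor (g x) i j - (if i = j then 1 else 0)\<bar> \<le> 6 * \<delta>" for i j x using cn(1) \<delta> by simp
  have g2: "\<bar>g x $ i $ j\<bar> \<le> 2" for x i j
    using near[of x i j] \<delta> by (auto split: if_splits)
  have C2: "\<bar>cofactor (g x) i j\<bar> \<le> 2" for x i j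
    using C[of x i j] \<delta> by (auto split: if_splits)
  have Dl: "det (g x) \<ge> 9 / 10" for x using D[of x] \<delta> by linarith
  then show Dpos: "det (g x) > 0" for x by (rule less_le_trans[rotated]) simp
  note smC = smooth_T3_cofactor[of g, OF g] and smD = smooth_T3_det[of g, OF g]
  have smP: "smooth_T3 (\<lambda>x. det (g x) powr a)" for a by (rule smooth_T3_powr[OF smD Dpos])
  have star: "star_coeff g i j = (\<lambda>x. cofactor (g x) i j * det (g x) powr (- 1 / 2))"
    by (rule ext) (simp add: star_coeff_def)
  show "smooth_T3 (star_coeff g i j)" unfolding star by (intro smooth_T3_mult smC smP)
  have dC: "\<bar>partial (\<lambda>x. cofactor (g x) i j) k x\<bar> \<le> 8 * \<delta>" for i j k x
  proof -
    have p: "\<bar>partial (\<lambda>x. g x $ a $ b * g x $ c $ d) k x\<bar> \<le> \<delta> * 2 + 2 * \<delta>" for a b c d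
      by (rule abs_partial_mult_le) (intro g g2 dg)+
    have "partial (\<lambda>x. cofactor (g x) i j) k x =
      partial (\<lambda>x. g x $ (j + 1) $ (i + 1) * g x $ (j + 2) $ (i + 2)) k x
      - partial (\<lambda>x. g x $ (j + 1) $ (i + 2) * g x $ (j + 2) $ (i + 1)) k x"
      unfolding cofactor_def
      by (subst partial_diff) (intro smooth_T3D(1) smooth_T3_mult g refl)+
    then show ?thesis
      using p[of "j + 1" "i + 1" "j + 2" "i + 2"] p[of "j + 1" "i + 2" "j + 2" "i + 1"] by linarith
  qed
  have dD: "\<bar>partial (\<lambda>x. det (g x)) k x\<bar> \<le> 54 * \<delta>" for k x
  proof -
    have p: "\<bar>partial (\<lambda>x. g x $ 1 $ m * cofactor (g x) m 1) k x\<bar> \<le> \<delta> * 2 + 2 * (8 * \<delta>)" for m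
      by (rule abs_partial_mult_le) (intro g g2 dg smC C2 dC)+
    have "partial (\<lambda>x. det (g x)) k x = (\<Sum>m\<in>UNIV. partial (\<lambda>x. g x $ 1 $ m * cofactor (g x) m 1) k x)"
      unfolding det_cofactor by (subst partial_sum) (auto intro!: smooth_T3D(1) smooth_T3_mult g smC)
    then show ?thesis using p[of 1] p[of 2] p[of 3] by (simp add: sum_3 abs_le_iff)
  qed
  have P1: "\<bar>det (g x) powr (- 1 / 2) - 1\<bar> \<le> 108 * \<delta>" for x
  proof -
    let ?s = "sqrt (det (g x))"
    have s: "?s \<ge> 1 / 2" using real_le_rsqrt[of "1 / 2" "det (g x)"] Dl[of x] by (simp add: power2_eq_square)
    have "det (g x) powr (- 1 / 2) = 1 / ?s"
      using Dpos[of x] by (simp add: powr_minus_divide powr_half_sqrt)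
    \<comment> \<open>Rationalising brings out \<open>1 - det (g x)\<close>, which is already
      controlled.\<close>
    moreover have "1 / ?s - 1 = (1 - det (g x)) / (?s * (1 + ?s))"
    proof -
      have "1 / t - 1 = (1 - t * t) / (t * (1 + t))" if "t \<ge> 1 / 2" for t :: real
      proof -
        have "t > 0" "t + t * t > 0" using that by (auto intro: add_pos_pos)
        then show ?thesis by (simp add: divide_simps algebra_simps)
      qed
      from this[OF s] show ?thesis using less_imp_le[OF Dpos[of x]] by simp
    qed
    moreover have "\<bar>(1 - det (g x)) / (?s * (1 + ?s))\<bar> \<le> (54 * \<delta>) / (1 / 2)"
    proof -
      have "1 / 2 * 1 \<le> ?s * (1 + ?s)" using s less_imp_le[OF Dpos[of x]] by (intro mult_mono) auto
      then show ?thesis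
        unfolding abs_divide using D[of x] \<delta>0 by (intro frac_le) (auto simp: abs_minus_commute)
    qed
    ultimately show ?thesis by simp
  qed
  have P2: "\<bar>det (g x) powr (- 1 / 2)\<bar> \<le> 2" for x using P1[of x] \<delta> by linarith
  have P3: "\<bar>partial (\<lambda>x. det (g x) powr (- 1 / 2)) k x\<bar> \<le> 108 * \<delta>" for k x
  proof -
    have "det (g x) powr (- 1 / 2 - 1) \<le> 4"
    proof -
      have "det (g x) powr (- 1 / 2 - 1) = det (g x) powr (- 1 / 2) / det (g x)"
        using powr_diff[of "det (g x)" "- 1 / 2" 1] Dpos[of x] by simp
      also have "\<dots> \<le> 2 / (1 / 2)" using P2[of x] Dl[of x] by (intro frac_le) auto
      finally show ?thesis by simp
    qed
    then have "1 / 2 * det (g x) powr (- 1 / 2 - 1) * \<bar>partial (\<lambda>x. det (g x)) k x\<bar> \<le> 2 * (54 * \<delta>)"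
      using dD[of k x] by (intro mult_mono) auto
    moreover have "\<bar>partial (\<lambda>x. det (g x) powr (- 1 / 2)) k x\<bar> =
        1 / 2 * det (g x) powr (- 1 / 2 - 1) * \<bar>partial (\<lambda>x. det (g x)) k x\<bar>"
      using partial_powr[OF smooth_T3D(1)[OF smD] Dpos, of "- 1 / 2" k] by (simp add: abs_mult)
    ultimately have "\<bar>partial (\<lambda>x. det (g x) powr (- 1 / 2)) k x\<bar> \<le> 2 * (54 * \<delta>)" by linarith
    then show ?thesis by simp
  qed
  have "\<bar>cofactor (g x) i j * det (g x) powr (- 1 / 2) - (if i = j then 1 else 0) * 1\<bar> \<le> 3 * (108 * \<delta>)"
    by (rule abs_mult_diff_le) (use C[of x i j] P1[of x] \<delta> \<delta>0 in auto)
  then show "\<bar>star_coeff g i j x - (if i = j then 1 else 0)\<bar> \<le> 500 * \<delta>"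
    using \<delta>0 by (simp add: star_coeff_def)
  have "\<bar>partial (\<lambda>x. cofactor (g x) i j * det (g x) powr (- 1 / 2)) k x\<bar> \<le> 8 * \<delta> * 2 + 2 * (108 * \<delta>)"
    by (rule abs_partial_mult_le) (intro smC smP C2 P2 dC P3)+
  then show "\<bar>partial (star_coeff g i j) k x\<bar> \<le> 500 * \<delta>"
    unfolding star using \<delta>0 by simp
qed

text \<open>A real supremum is informative only over a set bounded above; periodicity and continuity
  provide that bound, and then both parts of the norm dominate pointwise.\<close>

lemma C1_norm_pointwise:
  assumes g: "\<And>i j. smooth_T3 (\<lambda>x. g x $ i $ j)" and le: "C1_norm (\<lambda>x. g x - mat 1) \<le> \<delta>"
  shows "\<bar>g x $ i $ j - (if i = j then 1 else 0)\<bar> \<le> \<delta>"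
    and "\<bar>partial (\<lambda>x. g x $ i $ j) k x\<bar> \<le> \<delta>"
proof -
  let ?A = "\<lambda>x. g x - mat 1"
  have entry: "(\<lambda>x. ?A x $ i $ j) = (\<lambda>x. g x $ i $ j - (if i = j then 1 else 0))" for i j
    by (rule ext) (simp add: mat_def)
  have sm: "smooth_T3 (\<lambda>x. ?A x $ i $ j)" for i j
    unfolding entry by (intro smooth_T3_diff g smooth_T3_const)
  have pA: "partial (\<lambda>x. ?A x $ i $ j) k = partial (\<lambda>x. g x $ i $ j) k" for i j k
    unfolding entry by (subst partial_diff) (auto simp: partial_const smooth3_const smooth_T3D(1)[OF g])
  obtain B where B: "\<And>i j x. \<bar>?A x $ i $ j\<bar> \<le> B i j" using smooth_T3_bounded[OF sm] by metis
  obtain B' where B': "\<And>i j k x. \<bar>partial (\<lambda>x. ?A x $ i $ j) k x\<bar> \<le> B' i j k"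
    using smooth_T3_bounded[OF smooth_T3_partial[OF sm]] by metis
  have c0: "\<bar>?A x $ i $ j\<bar> \<le> C0_norm ?A" for i j x
  proof -
    have "bdd_above ((\<lambda>(i, j, x). \<bar>?A x $ i $ j\<bar>) ` UNIV)"
    proof (rule bdd_aboveI2)
      fix t :: "3 \<times> 3 \<times> (real^3)"
      have "B (fst t) (fst (snd t)) \<le> (\<Sum>p\<in>UNIV. \<bar>B (fst p) (snd p)\<bar>)"
        using member_le_sum[of "(fst t, fst (snd t))" UNIV "\<lambda>p. \<bar>B (fst p) (snd p)\<bar>"] by simp
      then show "(case t of (i, j, x) \<Rightarrow> \<bar>?A x $ i $ j\<bar>) \<le> (\<Sum>p\<in>UNIV. \<bar>B (fst p) (snd p)\<bar>)"
        unfolding split_beta by (rule order_trans[OF B])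
    qed
    from cSUP_upper[OF UNIV_I this, of "(i, j, x)"] show ?thesis by (simp add: C0_norm_def)
  qed
  have c1: "\<bar>partial (\<lambda>x. ?A x $ i $ j) k x\<bar> \<le> dC0_norm ?A" for i j k x
  proof -
    have "bdd_above ((\<lambda>(i, j, k, x). \<bar>partial (\<lambda>y. ?A y $ i $ j) k x\<bar>) ` UNIV)"
    proof (rule bdd_aboveI2)
      fix t :: "3 \<times> 3 \<times> 3 \<times> (real^3)"
      have "B' (fst t) (fst (snd t)) (fst (snd (snd t))) \<le> (\<Sum>p\<in>UNIV. \<bar>B' (fst p) (fst (snd p)) (snd (snd p))\<bar>)"
        using member_le_sum[of "(fst t, fst (snd t), fst (snd (snd t)))" UNIV
            "\<lambda>p. \<bar>B' (fst p) (fst (snd p)) (snd (snd p))\<bar>"] by simp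
      then show "(case t of (i, j, k, x) \<Rightarrow> \<bar>partial (\<lambda>y. ?A y $ i $ j) k x\<bar>)
          \<le> (\<Sum>p\<in>UNIV. \<bar>B' (fst p) (fst (snd p)) (snd (snd p))\<bar>)"
        unfolding split_beta by (rule order_trans[OF B'])
    qed
    from cSUP_upper[OF UNIV_I this, of "(i, j, k, x)"] show ?thesis by (simp add: dC0_norm_def)
  qed
  have sum: "C0_norm ?A + dC0_norm ?A \<le> \<delta>" using le by (simp add: C1_norm_def)
  have "0 \<le> C0_norm ?A" "0 \<le> dC0_norm ?A"
    using c0[of 0 1 1] c1[of 1 1 1 0] by linarith+
  then show "\<bar>g x $ i $ j - (if i = j then 1 else 0)\<bar> \<le> \<delta>" "\<bar>partial (\<lambda>x. g x $ i $ j) k x\<bar> \<le> \<delta>"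
    using c0[of x i j] c1[of i j k x, unfolded pA] sum fun_cong[OF entry, of x i j] by simp_all
qed

text \<open>Crude factors suffice: 9 * 193 = 1737 bounds \<open>C_reg\<close> from below, so
  \<open>C_S\<close> exceeds 27 * 17370 > 400000, and 1 + 27 * 13.25 > 300. The other summands are
  nonnegative.\<close>

lemma C_flat_large: "C_flat \<ge> 1000000"
proof -
  have s3: "sqrt 3 * sqrt 3 = (3::real)" "sqrt 3 \<ge> (1::real)" by simp_all
  \<comment> \<open>The rational parts cancel exactly, leaving a positive multiple of sqrt
    3.\<close>
  have chi: "C_Dchi = 10 * sqrt 3"
  proof -
    have "(9 + sqrt 3)^2 = 84 + 18 * sqrt (3::real)"
      using s3(1) by (simp add: power2_eq_square algebra_simps)
    moreover from this have "(9 + sqrt 3)^3 = 810 + 246 * sqrt (3::real)"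
      using s3(1) by (simp add: power3_eq_cube power2_eq_square algebra_simps)
    ultimately show ?thesis unfolding C_Dchi_def by (simp add: field_simps)
  qed
  have reg: "C_reg \<ge> 1737"
    unfolding C_reg_def C_CZ_def C_P_def by simp
  have "1737 * 10 \<le> C_reg * C_Dchi" unfolding chi using reg s3(2) by (intro mult_mono) auto
  moreover have "0 \<le> (2 + 54 * 27 * sqrt 17) * C_reg * C_H * C_D2chi * K_const"
  proof -
    have "6 \<le> 5 * sqrt (3::real)"
      using real_le_rsqrt[of "6 / 5" 3] by (simp add: power2_eq_square)
    then have "C_D2chi \<ge> 0" by (simp add: C_D2chi_def)
    then show ?thesis using reg unfolding C_H_def K_const_def by (intro mult_nonneg_nonneg) auto
  qed
  ultimately have S: "C_S \<ge> 400000" unfolding C_S_def by simp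
  have "C_S * 300 \<le> C_S * (1 + 27 * C_cube)" using S by (intro mult_left_mono) (auto simp: C_cube_def)
  moreover have "0 \<le> 1 / (4 * pi^2) * C_S * C_cube * (1 + 27 * sqrt 17)"
    using S by (intro mult_nonneg_nonneg) (auto simp: C_cube_def)
  ultimately show ?thesis using S unfolding C_flat_def by linarith
qed

text \<open>Only the linear term is kept: \<open>D_plus d \<ge> 1\<close> makes the other
  contributions nonnegative.\<close>

lemma C_abs_lower:
  assumes "d \<ge> 0" shows "C_abs d \<ge> 6 * d"
proof -
  have "1 \<le> (1 + d) ^ 3" using assms by (intro one_le_power) auto
  then have "D_plus d \<ge> 1" using assms unfolding D_plus_def by (simp add: add_increasing2)
  then have "D_plus d powr (1 / (2 * p_exp)) \<ge> 1" by (intro ge_one_powr_ge_zero) (simp_all add: p_exp_def)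
  then have "0 \<le> (D_plus d powr (1 / (2 * p_exp)) - 1) * (1 + 2 * d)"
    "0 \<le> 9 * sqrt 3 * (1 + 2 * d) * Gamma0 d * D_plus d powr (1 / (2 * p_exp))"
    using assms by (auto simp: Gamma0_def)
  moreover have "6 * d \<le> 3 * (X + 2 * d) + Y" if "0 \<le> X" "0 \<le> Y" for X Y using that by simp
  ultimately show ?thesis unfolding C_abs_def by blast
qed

theorem theorem1p4:
  fixes g :: "real^3 \<Rightarrow> real^3^3" and \<delta>0 \<delta> :: real
  assumes "riemannian_metric_T3 g"
    and "\<delta>0 > 0" and "C_abs \<delta>0 < 1 / C_flat"
    and "0 < \<delta>" and "\<delta> < \<delta>0" and "C_end \<delta> > 0"
    and "C1_norm (\<lambda>x. g x - mat 1) \<le> \<delta>"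
  shows "\<exists>\<xi>. smooth_T3 \<xi> \<and> nowhere_vanishing (one_form \<xi>) \<and> harmonic_1form g (one_form \<xi>)"
proof -
  have g: "smooth_T3 (\<lambda>x. g x $ i $ j)" for i j
    using assms(1) unfolding riemannian_metric_T3_def by blast
  have g_sym: "g x $ i $ j = g x $ j $ i" for x i j
  proof -
    have "transpose (g x) $ i $ j = g x $ i $ j"
      using assms(1) unfolding riemannian_metric_T3_def by simp
    then show ?thesis by (simp add: transpose_def)
  qed
  \<comment> \<open>Hence 500 \<delta> lies below 1/1000, the threshold of
    \<open>corrector_small_gradient\<close>.\<close>
  have "6 * \<delta>0 < 1 / 1000000"
  proof -
    have "6 * \<delta>0 \<le> C_abs \<delta>0" using assms(2) by (intro C_abs_lower) simp
    also have "\<dots> < 1 / C_flat" by (rule assms(3))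
    also have "\<dots> \<le> 1 / 1000000" using C_flat_large by (intro divide_left_mono) auto
    finally show ?thesis .
  qed
  then have \<delta>: "500 * \<delta> \<le> 1 / 1000" "\<delta> \<le> 1 / 1000" "0 < 500 * \<delta>" using assms(4,5) by linarith+
  note near = C1_norm_pointwise[of g, OF g assms(7)]
  note star = star_coeff_bounds[of g, OF g near(1) near(2) \<delta>(2)]
  have star_sym: "star_coeff g i j x = star_coeff g j i x" for i j x
    unfolding star_coeff_def cofactor_def by (simp add: g_sym[of x] mult.commute)
  have e1: "\<bar>axis (1::3) (1::real) $ j\<bar> \<le> 1" for j by (simp add: axis_def)
  obtain \<xi> where \<xi>: "smooth_T3 \<xi>" "\<And>k x. \<bar>partial \<xi> k x\<bar> < 1"
    and eq: "\<And>x. (\<Sum>i\<in>UNIV. partial (\<lambda>y. \<Sum>j\<in>UNIV. star_coeff g i j y * (axis 1 1 $ j + partial \<xi> j y)) i x) = 0"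
    using corrector_small_gradient[of "star_coeff g" "500 * \<delta>" "axis 1 1", OF star(2) star_sym star(3) star(4) \<delta>(3,1) e1]
    by blast
  have form: "one_form \<xi> y $ j = axis 1 1 $ j + partial \<xi> j y" for y j by (simp add: one_form_def)
  have "nowhere_vanishing (one_form \<xi>)"
    unfolding nowhere_vanishing_def
  proof
    fix x
    \<comment> \<open>The first component is 1 plus a partial derivative of modulus below 1.\<close>
    have "one_form \<xi> x $ 1 > 0" using \<xi>(2)[of 1 x] by (simp add: form abs_less_iff)
    then show "one_form \<xi> x \<noteq> 0" by auto
  qed
  moreover have "harmonic_1form g (one_form \<xi>)"
    unfolding harmonic_1form_def
  proof (intro conjI allI)
    fix i j x
    \<comment> \<open>Closedness is the symmetry of second derivatives, once the constant part has
      dropped out.\<close>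
    have "partial (\<lambda>y. one_form \<xi> y $ j) i = partial (partial \<xi> j) i" for i j
      unfolding form
      by (subst partial_add) (auto simp: partial_const smooth3_const smooth_T3D(1) smooth_T3_partial \<xi>)
    then show "partial (\<lambda>y. one_form \<xi> y $ j) i x = partial (\<lambda>y. one_form \<xi> y $ i) j x"
      by (simp add: partial_commute[OF \<xi>(1), of i j])
  next
    fix x
    have "sqrt (det (g y)) * (\<Sum>j\<in>UNIV. matrix_inv (g y) $ i $ j * one_form \<xi> y $ j) =
        (\<Sum>j\<in>UNIV. star_coeff g i j y * (axis 1 1 $ j + partial \<xi> j y))" for i y
      unfolding form star_coeff_eq[of g y, OF star(1), symmetric] by (simp add: sum_distrib_left mult.assoc)
    then show "(\<Sum>i\<in>UNIV. partial (\<lambda>y. sqrt (det (g y)) *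
        (\<Sum>j\<in>UNIV. matrix_inv (g y) $ i $ j * one_form \<xi> y $ j)) i x) = 0"
      using eq by simp
  qed
  ultimately show ?thesis using \<xi>(1) by blast
qed

end
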